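(* Let $M$ be a Hausdorff separable manifold with a continuous action $\alpha$ of $\mathbb{T}^n$ such that $\Delta=M/\mathbb{T}^n$ is a locally closed part of a Hausdorff manifold $N$ endowed with an action $\beta$ of $\mathbb{R}^n$ by diffeomorphisms. Suppose that the groupoid $G$ (defined in the context) is étale, and that the projection $J:M\to\Delta\subset N$ is smooth as a map to $N$ and has a continuous section $\sigma:\Delta\to M$ such that $k_\sigma:M_k\to\mathbb{T}$ is smooth for every $k\in\mathbb{Z}^n$. Let $\Omega$ be the Poisson bivector on $M$ such that $G$ is a deformation groupoid of $(M,\Omega)$ via the sub-$*$-algebra $\mathcal{Q}=C_c^\infty(G\subset\widetilde G)$ and the isomorphism $\mathcal{I}:C_0(M)\to C^*(G_0)$. Suppose moreover that: (1) the torus $\mathbb{T}^n$ acts (by $\alpha$) on $M$ by diffeomorphisms; (2) $\Delta(\infty)=\{y\in\Delta:\mathbb{T}^n_y=\{1\}\}$ is open in $N$ and dense in $\Delta$; (3) the restricted map $\rho:\Delta(\infty)\times\mathbb{T}^n\to M_\infty$, $\rho(y,s)=\alpha_s(\sigma(y))$, is a diffeomorphism, where $M_\infty=J^{-1}(\Delta(\infty))$. Then on $M_\infty$ the Poisson structure is given by the bivector $$\Omega=\sum_{i=1}^n\xi^\alpha_{E_i}\wedge\rho_*(\xi^\beta_{E_i}).$$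
   Context: $\mathbb{T}=\{z\in\mathbb{C}:|z|=1\}$; "separable" means second countable. $J:M\to\Delta$ is the canonical projection. For $y\in\Delta$, $\mathbb{T}^n_y=\{s\in\mathbb{T}^n:\alpha_s(x)=x\}$ is the common isotropy subgroup of all $x\in J^{-1}(y)$. For $k\in\mathbb{Z}^n$, $s\in\mathbb{T}^n$: $\langle k,s\rangle=s_1^{k_1}\cdots s_n^{k_n}$; $\Delta(k)=\{y\in\Delta:s\in\mathbb{T}^n_y\Rightarrow\langle k,s\rangle=1\}$; $M_k=J^{-1}(\Delta(k))$; $k_\sigma:M_k\to\mathbb{T}$ is the well-defined function with $k_\sigma(\alpha_s(\sigma(y)))=\langle k,s\rangle$ for $y\in\Delta(k)$, $s\in\mathbb{T}^n$. $\widetilde G=(\mathbb{R}\times N)\rtimes\mathbb{Z}^n$ is the groupoid with elements $(\hbar,y,k)\in\mathbb{R}\times N\times\mathbb{Z}^n$, source $(\hbar,y)$, range $(\hbar,\beta_{\hbar k}(y))$, product $(\hbar,\beta_{\hbar m}(y),l)(\hbar,y,m)=(\hbar,y,l+m)$. $G=\{(\hbar,y,k)\in\widetilde G: y,\beta_{\hbar k}(y)\in\Delta(k),\ \mathbb{T}^n_y=\mathbb{T}^n_{\beta_{\hbar k}(y)}\}$ is a subgroupoid with unit space $\mathbb{R}\times\Delta$ and the induced topology, bundled over $\mathbb{R}$ with fibers $G_\hbar$; $G_0$ is its fiber at $\hbar=0$, i.e. $\bigcup_k\{0\}\times\Delta(k)\times\{k\}$. A locally compact Hausdorff separable groupoid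 is étale if the fibers of its range map are discrete and the counting measures form a continuous Haar system. Convolution is $(f*f')(g)=\sum_{g_1g_2=g}f(g_1)f'(g_2)$ and $f^*(g)=\overline{f(g^{-1})}$. $C_c^\infty(G\subset\widetilde G)$ is the space of $f\in C_c(G)$ admitting an extension in $C^\infty(\widetilde G)$. $\mathcal{I}:C_0(M)\to C^*(G_0)$ is the $C^*$-isomorphism with $(\mathcal{I}^{-1}f_0)(x)=\sum_{k:\,J(x)\in\Delta(k)}f_0(0,J(x),k)\,k_\sigma(x)$ for $f_0\in C_c(G_0)$. That $G$ is a deformation groupoid of $(M,\Omega)$ via $\mathcal{Q},\mathcal{I}$ means: $(C^*(G_\hbar))_{\hbar\in\mathbb{R}}$ is a continuous field with algebra of continuous sections $C^*(G)$; $\mathcal{Q}_0=\{f_0=f|_{G_0}:f\in\mathcal{Q}\}$ is dense in $C^*(G_0)$; $\mathcal{I}^{-1}(\mathcal{Q}_0)\subset C_0^\infty(M)$ (smooth functions vanishing at infinity); and for all $f,f'\in\mathcal{Q}$ the section $\hbar\mapsto\frac{1}{\imath\hbar}[f_\hbar,f'_\hbar]$ ($\hbar\ne0$) extends continuously at $\hbar=0$ by an element $\{f_0,f'_0\}_0\in\mathcal{Q}_0$ with $\{f_0,f'_0\}_0=\mathcal{I}(\{\mathcal{I}^{-1}f_0,\mathcal{I}^{-1}f'_0\}_\Omega)$. Here $\{u,v\}_\Omega=\langle du\otimes dv,\Omega\rangle$, and $A\wedge B=A\otimes B-B\otimes A$ for vector fields. $E_1,\dots,E_n$ is the standard basis of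 $\mathbb{R}^n$, identified with $\mathrm{Lie}(\mathbb{T}^n)$ and its dual so that $(E_i|E_j)=\delta_{ij}$, $(k|E_i)=k_i$ and $\langle k,\exp X\rangle=e^{\imath(k|X)}$ for $k\in\mathbb{Z}^n$, $X\in\mathbb{R}^n$. For $X\in\mathbb{R}^n$: $\xi^\alpha_X(x)=\frac{d}{dt}\alpha_{\exp(tX)}(x)|_{t=0}$ on $M$ and $\xi^\beta_X(y)=\frac{d}{dt}\beta_{tX}(y)|_{t=0}$ on $N$. In $\rho_*(\xi^\beta_{E_i})$, $\xi^\beta_{E_i}$ is regarded as the vector field $(\xi^\beta_{E_i},0)$ on $\Delta(\infty)\times\mathbb{T}^n$. *)

theory Defs
  imports "HOL-Analysis.Analysis"
begin

section \<open>Smooth manifolds\<close>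

text \<open>C-k maps between open subsets of finite-dimensional spaces: all iterated
  directional derivatives up to order k exist and are continuous.\<close>

primrec Ck_on :: "nat \<Rightarrow> 'a::real_normed_vector set \<Rightarrow> ('a \<Rightarrow> 'b::real_normed_vector) \<Rightarrow> bool" where
  "Ck_on 0 S f \<longleftrightarrow> continuous_on S f"
| "Ck_on (Suc k) S f \<longleftrightarrow> (\<forall>x\<in>S. f differentiable at x) \<and>
     (\<forall>v. Ck_on k S (\<lambda>x. frechet_derivative f (at x) v))"

definition smooth_on :: "'a::real_normed_vector set \<Rightarrow> ('a \<Rightarrow> 'b::real_normed_vector) \<Rightarrow> bool" where
  "smooth_on S f \<longleftrightarrow> (\<forall>k. Ck_on k S f)"

text \<open>A chart is a pair of its domain and its coordinate map. The underlying set of a manifold,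
  the union of the chart domains, carries the subspace topology of the ambient type.\<close>

type_synonym ('a, 'e) atlas = "('a set \<times> ('a \<Rightarrow> 'e)) set"

definition points :: "('a, 'e) atlas \<Rightarrow> 'a set" where
  "points A = \<Union> (fst ` A)"

text \<open>The model space is a \<open>real_inner\<close> type with a finite spanning set rather than a
  \<open>euclidean_space\<close>, because the latter class excludes dimension 0.\<close>

definition smooth_manifold :: "('a::t2_space, 'e::real_inner) atlas \<Rightarrow> bool" where
  "smooth_manifold A \<longleftrightarrow>
     (\<exists>B::'e set. finite B \<and> span B = UNIV) \<and>
     (\<forall>(U, \<phi>)\<in>A. openin (top_of_set (points A)) U \<and> open (\<phi> ` U) \<and>
        homeomorphism U (\<phi> ` U) \<phi> (inv_into U \<phi>)) \<and>
     (\<forall>(U, \<phi>)\<in>A. \<forall>(V, \<psi>)\<in>A. smooth_on (\<phi> ` (U \<inter> V)) (\<psi> \<circ> inv_into U \<phi>))"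

definition smooth_map ::
  "('a::topological_space, 'e::real_normed_vector) atlas \<Rightarrow> ('b::topological_space, 'f::real_normed_vector) atlas
    \<Rightarrow> ('a \<Rightarrow> 'b) \<Rightarrow> bool" where
  "smooth_map A B f \<longleftrightarrow> continuous_on (points A) f \<and> f ` points A \<subseteq> points B \<and>
     (\<forall>(U, \<phi>)\<in>A. \<forall>(V, \<psi>)\<in>B. smooth_on (\<phi> ` (U \<inter> f -` V)) (\<psi> \<circ> f \<circ> inv_into U \<phi>))"

definition diffeo ::
  "('a::topological_space, 'e::real_normed_vector) atlas \<Rightarrow> ('b::topological_space, 'f::real_normed_vector) atlas
    \<Rightarrow> ('a \<Rightarrow> 'b) \<Rightarrow> bool" where
  "diffeo A B f \<longleftrightarrow> bij_betw f (points A) (points B) \<and> smooth_map A B f \<and>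
     smooth_map B A (inv_into (points A) f)"

definition restrict_atlas :: "('a, 'e) atlas \<Rightarrow> 'a set \<Rightarrow> ('a, 'e) atlas" where
  "restrict_atlas A S = {(U \<inter> S, \<phi>) | U \<phi>. (U, \<phi>) \<in> A}"

definition prod_atlas :: "('a, 'e) atlas \<Rightarrow> ('b, 'f) atlas \<Rightarrow> ('a \<times> 'b, 'e \<times> 'f) atlas" where
  "prod_atlas A B = {(U \<times> V, \<lambda>(x, y). (\<phi> x, \<psi> y)) | U \<phi> V \<psi>. (U, \<phi>) \<in> A \<and> (V, \<psi>) \<in> B}"

definition smooth_fun :: "('a::topological_space, 'e::real_normed_vector) atlas \<Rightarrow> ('a \<Rightarrow> complex) \<Rightarrow> bool" where
  "smooth_fun A u \<longleftrightarrow> smooth_map A {(UNIV, id)} u"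


section \<open>Tangent vectors and bivectors\<close>

text \<open>Tangent vectors are directional derivatives acting on smooth complex-valued functions
  (real vectors, extended complex-linearly), and are set to 0 on non-smooth functions so that equality of
  tangent vectors is equality of HOL functions.\<close>

type_synonym 'a tvec = "('a \<Rightarrow> complex) \<Rightarrow> complex"

definition tangent_space :: "('a::topological_space, 'e::real_normed_vector) atlas \<Rightarrow> 'a \<Rightarrow> 'a tvec set" where
  "tangent_space A x = {v. \<exists>(U, \<phi>)\<in>A. x \<in> U \<and> (\<exists>w. v = (\<lambda>u. if smooth_fun A u
     then frechet_derivative (u \<circ> inv_into U \<phi>) (at (\<phi> x)) w else 0))}"

definition velocity :: "('a::topological_space, 'e::real_normed_vector) atlas \<Rightarrow> (real \<Rightarrow> 'a) \<Rightarrow> 'a tvec" where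
  "velocity A c = (\<lambda>u. if smooth_fun A u then vector_derivative (\<lambda>t. u (c t)) (at 0) else 0)"

text \<open>The vector (v, 0) at the point (y, s) of a product manifold.\<close>

definition first_factor_vec ::
  "('a::topological_space, 'e::real_normed_vector) atlas \<Rightarrow> ('b::topological_space, 'f::real_normed_vector) atlas
    \<Rightarrow> 'b \<Rightarrow> 'a tvec \<Rightarrow> ('a \<times> 'b) tvec" where
  "first_factor_vec A B s v =
     (\<lambda>h. if smooth_fun (prod_atlas A B) h then v (\<lambda>y. h (y, s)) else 0)"

text \<open>Push-forward by f of a vector field on A. The target may be an open part of the manifold B;
  the resulting tangent vectors act on the smooth functions of B.\<close>

definition pushforward ::
  "('a, 'e) atlas \<Rightarrow> ('b::topological_space, 'f::real_normed_vector) atlas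
    \<Rightarrow> ('a \<Rightarrow> 'b) \<Rightarrow> ('a \<Rightarrow> 'a tvec) \<Rightarrow> 'b \<Rightarrow> 'b tvec" where
  "pushforward A B f V x =
     (\<lambda>u. if smooth_fun B u then V (inv_into (points A) f x) (u \<circ> f) else 0)"

text \<open>An element T of the tensor square of a tangent space is identified with the map sending
  (u, v) to the pairing of T with du \<open>\<otimes>\<close> dv.\<close>

type_synonym 'a tvec2 = "('a \<Rightarrow> complex) \<Rightarrow> ('a \<Rightarrow> complex) \<Rightarrow> complex"

definition tensor :: "'a tvec \<Rightarrow> 'a tvec \<Rightarrow> 'a tvec2" where
  "tensor a b = (\<lambda>u v. a u * b v)"

definition wedge :: "'a tvec \<Rightarrow> 'a tvec \<Rightarrow> 'a tvec2" where
  "wedge a b = (\<lambda>u v. tensor a b u v - tensor b a u v)"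

definition bivectors :: "('a::topological_space, 'e::real_normed_vector) atlas \<Rightarrow> 'a \<Rightarrow> 'a tvec2 set" where
  "bivectors A x = {\<lambda>u v. \<Sum>j<m. wedge (a j) (b j) u v | a b (m::nat).
     \<forall>j<m. a j \<in> tangent_space A x \<and> b j \<in> tangent_space A x}"

definition pbracket :: "('a \<Rightarrow> 'a tvec2) \<Rightarrow> ('a \<Rightarrow> complex) \<Rightarrow> ('a \<Rightarrow> complex) \<Rightarrow> 'a \<Rightarrow> complex" where
  "pbracket \<Omega> u v = (\<lambda>x. \<Omega> x u v)"

definition poisson_bivector :: "('a::topological_space, 'e::real_normed_vector) atlas \<Rightarrow> ('a \<Rightarrow> 'a tvec2) \<Rightarrow> bool" where
  "poisson_bivector A \<Omega> \<longleftrightarrow>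
     (\<forall>x\<in>points A. \<Omega> x \<in> bivectors A x) \<and>
     (\<forall>u v. smooth_fun A u \<longrightarrow> smooth_fun A v \<longrightarrow> smooth_fun A (pbracket \<Omega> u v)) \<and>
     (\<forall>u v w. smooth_fun A u \<longrightarrow> smooth_fun A v \<longrightarrow> smooth_fun A w \<longrightarrow>
        (\<forall>x\<in>points A. pbracket \<Omega> u (pbracket \<Omega> v w) x + pbracket \<Omega> v (pbracket \<Omega> w u) x
           + pbracket \<Omega> w (pbracket \<Omega> u v) x = 0))"


section \<open>The torus\<close>

definition torus :: "(complex ^ 'n) set" where
  "torus = {s. \<forall>i. s $ i \<in> sphere 0 1}"

text \<open>The charts of the circle are the continuous local branches of the argument.\<close>

definition circle_atlas :: "(complex, real) atlas" where
  "circle_atlas = {(U, \<theta>). openin (top_of_set (sphere 0 1)) U \<and> continuous_on U \<theta> \<and>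
     (\<forall>z\<in>U. cis (\<theta> z) = z)}"

definition torus_atlas :: "(complex ^ 'n, real ^ 'n) atlas" where
  "torus_atlas = {({s. \<forall>i. s $ i \<in> U i}, \<lambda>s. \<chi> i. \<theta> i (s $ i)) | U \<theta>.
     \<forall>i. (U i, \<theta> i) \<in> circle_atlas}"

definition torus_exp :: "real ^ 'n \<Rightarrow> complex ^ 'n" where
  "torus_exp X = (\<chi> i. cis (X $ i))"

definition character :: "int ^ 'n \<Rightarrow> complex ^ 'n \<Rightarrow> complex" where
  "character k s = (\<Prod>i\<in>UNIV. (s $ i) powi (k $ i))"

definition torus_action :: "(complex ^ 'n \<Rightarrow> 'm::topological_space \<Rightarrow> 'm) \<Rightarrow> bool" where
  "torus_action \<alpha> \<longleftrightarrow> (\<forall>x. \<alpha> 1 x = x) \<and>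
     (\<forall>s\<in>torus. \<forall>t\<in>torus. \<forall>x. \<alpha> (s * t) x = \<alpha> s (\<alpha> t x)) \<and>
     continuous_on (torus \<times> UNIV) (\<lambda>(s, x). \<alpha> s x)"

text \<open>Besides being a continuous action by diffeomorphisms, an action of \<open>\<real>\<^sup>n\<close> is required
  to have orbit maps with a velocity at time 0 in every direction; this is what makes the fundamental vector
  fields meaningful.\<close>

definition vector_action :: "('p::topological_space, 'f::real_normed_vector) atlas
    \<Rightarrow> (real ^ 'n \<Rightarrow> 'p \<Rightarrow> 'p) \<Rightarrow> bool" where
  "vector_action A \<beta> \<longleftrightarrow> (\<forall>y. \<beta> 0 y = y) \<and> (\<forall>X Y y. \<beta> (X + Y) y = \<beta> X (\<beta> Y y)) \<and>
     continuous_on UNIV (\<lambda>(X, y). \<beta> X y) \<and>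
     (\<forall>X. diffeo A A (\<beta> X)) \<and>
     (\<forall>X y. \<forall>(U, \<phi>)\<in>A. y \<in> U \<longrightarrow> (\<lambda>t. \<phi> (\<beta> (t *\<^sub>R X) y)) differentiable at (0::real))"

text \<open>In \<open>xi_beta\<close> the atlas may be the restriction of that of N to an open subset, which
  the orbit through y need only meet for small times.\<close>

definition xi_alpha :: "('m::topological_space, 'e::real_normed_vector) atlas
    \<Rightarrow> (complex ^ 'n \<Rightarrow> 'm \<Rightarrow> 'm) \<Rightarrow> real ^ 'n \<Rightarrow> 'm \<Rightarrow> 'm tvec" where
  "xi_alpha A \<alpha> X x = velocity A (\<lambda>t. \<alpha> (torus_exp (t *\<^sub>R X)) x)"

definition xi_beta :: "('p::topological_space, 'f::real_normed_vector) atlas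
    \<Rightarrow> (real ^ 'n \<Rightarrow> 'p \<Rightarrow> 'p) \<Rightarrow> real ^ 'n \<Rightarrow> 'p \<Rightarrow> 'p tvec" where
  "xi_beta A \<beta> X y = velocity A (\<lambda>t. \<beta> (t *\<^sub>R X) y)"


section \<open>Star-algebras, completions and continuous fields\<close>

record 'a star_alg =
  elems :: "'a set"
  alg_add :: "'a \<Rightarrow> 'a \<Rightarrow> 'a"
  scale :: "complex \<Rightarrow> 'a \<Rightarrow> 'a"
  alg_mult :: "'a \<Rightarrow> 'a \<Rightarrow> 'a"
  star :: "'a \<Rightarrow> 'a"
  nrm :: "'a \<Rightarrow> real"

definition alg_sub :: "'a star_alg \<Rightarrow> 'a \<Rightarrow> 'a \<Rightarrow> 'a" where
  "alg_sub A a b = alg_add A a (scale A (- 1) b)"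

definition star_hom :: "'a star_alg \<Rightarrow> 'b star_alg \<Rightarrow> ('a \<Rightarrow> 'b) \<Rightarrow> bool" where
  "star_hom A B h \<longleftrightarrow> h ` elems A \<subseteq> elems B \<and>
     (\<forall>a\<in>elems A. \<forall>b\<in>elems A. h (alg_add A a b) = alg_add B (h a) (h b) \<and> h (alg_mult A a b) = alg_mult B (h a) (h b)) \<and>
     (\<forall>a\<in>elems A. h (star A a) = star B (h a) \<and> (\<forall>c. h (scale A c a) = scale B c (h a)))"

definition star_iso :: "'a star_alg \<Rightarrow> 'b star_alg \<Rightarrow> ('a \<Rightarrow> 'b) \<Rightarrow> bool" where
  "star_iso A B h \<longleftrightarrow> star_hom A B h \<and> bij_betw h (elems A) (elems B)"

definition star_subalgebra :: "'a star_alg \<Rightarrow> 'a set \<Rightarrow> bool" where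
  "star_subalgebra A S \<longleftrightarrow> S \<subseteq> elems A \<and> S \<noteq> {} \<and>
     (\<forall>a\<in>S. \<forall>b\<in>S. alg_add A a b \<in> S \<and> alg_mult A a b \<in> S) \<and>
     (\<forall>a\<in>S. star A a \<in> S \<and> (\<forall>c. scale A c a \<in> S))"

text \<open>The Hausdorff completion with respect to the (semi)norm; its elements are classes of Cauchy
  sequences. The maps \<open>emb\<close> and \<open>completion_map\<close> are the canonical map into
  the completion and the extension of a contractive map to the completions.\<close>

definition cauchy_in :: "'a star_alg \<Rightarrow> (nat \<Rightarrow> 'a) \<Rightarrow> bool" where
  "cauchy_in A u \<longleftrightarrow> (\<forall>i. u i \<in> elems A) \<and>
     (\<forall>e>0. \<exists>N. \<forall>i\<ge>N. \<forall>j\<ge>N. nrm A (alg_sub A (u i) (u j)) < e)"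

definition cls :: "'a star_alg \<Rightarrow> (nat \<Rightarrow> 'a) \<Rightarrow> (nat \<Rightarrow> 'a) set" where
  "cls A u = {v. cauchy_in A v \<and> (\<lambda>i. nrm A (alg_sub A (u i) (v i))) \<longlonglongrightarrow> 0}"

definition rep :: "(nat \<Rightarrow> 'a) set \<Rightarrow> nat \<Rightarrow> 'a" where
  "rep X = (SOME u. u \<in> X)"

definition completion :: "'a star_alg \<Rightarrow> (nat \<Rightarrow> 'a) set star_alg" where
  "completion A = \<lparr>
     elems = cls A ` {u. cauchy_in A u},
     alg_add = (\<lambda>X Y. cls A (\<lambda>i. alg_add A (rep X i) (rep Y i))),
     scale = (\<lambda>c X. cls A (\<lambda>i. scale A c (rep X i))),
     alg_mult = (\<lambda>X Y. cls A (\<lambda>i. alg_mult A (rep X i) (rep Y i))),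
     star = (\<lambda>X. cls A (\<lambda>i. star A (rep X i))),
     nrm = (\<lambda>X. lim (\<lambda>i. nrm A (rep X i))) \<rparr>"

definition emb :: "'a star_alg \<Rightarrow> 'a \<Rightarrow> (nat \<Rightarrow> 'a) set" where
  "emb A a = cls A (\<lambda>_. a)"

definition completion_map :: "'b star_alg \<Rightarrow> ('a \<Rightarrow> 'b) \<Rightarrow> (nat \<Rightarrow> 'a) set \<Rightarrow> (nat \<Rightarrow> 'b) set" where
  "completion_map B h X = cls B (\<lambda>i. h (rep X i))"

definition C0 :: "('x::topological_space \<Rightarrow> complex) set" where
  "C0 = {f. continuous_on UNIV f \<and> (\<forall>e>0. \<exists>K. compact K \<and> (\<forall>x. x \<notin> K \<longrightarrow> norm (f x) < e))}"

definition C0_alg :: "('x::topological_space \<Rightarrow> complex) star_alg" where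
  "C0_alg = \<lparr> elems = C0, alg_add = (\<lambda>f g x. f x + g x), scale = (\<lambda>c f x. c * f x),
     alg_mult = (\<lambda>f g x. f x * g x), star = (\<lambda>f x. cnj (f x)), nrm = (\<lambda>f. SUP x. norm (f x)) \<rparr>"

definition C0_smooth :: "('m::topological_space, 'e::real_normed_vector) atlas \<Rightarrow> ('m \<Rightarrow> complex) set" where
  "C0_smooth A = {u \<in> C0. smooth_fun A u}"

text \<open>Continuous fields of C*-algebras over \<open>\<real>\<close> in the sense of Landsman (equivalently,
  Kirchberg-Wassermann): \<open>A\<close> is the algebra of continuous sections vanishing at infinity and
  \<open>ev h\<close> is the evaluation of sections at h.\<close>

definition continuous_field :: "'a star_alg \<Rightarrow> (real \<Rightarrow> 'b star_alg) \<Rightarrow> (real \<Rightarrow> 'a \<Rightarrow> 'b) \<Rightarrow> bool" where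
  "continuous_field A B ev \<longleftrightarrow>
     (\<forall>h. star_hom A (B h) (ev h) \<and> ev h ` elems A = elems (B h)) \<and>
     (\<forall>a\<in>elems A. (\<lambda>h. complex_of_real (nrm (B h) (ev h a))) \<in> C0) \<and>
     (\<forall>a\<in>elems A. nrm A a = (SUP h. nrm (B h) (ev h a))) \<and>
     (\<forall>f\<in>C0. \<forall>a\<in>elems A. \<exists>b\<in>elems A. \<forall>h. ev h b = scale (B h) (f h) (ev h a))"

text \<open>Continuity at a point (Dixmier) of a not necessarily continuous section s of the field.\<close>

definition section_continuous_at ::
  "'a star_alg \<Rightarrow> (real \<Rightarrow> 'b star_alg) \<Rightarrow> (real \<Rightarrow> 'a \<Rightarrow> 'b) \<Rightarrow> (real \<Rightarrow> 'b) \<Rightarrow> real \<Rightarrow> bool" where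
  "section_continuous_at A B ev s h0 \<longleftrightarrow>
     (\<forall>e>0. \<exists>a\<in>elems A. \<forall>\<^sub>F h in nhds h0. nrm (B h) (alg_sub (B h) (s h) (ev h a)) < e)"


section \<open>Topological groupoids and their C*-algebras\<close>

record ('g, 'u) groupoid =
  arrows :: "'g set"
  src :: "'g \<Rightarrow> 'u"
  rng :: "'g \<Rightarrow> 'u"
  gcomp :: "'g \<Rightarrow> 'g \<Rightarrow> 'g"
  ginv :: "'g \<Rightarrow> 'g"

definition units :: "('g, 'u) groupoid \<Rightarrow> 'u set" where
  "units G = src G ` arrows G"

definition range_fiber :: "('g, 'u) groupoid \<Rightarrow> 'u \<Rightarrow> 'g set" where
  "range_fiber G u = {g \<in> arrows G. rng G g = u}"

definition source_fiber :: "('g, 'u) groupoid \<Rightarrow> 'u \<Rightarrow> 'g set" where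
  "source_fiber G u = {g \<in> arrows G. src G g = u}"

text \<open>Functions on a groupoid are represented by their extension by 0 to the ambient type; no
  continuity outside of \<open>arrows G\<close> is required.\<close>

definition Cc :: "('g::topological_space, 'u) groupoid \<Rightarrow> ('g \<Rightarrow> complex) set" where
  "Cc G = {f. continuous_on (arrows G) f \<and>
     (\<exists>K. compact K \<and> K \<subseteq> arrows G \<and> (\<forall>g. g \<notin> K \<longrightarrow> f g = 0))}"

definition haar_system ::
  "('g::topological_space, 'u::topological_space) groupoid \<Rightarrow> ('u \<Rightarrow> 'g measure) \<Rightarrow> bool" where
  "haar_system G \<mu> \<longleftrightarrow>
     (\<forall>u\<in>units G. space (\<mu> u) = range_fiber G u \<and>
        (\<forall>V. openin (top_of_set (range_fiber G u)) V \<longrightarrow> V \<noteq> {} \<longrightarrow> emeasure (\<mu> u) V \<noteq> 0)) \<and>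
     (\<forall>f\<in>Cc G. continuous_on (units G) (\<lambda>u. lebesgue_integral (\<mu> u) f)) \<and>
     (\<forall>f\<in>Cc G. \<forall>g\<in>arrows G.
        lebesgue_integral (\<mu> (src G g)) (\<lambda>h. f (gcomp G g h)) = lebesgue_integral (\<mu> (rng G g)) f)"

definition etale :: "('g::topological_space, 'u::topological_space) groupoid \<Rightarrow> bool" where
  "etale G \<longleftrightarrow>
     locally_compact_space (top_of_set (arrows G)) \<and> Hausdorff_space (top_of_set (arrows G)) \<and>
     second_countable (top_of_set (arrows G)) \<and>
     (\<forall>u\<in>units G. top_of_set (range_fiber G u) = discrete_topology (range_fiber G u)) \<and>
     haar_system G (\<lambda>u. count_space (range_fiber G u))"

definition conv :: "('g, 'u) groupoid \<Rightarrow> ('g \<Rightarrow> complex) \<Rightarrow> ('g \<Rightarrow> complex) \<Rightarrow> 'g \<Rightarrow> complex" where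
  "conv G f f' g = (if g \<in> arrows G then
     \<Sum>\<^sub>\<infinity>(g1, g2)\<in>{(g1, g2). g1 \<in> arrows G \<and> g2 \<in> arrows G \<and> src G g1 = rng G g2 \<and> gcomp G g1 g2 = g}.
       f g1 * f' g2 else 0)"

definition gstar :: "('g, 'u) groupoid \<Rightarrow> ('g \<Rightarrow> complex) \<Rightarrow> 'g \<Rightarrow> complex" where
  "gstar G f g = (if g \<in> arrows G then cnj (f (ginv G g)) else 0)"

definition I_norm :: "('g, 'u) groupoid \<Rightarrow> ('g \<Rightarrow> complex) \<Rightarrow> real" where
  "I_norm G f = max (SUP u\<in>units G. \<Sum>\<^sub>\<infinity>g\<in>range_fiber G u. norm (f g))
                    (SUP u\<in>units G. \<Sum>\<^sub>\<infinity>g\<in>source_fiber G u. norm (f g))"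

text \<open>The norm of the full groupoid C*-algebra: the largest C*-seminorm on \<open>Cc G\<close> dominated by
  the I-norm, i.e. the supremum over all I-norm bounded *-representations.\<close>

definition bounded_cstar_seminorm ::
  "('g::topological_space, 'u) groupoid \<Rightarrow> (('g \<Rightarrow> complex) \<Rightarrow> real) \<Rightarrow> bool" where
  "bounded_cstar_seminorm G p \<longleftrightarrow>
     (\<forall>f\<in>Cc G. 0 \<le> p f \<and> p f \<le> I_norm G f \<and> p (conv G (gstar G f) f) = (p f)\<^sup>2 \<and>
        (\<forall>c. p (\<lambda>g. c * f g) = norm c * p f)) \<and>
     (\<forall>f\<in>Cc G. \<forall>f'\<in>Cc G. p (\<lambda>g. f g + f' g) \<le> p f + p f' \<and> p (conv G f f') \<le> p f * p f')"

definition full_norm :: "('g::topological_space, 'u) groupoid \<Rightarrow> ('g \<Rightarrow> complex) \<Rightarrow> real" where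
  "full_norm G f = (SUP p\<in>{p. bounded_cstar_seminorm G p}. p f)"

definition Cc_alg :: "('g::topological_space, 'u) groupoid \<Rightarrow> ('g \<Rightarrow> complex) star_alg" where
  "Cc_alg G = \<lparr> elems = Cc G, alg_add = (\<lambda>f f' g. f g + f' g), scale = (\<lambda>c f g. c * f g),
     alg_mult = conv G, star = gstar G, nrm = full_norm G \<rparr>"

definition cstar :: "('g::topological_space, 'u) groupoid \<Rightarrow> (nat \<Rightarrow> 'g \<Rightarrow> complex) set star_alg" where
  "cstar G = completion (Cc_alg G)"

definition fiber :: "('g, 'u) groupoid \<Rightarrow> ('g \<Rightarrow> real) \<Rightarrow> real \<Rightarrow> ('g, 'u) groupoid" where
  "fiber G \<tau> h = G \<lparr> arrows := {g \<in> arrows G. \<tau> g = h} \<rparr>"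

definition restr :: "('g, 'u) groupoid \<Rightarrow> ('g \<Rightarrow> complex) \<Rightarrow> 'g \<Rightarrow> complex" where
  "restr H f g = (if g \<in> arrows H then f g else 0)"

definition eval_fiber :: "('g::topological_space, 'u) groupoid \<Rightarrow> ('g \<Rightarrow> real) \<Rightarrow> real
    \<Rightarrow> (nat \<Rightarrow> 'g \<Rightarrow> complex) set \<Rightarrow> (nat \<Rightarrow> 'g \<Rightarrow> complex) set" where
  "eval_fiber G \<tau> h = completion_map (Cc_alg (fiber G \<tau> h)) (restr (fiber G \<tau> h))"

definition commutator :: "('g, 'u) groupoid \<Rightarrow> ('g \<Rightarrow> complex) \<Rightarrow> ('g \<Rightarrow> complex) \<Rightarrow> 'g \<Rightarrow> complex" where
  "commutator G f f' g = conv G f f' g - conv G f' f g"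

definition quantum_bracket :: "('g::topological_space, 'u) groupoid \<Rightarrow> ('g \<Rightarrow> real)
    \<Rightarrow> ('g \<Rightarrow> complex) \<Rightarrow> ('g \<Rightarrow> complex) \<Rightarrow> ('g \<Rightarrow> complex) \<Rightarrow> real \<Rightarrow> (nat \<Rightarrow> 'g \<Rightarrow> complex) set" where
  "quantum_bracket G \<tau> f f' c h = emb (Cc_alg (fiber G \<tau> h))
     (if h = 0 then c
      else (\<lambda>g. 1 / (\<i> * of_real h) *
        commutator (fiber G \<tau> h) (restr (fiber G \<tau> h) f) (restr (fiber G \<tau> h) f') g))"

text \<open>Applying the total function \<open>\<I>\<close> to the Poisson bracket makes sense only when the
  bracket lies in \<open>C0\<close>, hence the explicit membership in the last clause.\<close>

definition deformation_groupoid ::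
  "('g::topological_space, 'u) groupoid \<Rightarrow> ('g \<Rightarrow> real)
    \<Rightarrow> ('m::topological_space, 'e::real_normed_vector) atlas \<Rightarrow> ('m \<Rightarrow> 'm tvec2)
    \<Rightarrow> ('g \<Rightarrow> complex) set \<Rightarrow> (('m \<Rightarrow> complex) \<Rightarrow> (nat \<Rightarrow> 'g \<Rightarrow> complex) set) \<Rightarrow> bool" where
  "deformation_groupoid G \<tau> A \<Omega> Q \<I> \<longleftrightarrow>
     (let G0 = fiber G \<tau> 0; emb0 = emb (Cc_alg G0); \<I>' = inv_into C0 \<I> in
      star_subalgebra (Cc_alg G) Q \<and>
      continuous_field (cstar G) (\<lambda>h. cstar (fiber G \<tau> h)) (eval_fiber G \<tau>) \<and>
      (\<forall>X\<in>elems (cstar G0). \<forall>e>0. \<exists>f\<in>Q. nrm (cstar G0) (alg_sub (cstar G0) X (emb0 (restr G0 f))) < e) \<and>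
      star_iso C0_alg (cstar G0) \<I> \<and>
      (\<forall>f\<in>Q. \<I>' (emb0 (restr G0 f)) \<in> C0_smooth A) \<and>
      (\<forall>f\<in>Q. \<forall>f'\<in>Q. \<exists>c\<in>restr G0 ` Q.
         section_continuous_at (cstar G) (\<lambda>h. cstar (fiber G \<tau> h)) (eval_fiber G \<tau>)
           (quantum_bracket G \<tau> f f' c) 0 \<and>
         pbracket \<Omega> (\<I>' (emb0 (restr G0 f))) (\<I>' (emb0 (restr G0 f'))) \<in> C0 \<and>
         emb0 c = \<I> (pbracket \<Omega> (\<I>' (emb0 (restr G0 f))) (\<I>' (emb0 (restr G0 f'))))))"


section \<open>The groupoid of a torus action and an action of \<open>\<real>\<^sup>n\<close>\<close>

text \<open>The orbit space is realised as the image of the projection J in N.\<close>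

definition orbit_projection ::
  "(complex ^ 'n \<Rightarrow> 'm::topological_space \<Rightarrow> 'm) \<Rightarrow> ('m \<Rightarrow> 'p::topological_space) \<Rightarrow> bool" where
  "orbit_projection \<alpha> J \<longleftrightarrow> (\<forall>x x'. J x = J x' \<longleftrightarrow> (\<exists>s\<in>torus. x' = \<alpha> s x)) \<and>
     quotient_map euclidean (top_of_set (range J)) J"

definition locally_closed :: "'p::topological_space set \<Rightarrow> bool" where
  "locally_closed D \<longleftrightarrow> (\<exists>U F. open U \<and> closed F \<and> D = U \<inter> F)"

definition isotropy :: "(complex ^ 'n \<Rightarrow> 'm \<Rightarrow> 'm) \<Rightarrow> ('m \<Rightarrow> 'p) \<Rightarrow> 'p \<Rightarrow> (complex ^ 'n) set" where
  "isotropy \<alpha> J y = {s \<in> torus. \<forall>x. J x = y \<longrightarrow> \<alpha> s x = x}"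

definition Delta_k :: "(complex ^ 'n \<Rightarrow> 'm \<Rightarrow> 'm) \<Rightarrow> ('m \<Rightarrow> 'p) \<Rightarrow> int ^ 'n \<Rightarrow> 'p set" where
  "Delta_k \<alpha> J k = {y \<in> range J. \<forall>s\<in>isotropy \<alpha> J y. character k s = 1}"

definition Delta_inf :: "(complex ^ 'n \<Rightarrow> 'm \<Rightarrow> 'm) \<Rightarrow> ('m \<Rightarrow> 'p) \<Rightarrow> 'p set" where
  "Delta_inf \<alpha> J = {y \<in> range J. isotropy \<alpha> J y = {1}}"

text \<open>Well defined, i.e. independent of s, when J x lies in \<open>Delta_k \<alpha> J k\<close>.\<close>

definition k_sigma :: "(complex ^ 'n \<Rightarrow> 'm \<Rightarrow> 'm) \<Rightarrow> ('m \<Rightarrow> 'p) \<Rightarrow> ('p \<Rightarrow> 'm)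
    \<Rightarrow> int ^ 'n \<Rightarrow> 'm \<Rightarrow> complex" where
  "k_sigma \<alpha> J \<sigma> k x = (THE c. \<exists>s\<in>torus. x = \<alpha> s (\<sigma> (J x)) \<and> c = character k s)"

definition hk :: "real \<Rightarrow> int ^ 'n \<Rightarrow> real ^ 'n" where
  "hk h k = (\<chi> i. h * of_int (k $ i))"

definition Gtilde :: "(real ^ 'n \<Rightarrow> 'p \<Rightarrow> 'p) \<Rightarrow> (real \<times> 'p \<times> (int ^ 'n), real \<times> 'p) groupoid" where
  "Gtilde \<beta> = \<lparr>
     arrows = UNIV,
     src = (\<lambda>(h, y, k). (h, y)),
     rng = (\<lambda>(h, y, k). (h, \<beta> (hk h k) y)),
     gcomp = (\<lambda>(_, _, l) (h, y, m). (h, y, l + m)),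
     ginv = (\<lambda>(h, y, k). (h, \<beta> (hk h k) y, - k)) \<rparr>"

definition Ggrp :: "(complex ^ 'n \<Rightarrow> 'm \<Rightarrow> 'm) \<Rightarrow> (real ^ 'n \<Rightarrow> 'p \<Rightarrow> 'p) \<Rightarrow> ('m \<Rightarrow> 'p)
    \<Rightarrow> (real \<times> 'p \<times> (int ^ 'n), real \<times> 'p) groupoid" where
  "Ggrp \<alpha> \<beta> J = Gtilde \<beta> \<lparr> arrows := {(h, y, k). y \<in> Delta_k \<alpha> J k \<and> \<beta> (hk h k) y \<in> Delta_k \<alpha> J k \<and>
     isotropy \<alpha> J y = isotropy \<alpha> J (\<beta> (hk h k) y)} \<rparr>"

definition Gtilde_atlas :: "('p, 'f) atlas \<Rightarrow> (real \<times> 'p \<times> (int ^ 'n), real \<times> 'f) atlas" where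
  "Gtilde_atlas A = {(UNIV \<times> U \<times> {k}, \<lambda>(h, y, _). (h, \<phi> y)) | U \<phi> k. (U, \<phi>) \<in> A}"

definition Cc_smooth :: "('p::topological_space, 'f::real_normed_vector) atlas
    \<Rightarrow> (real \<times> 'p \<times> (int ^ 'n), real \<times> 'p) groupoid \<Rightarrow> (real \<times> 'p \<times> (int ^ 'n) \<Rightarrow> complex) set" where
  "Cc_smooth A G = {f \<in> Cc G. \<exists>F. smooth_fun (Gtilde_atlas A) F \<and> (\<forall>g\<in>arrows G. F g = f g)}"

text \<open>The isomorphism of the C*-algebra of functions vanishing at infinity on M with that of
  the fiber of G at 0, determined by its inverse on \<open>Cc\<close>.\<close>

definition fourier_iso :: "(complex ^ 'n \<Rightarrow> 'm::topological_space \<Rightarrow> 'm) \<Rightarrow> (real ^ 'n \<Rightarrow> 'p::topological_space \<Rightarrow> 'p)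
    \<Rightarrow> ('m \<Rightarrow> 'p) \<Rightarrow> ('p \<Rightarrow> 'm)
    \<Rightarrow> (('m \<Rightarrow> complex) \<Rightarrow> (nat \<Rightarrow> real \<times> 'p \<times> (int ^ 'n) \<Rightarrow> complex) set) \<Rightarrow> bool" where
  "fourier_iso \<alpha> \<beta> J \<sigma> \<I> \<longleftrightarrow> (let G0 = fiber (Ggrp \<alpha> \<beta> J) fst 0 in
     star_iso C0_alg (cstar G0) \<I> \<and>
     (\<forall>f\<in>Cc G0. inv_into C0 \<I> (emb (Cc_alg G0) f) =
        (\<lambda>x. \<Sum>\<^sub>\<infinity>k\<in>{k. J x \<in> Delta_k \<alpha> J k}. f (0, J x, k) * k_sigma \<alpha> J \<sigma> k x)))"

definition rho :: "(complex ^ 'n \<Rightarrow> 'm \<Rightarrow> 'm) \<Rightarrow> ('p \<Rightarrow> 'm) \<Rightarrow> 'p \<times> (complex ^ 'n) \<Rightarrow> 'm" where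
  "rho \<alpha> \<sigma> = (\<lambda>(y, s). \<alpha> s (\<sigma> y))"

definition rho_star_xi_beta ::
  "('m::topological_space, 'e::real_normed_vector) atlas \<Rightarrow> ('p::topological_space, 'f::real_normed_vector) atlas
    \<Rightarrow> (complex ^ 'n \<Rightarrow> 'm \<Rightarrow> 'm) \<Rightarrow> (real ^ 'n \<Rightarrow> 'p \<Rightarrow> 'p) \<Rightarrow> ('m \<Rightarrow> 'p) \<Rightarrow> ('p \<Rightarrow> 'm)
    \<Rightarrow> real ^ 'n \<Rightarrow> 'm \<Rightarrow> 'm tvec" where
  "rho_star_xi_beta A_M A_N \<alpha> \<beta> J \<sigma> X =
     (let D = restrict_atlas A_N (Delta_inf \<alpha> J) in
      pushforward (prod_atlas D torus_atlas) A_M (rho \<alpha> \<sigma>)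
        (\<lambda>(y, s). first_factor_vec D torus_atlas s (xi_beta D \<beta> X y)))"

end

theory Submission
  imports Defs "HOL-Computational_Algebra.Polynomial"
begin

text \<open>
  A bivector at a point is a bilinear form in the differentials of two functions, so two bivectors
  agree as soon as they agree on functions whose differentials span the cotangent space. Near a
  point \<open>x = \<rho>(y\<^sub>0, s\<^sub>0)\<close> of the free part such functions come from the groupoid. For \<open>g\<close> smooth with
  small compact support near \<open>y\<^sub>0\<close> and for \<open>k\<close> in \<open>\<int>\<^sup>n\<close>, the function that equals a cutoff in
  \<open>\<hbar>\<close> times \<open>g(y)\<close> on the sheet of index \<open>k\<close> and 0 on the other sheets belongs to the dense
  subalgebra, because \<open>\<Delta>(\<infinity>)\<close> is open and hence a neighbourhood of \<open>(0, y\<^sub>0, k)\<close> lies in the groupoid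
  (\<open>test_in_Q\<close>). At \<open>\<hbar> = 0\<close> it corresponds to the function \<open>\<rho>(y, s) \<mapsto> g(y) \<langle>k, s\<rangle>\<close> on M
  (\<open>test_symbol\<close>).

  The Poisson bracket of two such functions is computed from the deformation. The convolution
  commutator of the functions given by \<open>(g, k)\<close> and \<open>(g', k')\<close> lives on the sheet \<open>k + k'\<close>, and there,
  up to the cutoff, it equals \<open>g(\<beta>\<^bsub>\<hbar>k'\<^esub> y) g'(y) - g'(\<beta>\<^bsub>\<hbar>k\<^esub> y) g(y)\<close>. After division by
  \<open>\<i>\<hbar>\<close> it tends to \<open>(\<xi>\<^sup>\<beta>\<^bsub>k'\<^esub>g \<cdot> g' - \<xi>\<^sup>\<beta>\<^bsub>k\<^esub>g' \<cdot> g) / \<i>\<close>, which is the value of the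
  asserted bivector, since \<open>\<xi>\<^sup>\<alpha>\<close> multiplies \<open>\<langle>k, \<cdot>\<rangle>\<close> by \<open>\<i> k\<^sub>i\<close> and \<open>\<rho>\<^sub>*\<xi>\<^sup>\<beta>\<close> differentiates \<open>g\<close>
  (\<open>bracket_test\<close> and \<open>Lambda_test\<close>).

  Two points need an argument. The first is that the limit in the continuous field of C*-algebras is a
  limit of point values (\<open>section_values_continuous\<close>). This holds because the norm of the full
  C*-algebra dominates the supremum norm (\<open>norm_le_full_norm\<close>): the values of a function on the
  groupoid are matrix entries of its regular representations, whose operator norms are among the
  seminorms of which the full norm is the supremum. The second is the passage to all tangent vectors of
  M (\<open>tangent_dcoord\<close>): as \<open>\<rho>\<close> is a diffeomorphism, all of them can be computed in the product
  coordinates, and so can \<open>\<xi>\<^sup>\<alpha>\<close> and \<open>\<rho>\<^sub>*\<xi>\<^sup>\<beta>\<close>. Only the indices \<open>k = 0\<close> and \<open>k = E\<^sub>i\<close> are used. Their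
  test functions already have spanning differentials, and the vectors \<open>\<xi>\<^sup>\<beta>\<^sub>X\<close>
  that occur in their brackets are those of the asserted bivector, \<open>X = E\<^sub>i\<close>, and 0.
\<close>


section \<open>Calculus of maps of class C-k\<close>

lemma Ck_on_cong:
  "open S \<Longrightarrow> (\<And>x. x \<in> S \<Longrightarrow> f x = g x) \<Longrightarrow> Ck_on k S f \<Longrightarrow> Ck_on k S g"
proof (induction k arbitrary: f g)
  case 0
  then show ?case using continuous_on_cong by force
next
  case (Suc k)
  have d: "f differentiable at x" if "x \<in> S" for x using Suc.prems(3) that by simp
  have "(g has_derivative frechet_derivative f (at x)) (at x)" if "x \<in> S" for x
    using d[OF that] Suc.prems(1,2) that
    by (metis frechet_derivative_works has_derivative_transform_within_open)
  moreover from this have "frechet_derivative f (at x) = frechet_derivative g (at x)" if "x \<in> S" for x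
    using that frechet_derivative_at by blast
  ultimately have eq: "frechet_derivative f (at x) = frechet_derivative g (at x)"
    and "g differentiable at x" if "x \<in> S" for x
    using that by (auto simp: differentiable_def)
  moreover have "Ck_on k S (\<lambda>x. frechet_derivative g (at x) v)" for v
    by (rule Suc.IH[OF Suc.prems(1), of "\<lambda>x. frechet_derivative f (at x) v"])
       (use Suc.prems(3) eq in auto)
  ultimately show ?case by simp
qed

lemma Ck_on_subset: "Ck_on k T f \<Longrightarrow> S \<subseteq> T \<Longrightarrow> Ck_on k S f"
  by (induction k arbitrary: f) (auto intro: continuous_on_subset)

lemma Ck_on_continuous: "Ck_on k S f \<Longrightarrow> continuous_on S f"
  by (cases k) (auto simp: continuous_on_eq_continuous_within
      intro: continuous_at_imp_continuous_at_within[OF differentiable_imp_continuous_within])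

lemma Ck_on_Suc_imp: "Ck_on (Suc k) S f \<Longrightarrow> Ck_on k S f"
proof (induction k arbitrary: f)
  case 0
  from Ck_on_continuous[OF this] show ?case by simp
next
  case (Suc k)
  have "\<forall>v. Ck_on (Suc k) S (\<lambda>x. frechet_derivative f (at x) v)" "\<forall>x\<in>S. f differentiable at x"
    using Suc.prems by (subst (asm) Ck_on.simps(2), blast)+
  then show ?case using Suc.IH by (subst Ck_on.simps(2)) blast
qed

lemma Ck_on_local:
  "(\<And>x. x \<in> S \<Longrightarrow> \<exists>T. open T \<and> x \<in> T \<and> Ck_on k T f) \<Longrightarrow> Ck_on k S f"
proof (induction k arbitrary: f)
  case 0
  have "continuous (at x within S) f" if "x \<in> S" for x
    using 0[OF that] by (auto simp: continuous_on_eq_continuous_at intro: continuous_at_imp_continuous_at_within)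
  then show ?case by (simp add: continuous_on_eq_continuous_within)
next
  case (Suc k)
  have "Ck_on k S (\<lambda>x. frechet_derivative f (at x) v)" for v
  proof (rule Suc.IH)
    fix x assume "x \<in> S"
    then obtain T where "open T" "x \<in> T" "Ck_on (Suc k) T f" using Suc.prems by blast
    then show "\<exists>T. open T \<and> x \<in> T \<and> Ck_on k T (\<lambda>x. frechet_derivative f (at x) v)"
      by (intro exI[of _ T]) simp
  qed
  moreover have "f differentiable at x" if "x \<in> S" for x
    using Suc.prems[OF that] by auto
  ultimately show ?case by simp
qed

text \<open>Any expression for the derivative may be used, since on the open set S it agrees with the canonical
  choice of a Frechet derivative.\<close>

lemma Ck_on_SucI:
  assumes "open S" "\<And>x. x \<in> S \<Longrightarrow> (f has_derivative D x) (at x)" "\<And>v. Ck_on k S (\<lambda>x. D x v)"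
  shows "Ck_on (Suc k) S f"
proof -
  have "Ck_on k S (\<lambda>x. frechet_derivative f (at x) v)" for v
  proof (rule Ck_on_cong[OF assms(1) _ assms(3)[of v]])
    show "D x v = frechet_derivative f (at x) v" if "x \<in> S" for x
      using frechet_derivative_at[OF assms(2)[OF that]] by simp
  qed
  moreover have "f differentiable at x" if "x \<in> S" for x
    using assms(2)[OF that] by (rule differentiableI)
  ultimately show ?thesis by simp
qed

lemma Ck_on_derivD:
  assumes "Ck_on (Suc k) S f"
  shows "x \<in> S \<Longrightarrow> (f has_derivative frechet_derivative f (at x)) (at x)"
    and "Ck_on k S (\<lambda>x. frechet_derivative f (at x) v)"
  using assms frechet_derivative_works by auto

lemma Ck_on_const: "open S \<Longrightarrow> Ck_on k S (\<lambda>x. c)"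
proof (induction k arbitrary: c)
  case (Suc k)
  show ?case by (rule Ck_on_SucI[where D="\<lambda>_ _. 0"]) (use Suc in simp_all)
qed simp

lemma Ck_on_linear:
  assumes "bounded_linear L" "open S" shows "Ck_on k S L"
proof (cases k)
  case 0
  then show ?thesis by (simp add: assms(1) linear_continuous_on)
next
  case (Suc j)
  then show ?thesis
    by (simp only:) (rule Ck_on_SucI[OF assms(2) bounded_linear_imp_has_derivative[OF assms(1)]
        Ck_on_const[OF assms(2)]])
qed

lemma Ck_on_linear_comp:
  assumes "bounded_linear L" "open S"
  shows "Ck_on k S f \<Longrightarrow> Ck_on k S (\<lambda>x. L (f x))"
proof (induction k arbitrary: f)
  case 0
  then show ?case
    by (simp add: assms(1) bounded_linear.continuous_on)
next
  case (Suc k)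
  show ?case
    by (rule Ck_on_SucI[OF assms(2) bounded_linear.has_derivative[OF assms(1)] Suc.IH])
       (rule Ck_on_derivD[OF Suc.prems], assumption?)+
qed

lemma Ck_on_add:
  assumes "open S"
  shows "Ck_on k S f \<Longrightarrow> Ck_on k S g \<Longrightarrow> Ck_on k S (\<lambda>x. f x + g x)"
proof (induction k arbitrary: f g)
  case 0
  then show ?case by (simp add: continuous_on_add)
next
  case (Suc k)
  show ?case
    by (rule Ck_on_SucI[OF assms has_derivative_add Suc.IH])
       (rule Ck_on_derivD[OF Suc.prems(1)] Ck_on_derivD[OF Suc.prems(2)], assumption?)+
qed

lemma Ck_on_sum:
  assumes "open S" "\<And>i. i \<in> I \<Longrightarrow> Ck_on k S (f i)"
  shows "Ck_on k S (\<lambda>x. \<Sum>i\<in>I. f i x)"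
  using assms(2)
  by (induction I rule: infinite_finite_induct) (auto intro: Ck_on_add Ck_on_const assms(1))

lemma Ck_on_bilinear:
  assumes "bounded_bilinear pr" "open S"
  shows "Ck_on k S f \<Longrightarrow> Ck_on k S g \<Longrightarrow> Ck_on k S (\<lambda>x. pr (f x) (g x))"
proof (induction k arbitrary: f g)
  case 0
  then show ?case using bounded_bilinear.continuous_on[OF assms(1)] by simp
next
  case (Suc k)
  show ?case
    by (rule Ck_on_SucI[OF assms(2) bounded_bilinear.FDERIV[OF assms(1)]
          Ck_on_add[OF assms(2) Suc.IH Suc.IH]])
       (rule Ck_on_derivD[OF Suc.prems(1)] Ck_on_derivD[OF Suc.prems(2)]
          Ck_on_Suc_imp[OF Suc.prems(1)] Ck_on_Suc_imp[OF Suc.prems(2)], assumption?)+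
qed

text \<open>A finite orthonormal basis, described by the expansion formula. The model space of dimension 0 has
  the empty one.\<close>

definition orthonormal_frame :: "'e::real_inner set \<Rightarrow> bool" where
  "orthonormal_frame B \<longleftrightarrow> finite B \<and> (\<forall>x. (\<Sum>b\<in>B. (x \<bullet> b) *\<^sub>R b) = x) \<and> (\<forall>b\<in>B. norm b = 1)"

text \<open>Gram--Schmidt, followed by normalisation of the nonzero vectors.\<close>

lemma orthonormal_frame_exists:
  fixes B0 :: "'e::real_inner set"
  assumes "finite B0" "span B0 = UNIV"
  obtains B :: "'e set" where "orthonormal_frame B"
proof -
  obtain C :: "'e set" where C: "finite C" "span C = UNIV" "pairwise orthogonal C"
    using basis_orthogonal[OF assms(1)] assms(2) by auto
  define B where "B = (\<lambda>c. c /\<^sub>R norm c) ` (C - {0})"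
  have fB: "finite B" using C by (simp add: B_def)
  have nB: "norm b = 1" if "b \<in> B" for b using that by (auto simp: B_def field_simps split: if_splits)
  have oB: "b \<bullet> c = 0" if bc': "b \<in> B" "c \<in> B" "b \<noteq> c" for b c
  proof -
    obtain b' c' where bc: "b' \<in> C - {0}" "c' \<in> C - {0}" "b = b' /\<^sub>R norm b'" "c = c' /\<^sub>R norm c'"
      using bc'(1,2) unfolding B_def by blast
    then have "b' \<bullet> c' = 0" using C(3) bc'(3) by (auto simp: pairwise_def orthogonal_def)
    then show ?thesis using bc by simp
  qed
  have "C \<subseteq> span B"
  proof
    fix c assume c: "c \<in> C"
    show "c \<in> span B"
    proof (cases "c = 0")
      case False
      then have "c /\<^sub>R norm c \<in> B" using c by (auto simp: B_def)
      then have "norm c *\<^sub>R (c /\<^sub>R norm c) \<in> span B" by (intro span_scale span_base)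
      then show ?thesis using False by simp
    qed (simp add: span_zero)
  qed
  then have "x \<in> span B" for x using C(2) by (metis UNIV_I span_mono span_span subsetD)
  moreover have "(\<Sum>b\<in>B. (x \<bullet> b) *\<^sub>R b) = x" if "x \<in> span B" for x
    using that
  proof (induction rule: span_induct_alt)
    case (step c x y)
    have "(\<Sum>b\<in>B. (x \<bullet> b) *\<^sub>R b) = (\<Sum>b\<in>B. if b = x then x else 0)"
      using oB nB step(1) by (intro sum.cong) (auto simp: dot_square_norm)
    also have "\<dots> = x" using step(1) fB by simp
    finally have "(\<Sum>b\<in>B. (x \<bullet> b) *\<^sub>R b) = x" .
    moreover have "(\<Sum>b\<in>B. ((c *\<^sub>R x + y) \<bullet> b) *\<^sub>R b)
        = c *\<^sub>R (\<Sum>b\<in>B. (x \<bullet> b) *\<^sub>R b) + (\<Sum>b\<in>B. (y \<bullet> b) *\<^sub>R b)"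
      by (simp add: inner_add_left scaleR_add_left sum.distrib scaleR_sum_right)
    ultimately show ?case using step(2) by simp
  qed simp
  ultimately show thesis using that fB nB unfolding orthonormal_frame_def by blast
qed

lemma orthonormal_frame_Basis: "orthonormal_frame (Basis :: 'a::euclidean_space set)"
  by (auto simp: orthonormal_frame_def euclidean_representation)

lemma orthonormal_frame_Times:
  assumes "orthonormal_frame (A :: 'a::real_inner set)" "orthonormal_frame (B :: 'b::real_inner set)"
  shows "orthonormal_frame ((\<lambda>a. (a, 0)) ` A \<union> (\<lambda>b. (0, b)) ` B)"
proof -
  have f: "finite A" "finite B" and n: "\<And>a. a \<in> A \<Longrightarrow> norm a = 1" "\<And>b. b \<in> B \<Longrightarrow> norm b = 1"
    and e: "\<And>x. (\<Sum>b\<in>A. (x \<bullet> b) *\<^sub>R b) = x" "\<And>x. (\<Sum>b\<in>B. (x \<bullet> b) *\<^sub>R b) = x"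
    using assms by (auto simp: orthonormal_frame_def)
  have "(\<Sum>b\<in>(\<lambda>a. (a, 0)) ` A \<union> (\<lambda>b. (0, b)) ` B. (x \<bullet> b) *\<^sub>R b) = x" for x :: "'a \<times> 'b"
  proof -
    obtain x1 x2 where x: "x = (x1, x2)" by (cases x)
    have "(\<Sum>b\<in>(\<lambda>a. (a, 0)) ` A \<union> (\<lambda>b. (0, b)) ` B. (x \<bullet> b) *\<^sub>R b)
        = (\<Sum>b\<in>(\<lambda>a. (a, 0)) ` A. (x \<bullet> b) *\<^sub>R b) + (\<Sum>b\<in>(\<lambda>b. (0, b)) ` B. (x \<bullet> b) *\<^sub>R b)"
      using f n n(1)[of 0] n(2)[of 0] by (intro sum.union_disjoint) auto
    also have "\<dots> = (\<Sum>a\<in>A. ((x1 \<bullet> a) *\<^sub>R a, 0)) + (\<Sum>b\<in>B. (0, (x2 \<bullet> b) *\<^sub>R b))"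
      by (subst (1 2) sum.reindex) (auto simp: inj_on_def x)
    also have "\<dots> = x"
      unfolding x using e(1)[of x1] e(2)[of x2] by (simp add: prod_eq_iff fst_sum snd_sum)
    finally show ?thesis .
  qed
  then show ?thesis using f n by (auto simp: orthonormal_frame_def norm_Pair)
qed

lemma linear_frame_expand:
  assumes "orthonormal_frame B" "linear L" shows "L v = (\<Sum>b\<in>B. (v \<bullet> b) *\<^sub>R L b)"
proof -
  have "L v = L (\<Sum>b\<in>B. (v \<bullet> b) *\<^sub>R b)" using assms(1) by (metis orthonormal_frame_def)
  then show ?thesis using assms(2) by (simp add: linear_sum linear_cmul)
qed

text \<open>With respect to a frame the chain rule reads
  \<open>D(f \<circ> g) v = (\<Sum>b\<in>B. (Dg v \<bullet> b) *\<^sub>R (\<partial>\<^sub>b f \<circ> g))\<close>. It involves only partial derivatives of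
  \<open>f\<close> and directional derivatives of \<open>g\<close>, so that the induction on the order applies to each factor
  separately.\<close>

lemma Ck_on_compose:
  fixes g :: "'a::real_normed_vector \<Rightarrow> 'e::real_inner"
  assumes B: "orthonormal_frame (B :: 'e set)" and S: "open S"
  shows "Ck_on k T f \<Longrightarrow> Ck_on k S g \<Longrightarrow> g ` S \<subseteq> T \<Longrightarrow> Ck_on k S (\<lambda>x. f (g x))"
proof (induction k arbitrary: f)
  case 0
  then show ?case using continuous_on_compose2[of T f S g] by simp
next
  case (Suc k)
  note f = Ck_on_derivD[OF Suc.prems(1)] and g = Ck_on_derivD[OF Suc.prems(2)]
  have lin: "linear (frechet_derivative f (at (g x)))" if "x \<in> S" for x
    using Suc.prems(1,3) that by (intro linear_frechet_derivative) auto
  show ?case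
  proof (rule Ck_on_SucI[OF S])
    fix x assume x: "x \<in> S"
    have "((\<lambda>x. f (g x)) has_derivative (\<lambda>v. frechet_derivative f (at (g x)) (frechet_derivative g (at x) v))) (at x)"
      using x Suc.prems(3) by (intro has_derivative_compose[OF g(1) f(1)]) auto
    then show "((\<lambda>x. f (g x)) has_derivative
        (\<lambda>v. \<Sum>b\<in>B. (frechet_derivative g (at x) v \<bullet> b) *\<^sub>R frechet_derivative f (at (g x)) b)) (at x)"
      by (simp add: linear_frame_expand[OF B lin[OF x], symmetric])
  next
    fix v
    show "Ck_on k S (\<lambda>x. \<Sum>b\<in>B. (frechet_derivative g (at x) v \<bullet> b) *\<^sub>R frechet_derivative f (at (g x)) b)"
    proof (intro Ck_on_sum[OF S] Ck_on_bilinear[OF bounded_bilinear_scaleR S])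
      fix b
      show "Ck_on k S (\<lambda>x. frechet_derivative g (at x) v \<bullet> b)"
        by (rule Ck_on_linear_comp[OF bounded_linear_inner_left S g(2)])
      show "Ck_on k S (\<lambda>x. frechet_derivative f (at (g x)) b)"
        using f(2) Ck_on_Suc_imp[OF Suc.prems(2)] Suc.prems(3) by (rule Suc.IH)
    qed
  qed
qed

lemma smooth_on_local:
  assumes "\<And>x. x \<in> S \<Longrightarrow> \<exists>T. open T \<and> x \<in> T \<and> smooth_on T f"
  shows "smooth_on S f"
  unfolding smooth_on_def
proof (intro allI Ck_on_local)
  fix k x assume "x \<in> S"
  from assms[OF this] show "\<exists>T. open T \<and> x \<in> T \<and> Ck_on k T f" by (auto simp: smooth_on_def)
qed

lemma smooth_on_subset: "smooth_on T f \<Longrightarrow> S \<subseteq> T \<Longrightarrow> smooth_on S f"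
  unfolding smooth_on_def using Ck_on_subset[of _ T f S] by simp

lemma smooth_on_cong:
  "open S \<Longrightarrow> (\<And>x. x \<in> S \<Longrightarrow> f x = g x) \<Longrightarrow> smooth_on S f \<Longrightarrow> smooth_on S g"
  unfolding smooth_on_def using Ck_on_cong[of S f g] by simp

lemma smooth_on_compose:
  fixes g :: "'a::real_normed_vector \<Rightarrow> 'e::real_inner"
  assumes "orthonormal_frame (B :: 'e set)" "open S" "smooth_on T f" "smooth_on S g" "g ` S \<subseteq> T"
  shows "smooth_on S (\<lambda>x. f (g x))"
  using Ck_on_compose[OF assms(1,2) _ _ assms(5), of _ f] assms(3,4) by (simp add: smooth_on_def)

lemma smooth_on_bilinear:
  assumes "bounded_bilinear pr" "open S" "smooth_on S f" "smooth_on S g"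
  shows "smooth_on S (\<lambda>x. pr (f x) (g x))"
  using Ck_on_bilinear[OF assms(1,2), of _ f g] assms(3,4) by (simp add: smooth_on_def)

lemma smooth_on_const: "open S \<Longrightarrow> smooth_on S (\<lambda>x. c)"
  by (simp add: smooth_on_def Ck_on_const)

lemma smooth_on_add: "open S \<Longrightarrow> smooth_on S f \<Longrightarrow> smooth_on S g \<Longrightarrow> smooth_on S (\<lambda>x. f x + g x)"
  by (simp add: smooth_on_def Ck_on_add)

lemma smooth_on_linear: "bounded_linear L \<Longrightarrow> open S \<Longrightarrow> smooth_on S L"
  by (simp add: smooth_on_def Ck_on_linear)

lemma smooth_on_differentiable: "smooth_on S f \<Longrightarrow> x \<in> S \<Longrightarrow> f differentiable at x"
  unfolding smooth_on_def by (drule spec[of _ "Suc 0"]) simp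

lemma smooth_on_continuous: "smooth_on S f \<Longrightarrow> continuous_on S f"
  unfolding smooth_on_def using Ck_on_continuous[of 0 S f] by blast


section \<open>Bump functions\<close>

text \<open>Functions of the form \<open>p (1/x) exp (- 1/x)\<close> with a polynomial \<open>p\<close>, extended by 0 to
  \<open>x \<le> 0\<close>, are closed under differentiation; hence they are all smooth.\<close>

definition flat_fun :: "real poly \<Rightarrow> real \<Rightarrow> real" where
  "flat_fun p x = (if x > 0 then poly p (1 / x) * exp (- (1 / x)) else 0)"

text \<open>In the variable \<open>t = 1/x\<close> one has \<open>d/dx = - t\<^sup>2 d/dt\<close>, which sends \<open>p(t) exp (- t)\<close> to
  \<open>t\<^sup>2 (p - p')(t) exp (- t)\<close>.\<close>

definition flat_deriv :: "real poly \<Rightarrow> real poly" where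
  "flat_deriv p = [:0, 0, 1:] * (p - pderiv p)"

lemma poly_exp_tendsto_0: "((\<lambda>t::real. poly p t * exp (- t)) \<longlongrightarrow> 0) at_top"
proof -
  have "((\<lambda>t::real. \<Sum>i\<le>degree p. coeff p i * (t ^ i / exp t)) \<longlongrightarrow> (\<Sum>i\<le>degree p. coeff p i * 0)) at_top"
    by (intro tendsto_sum tendsto_mult tendsto_const tendsto_power_div_exp_0)
  then show ?thesis
    by (simp add: poly_altdef sum_distrib_right exp_minus divide_inverse mult.assoc)
qed

lemma flat_fun_deriv_pos:
  assumes "x > 0"
  shows "(flat_fun p has_real_derivative flat_fun (flat_deriv p) x) (at x)"
proof -
  have "((\<lambda>x. poly p (1 / x) * exp (- (1 / x))) has_real_derivative
      poly (flat_deriv p) (1 / x) * exp (- (1 / x))) (at x)"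
    using assms
    by (auto intro!: derivative_eq_intros DERIV_chain'[OF _ poly_DERIV]
        simp: flat_deriv_def field_simps power2_eq_square)
  then have "(flat_fun p has_real_derivative poly (flat_deriv p) (1 / x) * exp (- (1 / x))) (at x)"
    by (rule has_field_derivative_transform_within_open[where S="{0<..}"])
       (use assms in \<open>auto simp: flat_fun_def\<close>)
  then show ?thesis using assms by (simp add: flat_fun_def)
qed

text \<open>The difference quotient at 0 from the right is again of the form \<open>q(t) exp (- t)\<close> with
  \<open>t = 1/x \<rightarrow> \<infinity>\<close>.\<close>

lemma flat_fun_deriv_0: "(flat_fun p has_real_derivative 0) (at 0)"
  unfolding has_field_derivative_iff
proof (rule filterlim_split_at_real)
  show "((\<lambda>y. (flat_fun p y - flat_fun p 0) / (y - 0)) \<longlongrightarrow> 0) (at_left 0)"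
    by (rule tendsto_eventually) (auto simp: flat_fun_def eventually_at_filter)
  have "((\<lambda>y. poly ([:0, 1:] * p) (inverse y) * exp (- inverse y)) \<longlongrightarrow> 0) (at_right (0::real))"
    using filterlim_compose[OF poly_exp_tendsto_0 filterlim_inverse_at_top_right] .
  then show "((\<lambda>y. (flat_fun p y - flat_fun p 0) / (y - 0)) \<longlongrightarrow> 0) (at_right 0)"
    by (rule Lim_transform_eventually)
       (auto simp: flat_fun_def eventually_at_filter divide_inverse mult_ac)
qed

lemma flat_fun_deriv: "(flat_fun p has_real_derivative flat_fun (flat_deriv p) x) (at x)"
proof (cases x "0::real" rule: linorder_cases)
  case less
  have "(flat_fun p has_real_derivative 0) (at x)"
    by (rule has_field_derivative_transform_within_open[where S="{..<0}" and f="\<lambda>_. 0"])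
       (use less in \<open>auto simp: flat_fun_def\<close>)
  then show ?thesis using less by (simp add: flat_fun_def)
next
  case equal
  then show ?thesis using flat_fun_deriv_0 by (simp add: flat_fun_def)
qed (rule flat_fun_deriv_pos)

lemma smooth_on_flat_fun: "smooth_on UNIV (flat_fun p)"
proof -
  have "Ck_on k UNIV (flat_fun p)" for k
  proof (induction k arbitrary: p)
    case 0
    show ?case
      using DERIV_isCont[OF flat_fun_deriv] by (simp add: continuous_at_imp_continuous_on)
  next
    case (Suc k)
    show ?case
    proof (rule Ck_on_SucI)
      show "(flat_fun p has_derivative (\<lambda>v. flat_fun (flat_deriv p) x * v)) (at x)" for x
        using flat_fun_deriv by (simp add: has_field_derivative_def)
      show "Ck_on k UNIV (\<lambda>x. flat_fun (flat_deriv p) x * v)" for v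
        by (rule Ck_on_linear_comp[OF bounded_linear_mult_left _ Suc.IH]) simp
    qed simp
  qed
  then show ?thesis by (simp add: smooth_on_def)
qed

text \<open>The factor \<open>exp 1\<close> makes the value at the centre 1. As a function of the squared distance the bump
  has derivative 0 at the centre, so multiplication by it does not change first derivatives there.\<close>

definition bump :: "'e::real_inner \<Rightarrow> real \<Rightarrow> 'e \<Rightarrow> real" where
  "bump z0 r z = exp 1 * flat_fun 1 (1 - (z - z0) \<bullet> (z - z0) / r\<^sup>2)"

lemma bump_center [simp]: "bump z0 r z0 = 1"
  by (simp add: bump_def flat_fun_def exp_minus)

lemma bump_eq_0:
  assumes "r > 0" "z \<notin> cball z0 r" shows "bump z0 r z = 0"
proof -
  have "r < norm (z - z0)" using assms(2) by (simp add: dist_norm norm_minus_commute)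
  then have "r\<^sup>2 < (z - z0) \<bullet> (z - z0)"
    using assms(1) by (metis dot_square_norm less_eq_real_def pos2 power_strict_mono)
  then show ?thesis using assms(1) by (simp add: bump_def flat_fun_def field_simps)
qed

lemma smooth_on_bump: "smooth_on UNIV (bump z0 r)"
proof -
  have aff: "smooth_on UNIV (\<lambda>z. z - z0)"
    using smooth_on_add[OF open_UNIV smooth_on_linear[OF bounded_linear_ident open_UNIV]
        smooth_on_const[OF open_UNIV, of "- z0"]] by simp
  have "smooth_on UNIV (\<lambda>z. (z - z0) \<bullet> (z - z0))"
    using smooth_on_bilinear[OF bounded_bilinear_inner open_UNIV aff aff] .
  from smooth_on_bilinear[OF bounded_bilinear_mult open_UNIV smooth_on_const[OF open_UNIV, of "- (1 / r\<^sup>2)"] this]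
  have "smooth_on UNIV (\<lambda>z. - (1 / r\<^sup>2) * ((z - z0) \<bullet> (z - z0)))" .
  from smooth_on_add[OF open_UNIV smooth_on_const[OF open_UNIV, of 1] this]
  have "smooth_on UNIV (\<lambda>z. 1 - (z - z0) \<bullet> (z - z0) / r\<^sup>2)" by simp
  from smooth_on_compose[OF orthonormal_frame_Basis open_UNIV smooth_on_flat_fun[of 1] this]
  have "smooth_on UNIV (\<lambda>z. flat_fun 1 (1 - (z - z0) \<bullet> (z - z0) / r\<^sup>2))" by simp
  from smooth_on_bilinear[OF bounded_bilinear_mult open_UNIV smooth_on_const[OF open_UNIV, of "exp 1"] this]
  show ?thesis by (simp add: bump_def[abs_def])
qed

lemma bump_deriv_center:
  assumes "r > 0"
  shows "(bump z0 r has_derivative (\<lambda>_. 0)) (at z0)"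
proof -
  have inner: "((\<lambda>z. 1 - (z - z0) \<bullet> (z - z0) / r\<^sup>2) has_derivative (\<lambda>_. 0)) (at z0)"
    using assms by (auto intro!: derivative_eq_intros)
  have "(flat_fun 1 has_derivative (\<lambda>v. flat_fun (flat_deriv 1) (1 - (z0 - z0) \<bullet> (z0 - z0) / r\<^sup>2) * v))
      (at (1 - (z0 - z0) \<bullet> (z0 - z0) / r\<^sup>2))"
    using flat_fun_deriv by (simp add: has_field_derivative_def)
  from has_derivative_compose[OF inner this]
  have "((\<lambda>z. flat_fun 1 (1 - (z - z0) \<bullet> (z - z0) / r\<^sup>2)) has_derivative (\<lambda>_. 0)) (at z0)" by simp
  from has_derivative_mult_right[OF this, of "exp 1"]
  show ?thesis by (simp add: bump_def[abs_def])
qed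

text \<open>The ball is a closed subset of a translated box, and the box is a finite sum of segments.\<close>

lemma compact_cball_frame:
  fixes z0 :: "'e::real_inner"
  assumes "orthonormal_frame (B :: 'e set)"
  shows "compact (cball z0 r)"
proof -
  have fin: "finite B" using assms by (simp add: orthonormal_frame_def)
  have box: "compact {\<Sum>b\<in>A. c b *\<^sub>R b | c. \<forall>b\<in>A. c b \<in> {-r..r}}" if "finite A" for A :: "'e set"
    using that
  proof (induction A)
    case (insert a A)
    have eq: "{\<Sum>b\<in>insert a A. c b *\<^sub>R b | c. \<forall>b\<in>insert a A. c b \<in> {-r..r}}
        = {x + y | x y. x \<in> (\<lambda>t. t *\<^sub>R a) ` {-r..r} \<and> y \<in> {\<Sum>b\<in>A. c b *\<^sub>R b | c. \<forall>b\<in>A. c b \<in> {-r..r}}}"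
      (is "?L = ?R")
    proof
      show "?L \<subseteq> ?R"
      proof
        fix z assume "z \<in> ?L"
        then obtain c where c: "\<forall>b\<in>insert a A. c b \<in> {-r..r}" "z = (\<Sum>b\<in>insert a A. c b *\<^sub>R b)" by blast
        then have "z = c a *\<^sub>R a + (\<Sum>b\<in>A. c b *\<^sub>R b)" using insert(1,2) by simp
        moreover have "c a *\<^sub>R a \<in> (\<lambda>t. t *\<^sub>R a) ` {-r..r}" by (rule imageI) (use c(1) in simp)
        moreover have "\<forall>b\<in>A. c b \<in> {-r..r}" using c(1) by simp
        ultimately show "z \<in> ?R" by blast
      qed
      show "?R \<subseteq> ?L"
      proof
        fix z assume "z \<in> ?R"
        then obtain t c where tc: "t \<in> {-r..r}" "\<forall>b\<in>A. c b \<in> {-r..r}" "z = t *\<^sub>R a + (\<Sum>b\<in>A. c b *\<^sub>R b)"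
          by blast
        have "(\<Sum>b\<in>A. (c(a := t)) b *\<^sub>R b) = (\<Sum>b\<in>A. c b *\<^sub>R b)"
          using insert(2) by (intro sum.cong) auto
        then have "z = (\<Sum>b\<in>insert a A. (c(a := t)) b *\<^sub>R b)"
          using insert(1,2) tc(3) by simp
        moreover have "\<forall>b\<in>insert a A. (c(a := t)) b \<in> {-r..r}" using tc by simp
        ultimately show "z \<in> ?L" by blast
      qed
    qed
    have "compact ((\<lambda>t. t *\<^sub>R a) ` {-r..r})"
      by (intro compact_continuous_image continuous_intros) simp
    from compact_sums[OF this insert(3)] show ?case unfolding eq .
  qed simp
  have "cball z0 r \<subseteq> (+) z0 ` {\<Sum>b\<in>B. c b *\<^sub>R b | c. \<forall>b\<in>B. c b \<in> {-r..r}}"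
  proof
    fix z assume z: "z \<in> cball z0 r"
    have "(z - z0) \<bullet> b \<in> {-r..r}" if "b \<in> B" for b
    proof -
      have "\<bar>(z - z0) \<bullet> b\<bar> \<le> norm (z - z0) * norm b" by (rule Cauchy_Schwarz_ineq2)
      also have "\<dots> \<le> r" using assms that z
        by (auto simp: orthonormal_frame_def dist_norm norm_minus_commute)
      finally show ?thesis by auto
    qed
    moreover have "z = z0 + (\<Sum>b\<in>B. ((z - z0) \<bullet> b) *\<^sub>R b)"
      using assms by (simp add: orthonormal_frame_def)
    ultimately show "z \<in> (+) z0 ` {\<Sum>b\<in>B. c b *\<^sub>R b | c. \<forall>b\<in>B. c b \<in> {-r..r}}" by blast
  qed
  moreover have "compact ((+) z0 ` {\<Sum>b\<in>B. c b *\<^sub>R b | c. \<forall>b\<in>B. c b \<in> {-r..r}})" (is "compact ?T")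
    by (rule compact_translation[OF box[OF fin]])
  ultimately show ?thesis using compact_Int_closed[of ?T "cball z0 r"] by (simp add: inf.absorb2)
qed

lemma smooth_manifold_chart:
  assumes "smooth_manifold A" "points A = UNIV" "(V, \<phi>) \<in> A"
  shows "homeomorphism V (\<phi> ` V) \<phi> (inv_into V \<phi>)" "open V" "open (\<phi> ` V)"
  using assms unfolding smooth_manifold_def by fastforce+

lemma smooth_fun_iff:
  "smooth_fun A u \<longleftrightarrow> continuous_on (points A) u \<and> (\<forall>(U, \<phi>)\<in>A. smooth_on (\<phi> ` U) (u \<circ> inv_into U \<phi>))"
  by (auto simp: smooth_fun_def smooth_map_def points_def)

text \<open>A smooth function of the coordinates of one chart with compact support is extended by 0 to the
  whole manifold; on the domains of the other charts it is smooth by the chain rule.\<close>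

lemma smooth_fun_extend_by_0:
  fixes A :: "('p::t2_space, 'f::real_inner) atlas"
  assumes man: "smooth_manifold A" "points A = UNIV" and ch: "(U, \<psi>) \<in> A"
    and g: "smooth_on UNIV g" "compact C" "C \<subseteq> \<psi> ` U" "\<And>z. z \<notin> C \<Longrightarrow> g z = (0::complex)"
  shows "smooth_fun A (\<lambda>y. if y \<in> U then g (\<psi> y) else 0)" (is "smooth_fun A ?g")
    and "compact (inv_into U \<psi> ` C)"
    and "y \<notin> inv_into U \<psi> ` C \<Longrightarrow> (if y \<in> U then g (\<psi> y) else 0) = 0"
proof -
  note hom = smooth_manifold_chart(1)[OF man] and oV = smooth_manifold_chart(2)[OF man]
    and oi = smooth_manifold_chart(3)[OF man]
  obtain B0 :: "'f set" where "finite B0" "span B0 = UNIV" using man(1) by (auto simp: smooth_manifold_def)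
  then obtain B :: "'f set" where B: "orthonormal_frame B" by (rule orthonormal_frame_exists)
  note hU = hom[OF ch]
  let ?K = "inv_into U \<psi> ` C"
  show K: "compact ?K"
    using hU g(2,3) by (meson compact_continuous_image continuous_on_subset homeomorphism_cont2)
  have KU: "?K \<subseteq> U" using g(3) inv_into_into[of _ \<psi> U] by blast
  have out: "?g y = 0" if "y \<notin> ?K" for y
  proof (cases "y \<in> U")
    case True
    then have "\<psi> y \<notin> C" using that hU by (metis homeomorphism_apply1 image_eqI)
    then show ?thesis using g(4) by simp
  qed simp
  show "y \<notin> ?K \<Longrightarrow> ?g y = 0" by (rule out)
  have oK: "open (- ?K)" using K by (simp add: compact_imp_closed open_Compl)
  have "continuous_on UNIV ?g"
  proof -
    have "continuous_on U ?g"
      using smooth_on_continuous[OF g(1)] homeomorphism_cont1[OF hU]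
      by (auto intro: continuous_on_eq[OF continuous_on_compose2])
    moreover have "continuous_on (- ?K) ?g"
      by (rule continuous_on_eq[of _ "\<lambda>_. 0"]) (auto simp: out)
    ultimately have "continuous_on (U \<union> - ?K) ?g"
      using oV[OF ch] oK by (simp add: continuous_on_open_Un)
    moreover have "U \<union> - ?K = UNIV" using KU by blast
    ultimately show ?thesis by simp
  qed
  moreover have "smooth_on (\<phi> ` V) (?g \<circ> inv_into V \<phi>)" if V: "(V, \<phi>) \<in> A" for V \<phi>
  proof (rule smooth_on_local)
    fix z assume z: "z \<in> \<phi> ` V"
    note hV = hom[OF V]
    have pre: "open {z \<in> \<phi> ` V. inv_into V \<phi> z \<in> W}" if "open W" for W
      using continuous_open_preimage[OF homeomorphism_cont2[OF hV] oi[OF V] that]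
      by (simp add: vimage_def Int_def)
    show "\<exists>T. open T \<and> z \<in> T \<and> smooth_on T (?g \<circ> inv_into V \<phi>)"
    proof (cases "inv_into V \<phi> z \<in> U")
      case True
      let ?T = "{z \<in> \<phi> ` V. inv_into V \<phi> z \<in> U}"
      have "smooth_on (\<phi> ` (V \<inter> U)) (\<psi> \<circ> inv_into V \<phi>)"
        using man(1) V ch unfolding smooth_manifold_def by blast
      then have "smooth_on ?T (\<psi> \<circ> inv_into V \<phi>)"
        by (rule smooth_on_subset) (use hV in \<open>auto simp: homeomorphism_def\<close>)
      from smooth_on_compose[OF B pre[OF oV[OF ch]] g(1) this]
      have "smooth_on ?T (\<lambda>z. g ((\<psi> \<circ> inv_into V \<phi>) z))" by simp
      then have "smooth_on ?T (?g \<circ> inv_into V \<phi>)"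
        by (rule smooth_on_cong[OF pre[OF oV[OF ch]], rotated]) auto
      then show ?thesis using True z pre[OF oV[OF ch]] by blast
    next
      case False
      let ?T = "{z \<in> \<phi> ` V. inv_into V \<phi> z \<in> - ?K}"
      have "smooth_on ?T (\<lambda>_. 0)" by (rule smooth_on_const[OF pre[OF oK]])
      then have "smooth_on ?T (?g \<circ> inv_into V \<phi>)"
        by (rule smooth_on_cong[OF pre[OF oK], rotated]) (use out in auto)
      then show ?thesis using False KU z pre[OF oK] by blast
    qed
  qed
  ultimately show "smooth_fun A ?g" by (auto simp: smooth_fun_iff man(2))
qed


section \<open>Matrices acting on finitely supported vectors\<close>

abbreviation supp :: "('i \<Rightarrow> complex) \<Rightarrow> 'i set" where "supp x \<equiv> {i. x i \<noteq> 0}"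

definition l2 :: "('i \<Rightarrow> complex) \<Rightarrow> real" where
  "l2 x = L2_set (\<lambda>i. norm (x i)) (supp x)"

definition dot :: "('i \<Rightarrow> complex) \<Rightarrow> ('i \<Rightarrow> complex) \<Rightarrow> complex" where
  "dot x y = (\<Sum>i\<in>supp x. cnj (x i) * y i)"

definition mv :: "('i \<Rightarrow> 'i \<Rightarrow> complex) \<Rightarrow> ('i \<Rightarrow> complex) \<Rightarrow> 'i \<Rightarrow> complex" where
  "mv a x k = (\<Sum>l\<in>supp x. a k l * x l)"

definition mm :: "('i \<Rightarrow> 'i \<Rightarrow> complex) \<Rightarrow> ('i \<Rightarrow> 'i \<Rightarrow> complex) \<Rightarrow> 'i \<Rightarrow> 'i \<Rightarrow> complex" where
  "mm a b k l = (\<Sum>j\<in>supp (\<lambda>j. b j l). a k j * b j l)"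

definition adj :: "('i \<Rightarrow> 'i \<Rightarrow> complex) \<Rightarrow> 'i \<Rightarrow> 'i \<Rightarrow> complex" where
  "adj a k l = cnj (a l k)"

text \<open>Matrices with finite columns act on the finitely supported vectors, a dense subspace of
  \<open>\<ell>\<^sup>2\<close>. The norm of a bounded operator is a supremum over that subspace, and so all sums stay finite.\<close>

definition col_finite :: "('i \<Rightarrow> 'i \<Rightarrow> complex) \<Rightarrow> bool" where
  "col_finite a \<longleftrightarrow> (\<forall>l. finite (supp (\<lambda>k. a k l)))"

definition op_bound :: "('i \<Rightarrow> 'i \<Rightarrow> complex) \<Rightarrow> real \<Rightarrow> bool" where
  "op_bound a C \<longleftrightarrow> 0 \<le> C \<and> (\<forall>x. finite (supp x) \<longrightarrow> l2 (mv a x) \<le> C * l2 x)"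

definition op_norm :: "('i \<Rightarrow> 'i \<Rightarrow> complex) \<Rightarrow> real" where
  "op_norm a = (SUP x\<in>{x. finite (supp x) \<and> l2 x \<le> 1}. l2 (mv a x))"

lemma l2_superset: "finite F \<Longrightarrow> supp x \<subseteq> F \<Longrightarrow> l2 x = L2_set (\<lambda>i. norm (x i)) F"
  unfolding l2_def L2_set_def by (rule arg_cong[where f=sqrt], rule sum.mono_neutral_left) auto

lemma dot_superset: "finite F \<Longrightarrow> supp x \<subseteq> F \<Longrightarrow> dot x y = (\<Sum>i\<in>F. cnj (x i) * y i)"
  unfolding dot_def by (rule sum.mono_neutral_left) auto

lemma mv_superset: "finite F \<Longrightarrow> supp x \<subseteq> F \<Longrightarrow> mv a x k = (\<Sum>l\<in>F. a k l * x l)"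
  unfolding mv_def by (rule sum.mono_neutral_left) auto

lemma l2_nonneg: "0 \<le> l2 x"
  by (simp add: l2_def L2_set_nonneg)

lemma l2_sq: "finite F \<Longrightarrow> supp x \<subseteq> F \<Longrightarrow> (l2 x)\<^sup>2 = (\<Sum>i\<in>F. (norm (x i))\<^sup>2)"
  by (simp add: l2_superset L2_set_def sum_nonneg)

lemma dot_self: "finite (supp x) \<Longrightarrow> dot x x = of_real ((l2 x)\<^sup>2)"
  by (simp add: l2_sq[OF _ order_refl] dot_def complex_norm_square mult.commute del: of_real_power)

lemma dot_le:
  assumes "finite (supp x)" "finite (supp y)"
  shows "norm (dot x y) \<le> l2 x * l2 y"
proof -
  define F where "F = supp x \<union> supp y"
  have F: "finite F" "supp x \<subseteq> F" "supp y \<subseteq> F" using assms by (auto simp: F_def)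
  have "norm (dot x y) \<le> (\<Sum>i\<in>F. \<bar>norm (x i)\<bar> * \<bar>norm (y i)\<bar>)"
    unfolding dot_superset[OF F(1,2)]
    by (rule order_trans[OF norm_sum]) (simp add: norm_mult)
  also have "\<dots> \<le> l2 x * l2 y"
    unfolding l2_superset[OF F(1,2)] l2_superset[OF F(1,3)] by (rule L2_set_mult_ineq)
  finally show ?thesis .
qed

lemma l2_add:
  assumes "finite (supp x)" "finite (supp y)"
  shows "l2 (\<lambda>i. x i + y i) \<le> l2 x + l2 y"
proof -
  define F where "F = supp x \<union> supp y"
  have F: "finite F" "supp x \<subseteq> F" "supp y \<subseteq> F" "supp (\<lambda>i. x i + y i) \<subseteq> F"
    using assms by (auto simp: F_def)
  have "L2_set (\<lambda>i. norm (x i + y i)) F \<le> L2_set (\<lambda>i. norm (x i) + norm (y i)) F"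
    by (rule L2_set_mono) (auto intro: norm_triangle_ineq)
  also have "\<dots> \<le> L2_set (\<lambda>i. norm (x i)) F + L2_set (\<lambda>i. norm (y i)) F"
    by (rule L2_set_triangle_ineq)
  finally show ?thesis using F by (simp add: l2_superset[of F])
qed

lemma l2_scale: "l2 (\<lambda>i. c * x i) = norm c * l2 x"
proof (cases "c = 0")
  case False
  then show ?thesis by (simp add: l2_def norm_mult L2_set_right_distrib)
qed (simp add: l2_def)

lemma mv_finite:
  assumes "col_finite a" "finite (supp x)" shows "finite (supp (mv a x))"
proof (rule finite_subset)
  show "supp (mv a x) \<subseteq> (\<Union>l\<in>supp x. supp (\<lambda>k. a k l))"
  proof
    fix k assume "k \<in> supp (mv a x)"
    then have "(\<Sum>l\<in>supp x. a k l * x l) \<noteq> 0" by (simp add: mv_def)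
    then obtain l where "l \<in> supp x" "a k l * x l \<noteq> 0" by (rule sum.not_neutral_contains_not_neutral)
    then show "k \<in> (\<Union>l\<in>supp x. supp (\<lambda>k. a k l))" by auto
  qed
  show "finite (\<Union>l\<in>supp x. supp (\<lambda>k. a k l))" using assms by (auto simp: col_finite_def)
qed

lemma mv_scale: "mv a (\<lambda>i. c * x i) = (\<lambda>i. c * mv a x i)"
  by (cases "c = 0") (auto simp: mv_def sum_distrib_left mult_ac)

lemma dot_mv:
  assumes "col_finite a" "col_finite (adj a)" "finite (supp x)" "finite (supp y)"
  shows "dot y (mv a x) = dot (mv (adj a) y) x"
proof -
  define F where "F = supp x \<union> supp y \<union> supp (mv (adj a) y)"
  have F: "finite F" "supp x \<subseteq> F" "supp y \<subseteq> F" "supp (mv (adj a) y) \<subseteq> F"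
    using assms mv_finite[OF assms(2,4)] by (auto simp: F_def)
  have "dot y (mv a x) = (\<Sum>k\<in>F. \<Sum>l\<in>F. cnj (y k) * (a k l * x l))"
    by (simp add: dot_superset[OF F(1,3)] mv_superset[OF F(1,2)] sum_distrib_left)
  also have "\<dots> = (\<Sum>l\<in>F. \<Sum>k\<in>F. cnj (y k) * (a k l * x l))" by (rule sum.swap)
  also have "\<dots> = dot (mv (adj a) y) x"
    by (simp add: dot_superset[OF F(1,4)] mv_superset[OF F(1,3)] sum_distrib_left sum_distrib_right
        adj_def mult_ac)
  finally show ?thesis .
qed

lemma mv_mm:
  assumes "col_finite b" "finite (supp x)"
  shows "mv (mm a b) x = mv a (mv b x)"
proof
  fix k
  define F where "F = supp (mv b x) \<union> (\<Union>l\<in>supp x. supp (\<lambda>j. b j l))"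
  have F: "finite F" "supp (mv b x) \<subseteq> F" and Fl: "l \<in> supp x \<Longrightarrow> supp (\<lambda>j. b j l) \<subseteq> F" for l
    using assms mv_finite[OF assms] by (auto simp: F_def col_finite_def)
  have "mm a b k l = (\<Sum>j\<in>F. a k j * b j l)" if "l \<in> supp x" for l
    unfolding mm_def using Fl[OF that] F(1) by (intro sum.mono_neutral_left) auto
  then have "mv (mm a b) x k = (\<Sum>l\<in>supp x. \<Sum>j\<in>F. a k j * b j l * x l)"
    unfolding mv_def[of "mm a b"] by (intro sum.cong) (auto simp: sum_distrib_right)
  also have "\<dots> = (\<Sum>j\<in>F. \<Sum>l\<in>supp x. a k j * b j l * x l)" by (rule sum.swap)
  also have "\<dots> = mv a (mv b x) k"
    by (simp add: mv_superset[OF F(1,2)] mv_def[of b] sum_distrib_left mult_ac)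
  finally show "mv (mm a b) x k = mv a (mv b x) k" .
qed

lemma op_norm_le:
  assumes "op_bound a C" shows "op_norm a \<le> C"
proof -
  have "l2 (mv a x) \<le> C" if "finite (supp x)" "l2 x \<le> 1" for x
  proof -
    have "l2 (mv a x) \<le> C * l2 x" using assms that by (simp add: op_bound_def)
    also have "\<dots> \<le> C * 1" using assms that by (intro mult_left_mono) (auto simp: op_bound_def)
    finally show ?thesis by simp
  qed
  moreover have "finite (supp (\<lambda>_ :: 'a. 0)) \<and> l2 (\<lambda>_ :: 'a. 0) \<le> 1" by (simp add: l2_def)
  then have "{x :: 'a \<Rightarrow> complex. finite (supp x) \<and> l2 x \<le> 1} \<noteq> {}" by fast
  ultimately show ?thesis unfolding op_norm_def by (intro cSUP_least) simp_all
qed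

lemma op_norm_upper:
  assumes "op_bound a C" "finite (supp x)" "l2 x \<le> 1"
  shows "l2 (mv a x) \<le> op_norm a"
  unfolding op_norm_def
proof (rule cSUP_upper)
  have "l2 (mv a x) \<le> C" if "finite (supp x)" "l2 x \<le> 1" for x
  proof -
    have "l2 (mv a x) \<le> C * l2 x" using assms that by (simp add: op_bound_def)
    also have "\<dots> \<le> C * 1" using assms that by (intro mult_left_mono) (auto simp: op_bound_def)
    finally show ?thesis by simp
  qed
  then show "bdd_above ((\<lambda>x. l2 (mv a x)) ` {x. finite (supp x) \<and> l2 x \<le> 1})"
    by (intro bdd_aboveI[of _ C]) auto
qed (use assms in simp)

lemma op_norm_nonneg: "op_bound a C \<Longrightarrow> 0 \<le> op_norm a"
  using op_norm_upper[of a C "\<lambda>_. 0"] order_trans[OF l2_nonneg[of "mv a (\<lambda>_. 0)"]]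
  by (simp add: l2_def[of "\<lambda>_. 0"])

lemma op_norm_bound:
  assumes "op_bound a C" shows "op_bound a (op_norm a)"
  unfolding op_bound_def
proof (intro conjI allI impI)
  show "0 \<le> op_norm a" by (rule op_norm_nonneg[OF assms])
  fix x :: "'a \<Rightarrow> complex" assume fin: "finite (supp x)"
  show "l2 (mv a x) \<le> op_norm a * l2 x"
  proof (cases "l2 x = 0")
    case True
    then show ?thesis using assms fin l2_nonneg[of "mv a x"] by (fastforce simp: op_bound_def)
  next
    case False
    define c where "c = complex_of_real (1 / l2 x)"
    have pos: "l2 x > 0" using False l2_nonneg[of x] by simp
    have "l2 (mv a (\<lambda>i. c * x i)) \<le> op_norm a"
    proof (rule op_norm_upper[OF assms])
      show "finite (supp (\<lambda>i. c * x i))" using fin by (auto intro: finite_subset)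
      show "l2 (\<lambda>i. c * x i) \<le> 1"
        unfolding l2_scale using pos by (simp add: c_def norm_divide)
    qed
    then have "1 / l2 x * l2 (mv a x) \<le> op_norm a"
      unfolding mv_scale l2_scale using pos by (simp add: c_def norm_divide)
    then show ?thesis using pos by (simp add: field_simps)
  qed
qed

text \<open>An entry is a component of the image of a unit vector.\<close>

lemma op_norm_entry:
  assumes "op_bound a C" "col_finite a" shows "norm (a k l) \<le> op_norm a"
proof -
  define x :: "'a \<Rightarrow> complex" where "x = (\<lambda>i. if i = l then 1 else 0)"
  have s: "supp x = {l}" by (auto simp: x_def)
  have "l2 x = 1" unfolding l2_def s L2_set_def by (simp add: x_def)
  moreover have m: "mv a x = (\<lambda>k. a k l)" unfolding mv_def s by (simp add: x_def)
  moreover have "norm (a k l) \<le> l2 (\<lambda>k. a k l)"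
  proof (cases "a k l = 0")
    case False
    have "norm (a k l) \<le> L2_set (\<lambda>i. norm (a i l)) (supp (\<lambda>k. a k l))"
      using assms(2) False by (intro member_le_L2_set) (auto simp: col_finite_def)
    then show ?thesis by (simp add: l2_def)
  qed (simp add: l2_nonneg)
  ultimately show ?thesis using op_norm_upper[OF assms(1), of x] s by simp
qed

lemma op_norm_add:
  assumes "op_bound a C" "op_bound b D" "col_finite a" "col_finite b"
  shows "op_norm (\<lambda>k l. a k l + b k l) \<le> op_norm a + op_norm b"
proof (rule op_norm_le)
  note A = op_norm_bound[OF assms(1), unfolded op_bound_def] and B = op_norm_bound[OF assms(2), unfolded op_bound_def]
  have "l2 (mv (\<lambda>k l. a k l + b k l) x) \<le> (op_norm a + op_norm b) * l2 x" if "finite (supp x)" for x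
  proof -
    have "mv (\<lambda>k l. a k l + b k l) x = (\<lambda>k. mv a x k + mv b x k)"
      by (auto simp: mv_def algebra_simps sum.distrib)
    then have "l2 (mv (\<lambda>k l. a k l + b k l) x) \<le> l2 (mv a x) + l2 (mv b x)"
      using l2_add[OF mv_finite mv_finite] assms(3,4) that by simp
    also have "\<dots> \<le> op_norm a * l2 x + op_norm b * l2 x" using A B that by (intro add_mono) auto
    finally show ?thesis by (simp add: algebra_simps)
  qed
  then show "op_bound (\<lambda>k l. a k l + b k l) (op_norm a + op_norm b)"
    using A B by (simp add: op_bound_def)
qed

lemma op_norm_scale:
  assumes "op_bound a C" shows "op_norm (\<lambda>k l. c * a k l) = norm c * op_norm a"
proof -
  have eq: "l2 (mv (\<lambda>k l. c * b k l) x) = norm c * l2 (mv b x)" for b :: "'a \<Rightarrow> 'a \<Rightarrow> complex" and c x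
    by (simp add: mv_def[abs_def] l2_scale sum_distrib_left[symmetric] mult.assoc)
  have le: "op_norm (\<lambda>k l. c * b k l) \<le> norm c * op_norm b \<and> op_bound (\<lambda>k l. c * b k l) (norm c * op_norm b)"
    if "op_bound b D" for b :: "'a \<Rightarrow> 'a \<Rightarrow> complex" and c D
  proof -
    have "op_bound (\<lambda>k l. c * b k l) (norm c * op_norm b)"
      using op_norm_bound[OF that] by (auto simp: op_bound_def eq mult.assoc intro: mult_left_mono)
    then show ?thesis using op_norm_le by blast
  qed
  show ?thesis
  proof (cases "c = 0")
    case True
    then show ?thesis
      using le[OF assms, of 0] op_norm_nonneg[of "\<lambda>k l. 0 * a k l"] by force
  next
    case False
    (* the reverse inequality is the first one for the factor inverse c *)
    have "op_norm (\<lambda>k l. inverse c * (c * a k l)) \<le> norm (inverse c) * op_norm (\<lambda>k l. c * a k l)"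
      using le[OF assms, of c] le[of "\<lambda>k l. c * a k l" _ "inverse c"] by blast
    moreover have "(\<lambda>k l. inverse c * (c * a k l)) = a" using False by (simp add: fun_eq_iff)
    ultimately have "norm c * op_norm a \<le> op_norm (\<lambda>k l. c * a k l)"
      using False by (simp add: norm_divide field_simps)
    then show ?thesis using le[OF assms, of c] by linarith
  qed
qed

lemma op_norm_mm:
  assumes "op_bound a C" "op_bound b D" "col_finite b"
  shows "op_norm (mm a b) \<le> op_norm a * op_norm b" and "op_bound (mm a b) (op_norm a * op_norm b)"
proof -
  note A = op_norm_bound[OF assms(1), unfolded op_bound_def] and B = op_norm_bound[OF assms(2), unfolded op_bound_def]
  have "l2 (mv (mm a b) x) \<le> op_norm a * op_norm b * l2 x" if "finite (supp x)" for x
  proof -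
    have "l2 (mv (mm a b) x) \<le> op_norm a * l2 (mv b x)"
      using A mv_finite[OF assms(3) that] by (simp add: mv_mm[OF assms(3) that])
    also have "\<dots> \<le> op_norm a * (op_norm b * l2 x)" using A B that by (intro mult_left_mono) auto
    finally show ?thesis by (simp add: mult.assoc)
  qed
  then show "op_bound (mm a b) (op_norm a * op_norm b)" using A B by (simp add: op_bound_def)
  then show "op_norm (mm a b) \<le> op_norm a * op_norm b" by (rule op_norm_le)
qed

text \<open>The C*-identity follows from \<open>\<parallel>a x\<parallel>\<^sup>2 = \<langle>x, a\<^sup>* a x\<rangle> \<le> \<parallel>a\<^sup>* a\<parallel> \<parallel>x\<parallel>\<^sup>2\<close>: it
  gives \<open>\<parallel>a\<parallel>\<^sup>2 \<le> \<parallel>a\<^sup>* a\<parallel> \<le> \<parallel>a\<^sup>*\<parallel> \<parallel>a\<parallel>\<close>, hence \<open>\<parallel>a\<parallel> \<le> \<parallel>a\<^sup>*\<parallel>\<close>, and equality by symmetry.\<close>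

lemma op_norm_cstar:
  assumes "op_bound a C" "op_bound (adj a) D" "col_finite a" "col_finite (adj a)"
  shows "op_norm (mm (adj a) a) = (op_norm a)\<^sup>2"
proof -
  have key: "(op_norm b)\<^sup>2 \<le> op_norm (mm (adj b) b) \<and> op_norm b \<le> op_norm (adj b)"
    if b: "op_bound b C'" "op_bound (adj b) D'" "col_finite b" "col_finite (adj b)"
    for b :: "'a \<Rightarrow> 'a \<Rightarrow> complex" and C' D'
  proof -
    let ?n = "op_norm (mm (adj b) b)"
    have n: "op_bound (mm (adj b) b) ?n"
      by (rule op_norm_bound[OF op_norm_mm(2)[OF b(2,1,3)]])
    have "l2 (mv b x) \<le> sqrt ?n * l2 x" if x: "finite (supp x)" for x
    proof -
      note f = mv_finite[OF b(3) x]
      have "of_real ((l2 (mv b x))\<^sup>2) = dot (mv b x) (mv b x)" using dot_self[OF f] by simp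
      also have "\<dots> = dot (mv (adj b) (mv b x)) x" by (rule dot_mv[OF b(3,4) x f])
      also have "\<dots> = dot (mv (mm (adj b) b) x) x" by (simp add: mv_mm[OF b(3) x])
      finally have "complex_of_real ((l2 (mv b x))\<^sup>2) = dot (mv (mm (adj b) b) x) x" .
      then have "(l2 (mv b x))\<^sup>2 = norm (dot (mv (mm (adj b) b) x) x)"
        by (metis norm_of_real abs_of_nonneg zero_le_power2)
      also have "\<dots> \<le> l2 (mv (mm (adj b) b) x) * l2 x"
        using mv_finite[OF b(4) f] x by (intro dot_le) (simp_all add: mv_mm[OF b(3) x])
      also have "\<dots> \<le> ?n * l2 x * l2 x"
        using n x l2_nonneg by (intro mult_right_mono) (auto simp: op_bound_def)
      also have "\<dots> = (sqrt ?n * l2 x)\<^sup>2"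
        using op_norm_nonneg[OF n] by (simp add: power_mult_distrib power2_eq_square)
      finally show ?thesis
        using op_norm_nonneg[OF n] l2_nonneg[of x] by (meson power2_le_imp_le mult_nonneg_nonneg real_sqrt_ge_zero)
    qed
    then have "op_norm b \<le> sqrt ?n"
      using op_norm_nonneg[OF n] by (intro op_norm_le) (simp add: op_bound_def)
    then have 1: "(op_norm b)\<^sup>2 \<le> ?n"
      using op_norm_nonneg[OF b(1)] op_norm_nonneg[OF n]
      by (metis power_mono real_sqrt_pow2)
    also have "?n \<le> op_norm (adj b) * op_norm b" by (rule op_norm_mm(1)[OF b(2,1,3)])
    finally have "op_norm b * op_norm b \<le> op_norm (adj b) * op_norm b" by (simp add: power2_eq_square)
    then have "op_norm b \<le> op_norm (adj b)"
      using op_norm_nonneg[OF b(1)] op_norm_nonneg[OF b(2)]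
      by (metis less_eq_real_def mult_right_le_imp_le)
    with 1 show ?thesis by simp
  qed
  have aa: "adj (adj a) = a" by (simp add: adj_def fun_eq_iff)
  have "op_norm (adj a) = op_norm a"
    using key[OF assms] key[of "adj a" D C] assms aa by simp
  then show ?thesis
    using key[OF assms] op_norm_mm(1)[OF assms(2,1,3)] by (simp add: power2_eq_square)
qed

text \<open>Schur's test. The Cauchy--Schwarz inequality with the weights \<open>\<bar>a\<^sub>k\<^sub>l\<bar>\<close> gives
  \<open>\<bar>(a x)\<^sub>k\<bar>\<^sup>2 \<le> C (\<Sum>\<^sub>l \<bar>a\<^sub>k\<^sub>l\<bar> \<bar>x\<^sub>l\<bar>\<^sup>2)\<close> from the row sums; summation over \<open>k\<close> then uses the column sums.\<close>

lemma schur_test: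
  assumes C: "0 \<le> C" and cf: "col_finite a"
    and row: "\<And>k S. finite S \<Longrightarrow> (\<Sum>l\<in>S. norm (a k l)) \<le> C"
    and col: "\<And>l S. finite S \<Longrightarrow> (\<Sum>k\<in>S. norm (a k l)) \<le> C"
  shows "op_bound a C"
  unfolding op_bound_def
proof (intro conjI allI impI C)
  fix x :: "'a \<Rightarrow> complex" assume x: "finite (supp x)"
  let ?S = "supp x" and ?T = "supp (mv a x)"
  have T: "finite ?T" by (rule mv_finite[OF cf x])
  have "(norm (mv a x k))\<^sup>2 \<le> C * (\<Sum>l\<in>?S. norm (a k l) * (norm (x l))\<^sup>2)" for k
  proof -
    have "norm (mv a x k) \<le> (\<Sum>l\<in>?S. sqrt (norm (a k l)) * (sqrt (norm (a k l)) * norm (x l)))"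
      unfolding mv_def by (rule order_trans[OF norm_sum]) (simp add: norm_mult mult.assoc[symmetric])
    then have "(norm (mv a x k))\<^sup>2 \<le> (\<Sum>l\<in>?S. sqrt (norm (a k l)) * (sqrt (norm (a k l)) * norm (x l)))\<^sup>2"
      by (rule power_mono) simp
    also have "\<dots> \<le> (\<Sum>l\<in>?S. (sqrt (norm (a k l)))\<^sup>2) * (\<Sum>l\<in>?S. (sqrt (norm (a k l)) * norm (x l))\<^sup>2)"
      by (rule Cauchy_Schwarz_ineq_sum)
    also have "\<dots> = (\<Sum>l\<in>?S. norm (a k l)) * (\<Sum>l\<in>?S. norm (a k l) * (norm (x l))\<^sup>2)"
      by (simp add: power_mult_distrib)
    also have "\<dots> \<le> C * (\<Sum>l\<in>?S. norm (a k l) * (norm (x l))\<^sup>2)"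
      using row[OF x] by (intro mult_right_mono sum_nonneg) auto
    finally show ?thesis .
  qed
  then have "(l2 (mv a x))\<^sup>2 \<le> (\<Sum>k\<in>?T. C * (\<Sum>l\<in>?S. norm (a k l) * (norm (x l))\<^sup>2))"
    unfolding l2_sq[OF T order_refl] by (rule sum_mono)
  also have "\<dots> = C * (\<Sum>l\<in>?S. (\<Sum>k\<in>?T. norm (a k l)) * (norm (x l))\<^sup>2)"
    by (subst sum_distrib_left[symmetric], subst sum.swap) (simp add: sum_distrib_right)
  also have "\<dots> \<le> C * (\<Sum>l\<in>?S. C * (norm (x l))\<^sup>2)"
    using C col[OF T] by (intro mult_left_mono sum_mono mult_right_mono) auto
  also have "\<dots> = (C * l2 x)\<^sup>2"
    unfolding power_mult_distrib l2_sq[OF x order_refl]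
    by (simp add: sum_distrib_left[symmetric] power2_eq_square)
  finally show "l2 (mv a x) \<le> C * l2 x"
    using C l2_nonneg[of x] by (meson power2_le_imp_le mult_nonneg_nonneg)
qed


section \<open>The regular representations of a subgroupoid\<close>

lemma compact_int_finite:
  assumes "compact (S :: int set)" shows "finite S"
proof -
  obtain T where "T \<subseteq> S" "finite T" "S \<subseteq> (\<Union>z\<in>T. {z})"
    by (rule compactE_image[OF assms, of S "\<lambda>z. {z}"]) (auto simp: open_discrete)
  then show ?thesis by (auto intro: finite_subset)
qed

lemma compact_int_vec_finite:
  assumes "compact (S :: (int ^ 'n) set)" shows "finite S"
proof -
  have fin: "finite ((\<lambda>k. k $ i) ` S)" for i
    by (intro compact_int_finite compact_continuous_image[OF _ assms] continuous_intros)
  have "vec_nth ` S \<subseteq> (\<Pi>\<^sub>E i\<in>UNIV. (\<lambda>k. k $ i) ` S)" by auto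
  moreover have "finite (\<Pi>\<^sub>E i\<in>UNIV. (\<lambda>k. k $ i) ` S)" by (rule finite_PiE) (simp_all add: fin)
  ultimately have "finite (vec_nth ` S)" by (rule finite_subset)
  then show ?thesis by (rule finite_imageD) (simp add: inj_on_def vec_eq_iff)
qed

lemma hk_0 [simp]: "hk h 0 = 0" "hk 0 k = 0"
  by (simp_all add: hk_def vec_eq_iff)

lemma hk_add: "hk h (k + l) = hk h k + hk h l"
  by (simp add: hk_def vec_eq_iff distrib_left)

text \<open>The groupoid of the theorem and each of its fibers over \<open>\<real>\<close> are given by a set of arrows of the
  transformation groupoid \<open>Gtilde\<close> that is closed under products and inverses, and are treated together.\<close>

locale subgroupoid =
  fixes \<beta> :: "real ^ 'n \<Rightarrow> 'p::topological_space \<Rightarrow> 'p"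
    and A :: "(real \<times> 'p \<times> (int ^ 'n)) set"
  assumes act_0: "\<beta> 0 y = y"
    and act_add: "\<beta> (X + Y) y = \<beta> X (\<beta> Y y)"
    and arrows_comp: "(h, \<beta> (hk h m) y, l) \<in> A \<Longrightarrow> (h, y, m) \<in> A \<Longrightarrow> (h, y, l + m) \<in> A"
    and arrows_inv: "(h, y, k) \<in> A \<Longrightarrow> (h, \<beta> (hk h k) y, - k) \<in> A"
    and nonempty: "A \<noteq> {}"
begin

definition H :: "(real \<times> 'p \<times> (int ^ 'n), real \<times> 'p) groupoid" where
  "H = Gtilde \<beta> \<lparr> arrows := A \<rparr>"

lemma H_simps [simp]:
  "arrows H = A" "src H (h, y, k) = (h, y)" "rng H (h, y, k) = (h, \<beta> (hk h k) y)"
  "gcomp H (h', y', l) (h, y, k) = (h, y, l + k)" "ginv H (h, y, k) = (h, \<beta> (hk h k) y, - k)"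
  by (simp_all add: H_def Gtilde_def)

abbreviation shift :: "real \<Rightarrow> int ^ 'n \<Rightarrow> 'p \<Rightarrow> 'p" where "shift h k \<equiv> \<beta> (hk h k)"

lemma shift_add: "shift h (k + l) y = shift h k (shift h l y)"
  by (simp add: hk_add act_add)

lemma shift_minus [simp]: "shift h (- k) (shift h k y) = y" "shift h k (shift h (- k) y) = y"
  using shift_add[of h "- k" k y] shift_add[of h k "- k" y] by (simp_all add: act_0)

lemma arrows_inv_iff: "(h, shift h k y, - k) \<in> A \<longleftrightarrow> (h, y, k) \<in> A"
  using arrows_inv[of h y k] arrows_inv[of h "shift h k y" "- k"] by auto

text \<open>These are the consequences of compact support that matter for the regular representations. The
  class is stable under the involution, for which continuity would need a separate argument.\<close>

definition banded :: "(real \<times> 'p \<times> (int ^ 'n) \<Rightarrow> complex) \<Rightarrow> bool" where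
  "banded f \<longleftrightarrow> (\<forall>g. g \<notin> A \<longrightarrow> f g = 0) \<and> (\<exists>F. finite F \<and> (\<forall>h y k. k \<notin> F \<longrightarrow> f (h, y, k) = 0)) \<and>
     (\<exists>B. \<forall>g. norm (f g) \<le> B)"

lemma banded_0: "banded f \<Longrightarrow> g \<notin> A \<Longrightarrow> f g = 0"
  unfolding banded_def by blast

lemma bandedE:
  assumes "banded f"
  obtains F B where "finite F" "\<And>h y k. k \<notin> F \<Longrightarrow> f (h, y, k) = 0" "\<And>g. norm (f g) \<le> B" "0 \<le> B"
    "\<And>g. g \<notin> A \<Longrightarrow> f g = 0"
proof -
  obtain F B where *: "finite F" "\<forall>h y k. k \<notin> F \<longrightarrow> f (h, y, k) = 0" "\<forall>g. norm (f g) \<le> B" "\<forall>g. g \<notin> A \<longrightarrow> f g = 0"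
    using assms unfolding banded_def by blast
  then have "0 \<le> B" using norm_ge_zero order_trans by blast
  with * show thesis using that by blast
qed

lemma Cc_banded:
  assumes "f \<in> Cc H" shows "banded f"
proof -
  obtain K where f: "continuous_on A f" and K: "compact K" "K \<subseteq> A" "\<And>g. g \<notin> K \<Longrightarrow> f g = 0"
    using assms by (auto simp: Cc_def)
  have "compact ((\<lambda>g. snd (snd g)) ` K)"
    by (intro compact_continuous_image[OF _ K(1)] continuous_intros)
  then have "finite ((\<lambda>g. snd (snd g)) ` K)" by (rule compact_int_vec_finite)
  moreover have "\<forall>h y k. k \<notin> (\<lambda>g. snd (snd g)) ` K \<longrightarrow> f (h, y, k) = 0"
    using K(3) by force
  moreover have "compact (f ` K)"
    by (rule compact_continuous_image[OF continuous_on_subset[OF f K(2)] K(1)])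
  then obtain B where B: "\<And>g. g \<in> K \<Longrightarrow> norm (f g) \<le> B"
    using compact_imp_bounded bounded_iff by (metis imageI)
  have "norm (f g) \<le> max B 0" for g
    using B[of g] K(3)[of g] by (cases "g \<in> K") auto
  ultimately show ?thesis using K(2,3) unfolding banded_def by blast
qed

lemma banded_gstar: assumes "banded f" shows "banded (gstar H f)"
proof -
  obtain F B where f: "finite F" "\<And>h y k. k \<notin> F \<Longrightarrow> f (h, y, k) = 0" "\<And>g. norm (f g) \<le> B" "0 \<le> B"
    using bandedE[OF assms] by metis
  have "gstar H f (h, y, k) = 0" if "k \<notin> uminus ` F" for h y k
  proof -
    have "- k \<notin> F" using that by (metis image_eqI minus_minus)
    then show ?thesis using f(2) by (simp add: gstar_def)
  qed
  moreover have "norm (gstar H f g) \<le> B" for g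
    using f(3,4) by (simp add: gstar_def)
  moreover have "gstar H f g = 0" if "g \<notin> A" for g using that by (simp add: gstar_def)
  moreover have "finite (uminus ` F)" using f(1) by simp
  ultimately show ?thesis unfolding banded_def by blast
qed

text \<open>The matrix of f in the regular representation on the arrows with source \<open>(h, y)\<close>: its entry at
  \<open>(k, l)\<close> is the value of f at the product of \<open>(h, y, k)\<close> with the inverse of \<open>(h, y, l)\<close>. All of
  \<open>\<int>\<^sup>n\<close> serves as index set; if the product is not an arrow of A, the entry is 0.\<close>

definition regrep :: "(real \<times> 'p \<times> (int ^ 'n) \<Rightarrow> complex) \<Rightarrow> real \<Rightarrow> 'p \<Rightarrow> int ^ 'n \<Rightarrow> int ^ 'n \<Rightarrow> complex" where
  "regrep f h y k l = f (h, shift h l y, k - l)"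

text \<open>A factorisation of \<open>(h, y, m)\<close> is determined by the index of its right factor. As the functions
  vanish outside of A, the formula holds for all triples, arrows or not.\<close>

lemma conv_banded:
  assumes "banded f" "banded f'"
  shows "conv H f f' (h, y, m)
    = (\<Sum>k\<in>supp (\<lambda>k. f' (h, y, k)). f (h, shift h k y, m - k) * f' (h, y, k))"
proof -
  obtain F B where f: "finite F" "\<And>h y k. k \<notin> F \<Longrightarrow> f' (h, y, k) = 0" and f'A: "\<And>g. g \<notin> A \<Longrightarrow> f' g = 0"
    using bandedE[OF assms(2)] by metis
  note fA = banded_0[OF assms(1)]
  let ?S = "supp (\<lambda>k. f' (h, y, k))"
  have S: "finite ?S" by (rule finite_subset[OF _ f(1)]) (use f(2) in auto)
  let ?P = "\<lambda>k. ((h, shift h k y, m - k), (h, y, k))"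
  show ?thesis
  proof (cases "(h, y, m) \<in> A")
    case True
    have "conv H f f' (h, y, m) = infsum (\<lambda>(g1, g2). f g1 * f' g2) (?P ` ?S)"
      unfolding conv_def H_simps(1) if_P[OF True]
    proof (rule infsum_cong_neutral)
      fix p assume "p \<in> {(g1, g2). g1 \<in> A \<and> g2 \<in> A \<and> src H g1 = rng H g2 \<and> gcomp H g1 g2 = (h, y, m)} - ?P ` ?S"
      moreover obtain h1 y1 k1 h2 y2 k2 where "p = ((h1, y1, k1), (h2, y2, k2))" by (metis surj_pair)
      ultimately show "(case p of (g1, g2) \<Rightarrow> f g1 * f' g2) = 0" by (auto simp: image_iff)
    next
      fix p assume "p \<in> ?P ` ?S - {(g1, g2). g1 \<in> A \<and> g2 \<in> A \<and> src H g1 = rng H g2 \<and> gcomp H g1 g2 = (h, y, m)}"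
      then show "(case p of (g1, g2) \<Rightarrow> f g1 * f' g2) = 0"
        using fA[of "fst p"] f'A[of "snd p"] by (cases p) auto
    qed simp
    also have "\<dots> = (\<Sum>p\<in>?P ` ?S. case p of (g1, g2) \<Rightarrow> f g1 * f' g2)" using S by simp
    also have "\<dots> = (\<Sum>k\<in>?S. f (h, shift h k y, m - k) * f' (h, y, k))"
      by (subst sum.reindex) (auto simp: inj_on_def)
    finally show ?thesis .
  next
    case False
    have "f (h, shift h k y, m - k) * f' (h, y, k) = 0" for k
      using arrows_comp[of h k y "m - k"] fA[of "(h, shift h k y, m - k)"] f'A[of "(h, y, k)"] False by auto
    then have "(\<Sum>k\<in>?S. f (h, shift h k y, m - k) * f' (h, y, k)) = 0" by (intro sum.neutral) blast
    then show ?thesis using False by (simp add: conv_def)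
  qed
qed

lemma regrep_conv:
  assumes "banded f" "banded f'"
  shows "regrep (conv H f f') h y = mm (regrep f h y) (regrep f' h y)"
proof (intro ext)
  fix k l
  have "supp (\<lambda>j. f' (h, shift h l y, j - l)) = (\<lambda>j. l + j) ` supp (\<lambda>j. f' (h, shift h l y, j))"
    by (auto intro!: image_eqI[of _ _ "_ - l"])
  then have "mm (regrep f h y) (regrep f' h y) k l
      = (\<Sum>j\<in>(\<lambda>j. l + j) ` supp (\<lambda>j. f' (h, shift h l y, j)).
          f (h, shift h j y, k - j) * f' (h, shift h l y, j - l))"
    by (simp add: mm_def regrep_def)
  also have "\<dots> = regrep (conv H f f') h y k l"
    unfolding regrep_def conv_banded[OF assms]
    by (subst sum.reindex) (auto simp: inj_on_def shift_add[symmetric] add.commute diff_diff_eq intro!: sum.cong)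
  finally show "regrep (conv H f f') h y k l = mm (regrep f h y) (regrep f' h y) k l" ..
qed

lemma regrep_gstar:
  assumes "banded f"
  shows "regrep (gstar H f) h y = adj (regrep f h y)"
proof (intro ext)
  fix k l
  have "shift h (k - l) (shift h l y) = shift h k y" using shift_add[of h "k - l" l y] by simp
  then show "regrep (gstar H f) h y k l = adj (regrep f h y) k l"
    using arrows_inv_iff[of h "k - l" "shift h l y"] assms
    by (auto simp: regrep_def gstar_def adj_def banded_def)
qed

lemma regrep_col_finite:
  assumes "banded f" shows "col_finite (regrep f h y)"
proof -
  obtain F where F: "finite F" "\<And>h y k. k \<notin> F \<Longrightarrow> f (h, y, k) = 0" using bandedE[OF assms] by metis
  have "supp (\<lambda>k. regrep f h y k l) \<subseteq> (\<lambda>j. j + l) ` F" for l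
    using F(2) by (auto simp: regrep_def image_iff) (metis diff_add_cancel)
  then show ?thesis using F(1) unfolding col_finite_def by (meson finite_imageI finite_subset)
qed

text \<open>An arrow is determined by its index together with its source or its range, so a banded function has
  boundedly many nonzero values on each fiber. The supremum in the I-norm is therefore finite, and it
  bounds the sum over any finite set of arrows with a common range or a common source.\<close>

lemma fiber_sum_le:
  assumes f: "banded f" and inj: "\<And>u. inj_on (\<lambda>(_, _, k). k) (Fib u)"
  shows "bdd_above ((\<lambda>u. \<Sum>\<^sub>\<infinity>g\<in>Fib u. norm (f g)) ` units H)"
    and "finite S \<Longrightarrow> S \<subseteq> Fib u \<Longrightarrow> (\<Sum>g\<in>S. norm (f g)) \<le> (\<Sum>\<^sub>\<infinity>g\<in>Fib u. norm (f g))"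
proof -
  obtain F B where F: "finite F" "\<And>h y k. k \<notin> F \<Longrightarrow> f (h, y, k) = 0" "\<And>g. norm (f g) \<le> B" "0 \<le> B"
    using bandedE[OF f] by metis
  let ?N = "\<lambda>u. {g \<in> Fib u. f g \<noteq> 0}"
  have sub: "(\<lambda>(_, _, k). k) ` ?N u \<subseteq> F" for u using F(2) by auto
  have injN: "inj_on (\<lambda>(_, _, k). k) (?N u)" for u
    using inj[of u] by (auto intro: inj_on_subset)
  have fin: "finite (?N u)" and card: "card (?N u) \<le> card F" for u
    using inj_on_finite[OF injN sub F(1)] card_inj_on_le[OF injN sub F(1)] by auto
  have eq: "(\<Sum>\<^sub>\<infinity>g\<in>Fib u. norm (f g)) = (\<Sum>g\<in>?N u. norm (f g))" for u
    using fin[of u] by (subst infsum_finite[OF fin, symmetric]) (rule infsum_cong_neutral, auto)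
  have "(\<Sum>\<^sub>\<infinity>g\<in>Fib u. norm (f g)) \<le> real (card F) * B" for u
  proof -
    have "(\<Sum>g\<in>?N u. norm (f g)) \<le> real (card (?N u)) * B"
      using F(3) by (intro sum_bounded_above) auto
    also have "\<dots> \<le> real (card F) * B" using card F(4) by (intro mult_right_mono) auto
    finally show ?thesis by (simp add: eq)
  qed
  then show "bdd_above ((\<lambda>u. \<Sum>\<^sub>\<infinity>g\<in>Fib u. norm (f g)) ` units H)"
    by (intro bdd_aboveI) blast
  assume S: "finite S" "S \<subseteq> Fib u"
  have "(\<Sum>g\<in>S. norm (f g)) = (\<Sum>g\<in>S \<inter> ?N u. norm (f g))"
    using S by (intro sum.mono_neutral_right) auto
  also have "\<dots> \<le> (\<Sum>g\<in>?N u. norm (f g))" using fin by (intro sum_mono2) auto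
  finally show "(\<Sum>g\<in>S. norm (f g)) \<le> (\<Sum>\<^sub>\<infinity>g\<in>Fib u. norm (f g))" by (simp add: eq)
qed

lemma inj_range_fiber: "inj_on (\<lambda>(_, _, k). k) (range_fiber H u)"
  unfolding range_fiber_def by (auto simp: inj_on_def) (metis shift_minus(1))+

lemma inj_source_fiber: "inj_on (\<lambda>(_, _, k). k) (source_fiber H u)"
  unfolding source_fiber_def by (auto simp: inj_on_def)

lemma sum_range_fiber_le:
  assumes "banded f" "finite S" "S \<subseteq> range_fiber H u" "u \<in> units H"
  shows "(\<Sum>g\<in>S. norm (f g)) \<le> I_norm H f"
  unfolding I_norm_def
  using fiber_sum_le(2)[where Fib="range_fiber H", OF assms(1) inj_range_fiber assms(2,3)]
    cSUP_upper[OF assms(4) fiber_sum_le(1)[where Fib="range_fiber H", OF assms(1) inj_range_fiber]]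
  by linarith

lemma sum_source_fiber_le:
  assumes "banded f" "finite S" "S \<subseteq> source_fiber H u" "u \<in> units H"
  shows "(\<Sum>g\<in>S. norm (f g)) \<le> I_norm H f"
  unfolding I_norm_def
  using fiber_sum_le(2)[where Fib="source_fiber H", OF assms(1) inj_source_fiber assms(2,3)]
    cSUP_upper[OF assms(4) fiber_sum_le(1)[where Fib="source_fiber H", OF assms(1) inj_source_fiber]]
  by linarith

lemma I_norm_nonneg: assumes "banded f" shows "0 \<le> I_norm H f"
proof -
  obtain g where "g \<in> A" using nonempty by blast
  then have "src H g \<in> units H" by (simp add: units_def)
  then show ?thesis using sum_source_fiber_le[OF assms, of "{}" "src H g"] by simp
qed

lemma rng_units: assumes "g \<in> A" shows "rng H g \<in> units H"
proof -
  obtain h y k where g: "g = (h, y, k)" by (metis surj_pair)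
  have "rng H g = src H (h, shift h k y, - k)" by (simp add: g)
  then show ?thesis using arrows_inv[of h y k] assms g unfolding units_def H_simps(1) by blast
qed

lemma fiber_family_le:
  assumes f: "banded f" and S: "finite S" "inj_on G S"
    and fib: "(\<forall>l\<in>S. G l \<in> A \<longrightarrow> rng H (G l) = u) \<or> (\<forall>l\<in>S. G l \<in> A \<longrightarrow> src H (G l) = u)"
  shows "(\<Sum>l\<in>S. norm (f (G l))) \<le> I_norm H f"
proof -
  let ?S' = "{l \<in> S. G l \<in> A}"
  have "(\<Sum>l\<in>S. norm (f (G l))) = (\<Sum>l\<in>?S'. norm (f (G l)))"
    using S(1) banded_0[OF f] by (intro sum.mono_neutral_right) auto
  also have "\<dots> = (\<Sum>g\<in>G ` ?S'. norm (f g))"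
    by (subst sum.reindex) (auto intro: inj_on_subset[OF S(2)])
  also have "\<dots> \<le> I_norm H f"
  proof (cases "?S' = {}")
    case True
    then show ?thesis using I_norm_nonneg[OF f] by (simp only: image_empty sum.empty)
  next
    case False
    then obtain l where l: "l \<in> S" "G l \<in> A" by blast
    have fin: "finite (G ` ?S')" using S(1) by simp
    from fib show ?thesis
    proof
      assume r: "\<forall>l\<in>S. G l \<in> A \<longrightarrow> rng H (G l) = u"
      then have "u \<in> units H" using rng_units[OF l(2)] l by simp
      then show ?thesis
        using r by (intro sum_range_fiber_le[OF f fin]) (auto simp: range_fiber_def)
    next
      assume r: "\<forall>l\<in>S. G l \<in> A \<longrightarrow> src H (G l) = u"
      then have "u \<in> units H" using l unfolding units_def H_simps(1) by (metis image_eqI)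
      then show ?thesis
        using r by (intro sum_source_fiber_le[OF f fin]) (auto simp: source_fiber_def)
    qed
  qed
  finally show ?thesis .
qed

text \<open>Row sums run over arrows with a common range and column sums over arrows with a common source.\<close>

lemma regrep_bound:
  assumes f: "banded f" shows "op_bound (regrep f h y) (I_norm H f)"
proof (rule schur_test[OF I_norm_nonneg[OF f] regrep_col_finite[OF f]])
  fix S :: "(int ^ 'n) set" assume S: "finite S"
  have "shift h (k - l) (shift h l y) = shift h k y" for k l using shift_add[of h "k - l" l y] by simp
  then show "(\<Sum>l\<in>S. norm (regrep f h y k l)) \<le> I_norm H f" for k
    unfolding regrep_def by (intro fiber_family_le[OF f S]) (auto simp: inj_on_def)
  show "(\<Sum>k\<in>S. norm (regrep f h y k l)) \<le> I_norm H f" for l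
    unfolding regrep_def by (intro fiber_family_le[OF f S]) (auto simp: inj_on_def)
qed

lemma regrep_seminorm: "bounded_cstar_seminorm H (\<lambda>f. op_norm (regrep f h y))"
  unfolding bounded_cstar_seminorm_def
proof (intro conjI ballI allI)
  fix f assume "f \<in> Cc H"
  then have f: "banded f" by (rule Cc_banded)
  note bd = regrep_bound[OF f, of h y] and cf = regrep_col_finite[OF f, of h y]
  show "0 \<le> op_norm (regrep f h y)" by (rule op_norm_nonneg[OF bd])
  show "op_norm (regrep f h y) \<le> I_norm H f" by (rule op_norm_le[OF bd])
  show "op_norm (regrep (conv H (gstar H f) f) h y) = (op_norm (regrep f h y))\<^sup>2"
    unfolding regrep_conv[OF banded_gstar[OF f] f] regrep_gstar[OF f]
    using regrep_bound[OF banded_gstar[OF f], of h y] regrep_col_finite[OF banded_gstar[OF f], of h y]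
    unfolding regrep_gstar[OF f] by (intro op_norm_cstar[OF bd _ cf])
  show "op_norm (regrep (\<lambda>g. c * f g) h y) = norm c * op_norm (regrep f h y)" for c
    using op_norm_scale[OF bd, of c] by (simp add: regrep_def[abs_def])
  fix f' assume "f' \<in> Cc H"
  then have f': "banded f'" by (rule Cc_banded)
  note bd' = regrep_bound[OF f', of h y] and cf' = regrep_col_finite[OF f', of h y]
  show "op_norm (regrep (\<lambda>g. f g + f' g) h y) \<le> op_norm (regrep f h y) + op_norm (regrep f' h y)"
    using op_norm_add[OF bd bd' cf cf'] by (simp add: regrep_def[abs_def])
  show "op_norm (regrep (conv H f f') h y) \<le> op_norm (regrep f h y) * op_norm (regrep f' h y)"
    unfolding regrep_conv[OF f f'] by (rule op_norm_mm(1)[OF bd bd' cf'])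
qed

lemma full_norm_upper:
  assumes "f \<in> Cc H" "bounded_cstar_seminorm H p" shows "p f \<le> full_norm H f"
  unfolding full_norm_def
proof (rule cSUP_upper)
  show "bdd_above ((\<lambda>p. p f) ` {p. bounded_cstar_seminorm H p})"
    by (rule bdd_aboveI[of _ "I_norm H f"]) (use assms(1) in \<open>auto simp: bounded_cstar_seminorm_def\<close>)
qed (use assms(2) in simp)

lemma full_norm_least:
  assumes "\<And>p. bounded_cstar_seminorm H p \<Longrightarrow> p f \<le> C" shows "full_norm H f \<le> C"
  unfolding full_norm_def using regrep_seminorm assms by (intro cSUP_least) auto

text \<open>The value at \<open>(h, y, k)\<close> is the entry \<open>(k, 0)\<close> of the regular representation at \<open>(h, y)\<close>.\<close>

lemma norm_le_full_norm:
  assumes "f \<in> Cc H" shows "norm (f g) \<le> full_norm H f"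
proof -
  obtain h y k where g: "g = (h, y, k)" by (metis surj_pair)
  note f = Cc_banded[OF assms]
  have "norm (f g) = norm (regrep f h y k 0)" by (simp add: regrep_def g act_0)
  also have "\<dots> \<le> op_norm (regrep f h y)" by (rule op_norm_entry[OF regrep_bound[OF f] regrep_col_finite[OF f]])
  also have "\<dots> \<le> full_norm H f" by (rule full_norm_upper[OF assms regrep_seminorm])
  finally show ?thesis .
qed

lemma Cc_scale: assumes "f \<in> Cc H" shows "(\<lambda>g. c * f g) \<in> Cc H"
proof -
  obtain K where "compact K" "K \<subseteq> A" "\<forall>g. g \<notin> K \<longrightarrow> f g = 0" and "continuous_on A f"
    using assms unfolding Cc_def H_simps by blast
  then show ?thesis by (auto simp: Cc_def intro!: continuous_on_mult_left exI[of _ K])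
qed

lemma Cc_add:
  assumes "f \<in> Cc H" "f' \<in> Cc H" shows "(\<lambda>g. f g + f' g) \<in> Cc H"
proof -
  obtain K K' where K: "compact K" "K \<subseteq> A" "\<forall>g. g \<notin> K \<longrightarrow> f g = 0"
      "compact K'" "K' \<subseteq> A" "\<forall>g. g \<notin> K' \<longrightarrow> f' g = 0"
    and c: "continuous_on A f" "continuous_on A f'"
    using assms unfolding Cc_def H_simps by blast
  have "compact (K \<union> K')" "K \<union> K' \<subseteq> A" "\<forall>g. g \<notin> K \<union> K' \<longrightarrow> f g + f' g = 0" using K by auto
  with continuous_on_add[OF c] show ?thesis unfolding Cc_def H_simps by blast
qed

lemma full_norm_add:
  assumes "f \<in> Cc H" "f' \<in> Cc H"
  shows "full_norm H (\<lambda>g. f g + f' g) \<le> full_norm H f + full_norm H f'"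
proof (rule full_norm_least)
  fix p assume p: "bounded_cstar_seminorm H p"
  then have "p (\<lambda>g. f g + f' g) \<le> p f + p f'" using assms by (simp add: bounded_cstar_seminorm_def)
  also have "\<dots> \<le> full_norm H f + full_norm H f'" using full_norm_upper p assms by (intro add_mono)
  finally show "p (\<lambda>g. f g + f' g) \<le> full_norm H f + full_norm H f'" .
qed

lemma full_norm_scale_le:
  assumes "f \<in> Cc H" shows "full_norm H (\<lambda>g. c * f g) \<le> norm c * full_norm H f"
proof (rule full_norm_least)
  fix p assume p: "bounded_cstar_seminorm H p"
  then have "p (\<lambda>g. c * f g) = norm c * p f" using assms by (simp add: bounded_cstar_seminorm_def)
  also have "\<dots> \<le> norm c * full_norm H f" using full_norm_upper[OF assms p] by (intro mult_left_mono) auto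
  finally show "p (\<lambda>g. c * f g) \<le> norm c * full_norm H f" .
qed

lemma full_norm_nonneg: "f \<in> Cc H \<Longrightarrow> 0 \<le> full_norm H f"
  using norm_le_full_norm order_trans[OF norm_ge_zero] by blast

end


section \<open>Point values on the C*-completion\<close>

context subgroupoid
begin

definition fdist :: "(real \<times> 'p \<times> (int ^ 'n) \<Rightarrow> complex) \<Rightarrow> (real \<times> 'p \<times> (int ^ 'n) \<Rightarrow> complex) \<Rightarrow> real" where
  "fdist f f' = nrm (Cc_alg H) (alg_sub (Cc_alg H) f f')"

lemma fdist_eq: "fdist f f' = full_norm H (\<lambda>g. f g - f' g)"
  by (simp add: fdist_def Cc_alg_def alg_sub_def)

lemma Cc_diff: "f \<in> Cc H \<Longrightarrow> f' \<in> Cc H \<Longrightarrow> (\<lambda>g. f g - f' g) \<in> Cc H"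
  using Cc_add[OF _ Cc_scale[of f' "-1"]] by simp

lemma fdist_self: assumes "f \<in> Cc H" shows "fdist f f = 0"
  using full_norm_scale_le[OF assms, of 0] full_norm_nonneg[OF Cc_diff[OF assms assms]]
  by (simp add: fdist_eq)

lemma fdist_ge: "f \<in> Cc H \<Longrightarrow> f' \<in> Cc H \<Longrightarrow> norm (f g - f' g) \<le> fdist f f'"
  unfolding fdist_eq by (rule norm_le_full_norm[OF Cc_diff])

lemma full_norm_diff_le:
  assumes "f \<in> Cc H" "f' \<in> Cc H" shows "\<bar>full_norm H f - full_norm H f'\<bar> \<le> fdist f f'"
proof -
  have "full_norm H f \<le> full_norm H (\<lambda>g. f g - f' g) + full_norm H f'"
    using full_norm_add[OF Cc_diff[OF assms] assms(2)] by simp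
  moreover have "full_norm H f' \<le> full_norm H (\<lambda>g. f' g - f g) + full_norm H f"
    using full_norm_add[OF Cc_diff[OF assms(2,1)] assms(1)] by simp
  moreover have "full_norm H (\<lambda>g. f' g - f g) \<le> full_norm H (\<lambda>g. f g - f' g)"
    using full_norm_scale_le[OF Cc_diff[OF assms], of "-1"] by simp
  ultimately show ?thesis by (simp add: fdist_eq)
qed

lemma fdist_add:
  assumes "f1 \<in> Cc H" "f2 \<in> Cc H" "f1' \<in> Cc H" "f2' \<in> Cc H"
  shows "fdist (\<lambda>g. f1 g + f2 g) (\<lambda>g. f1' g + f2' g) \<le> fdist f1 f1' + fdist f2 f2'"
  using full_norm_add[OF Cc_diff[OF assms(1,3)] Cc_diff[OF assms(2,4)]]
  by (simp add: fdist_eq algebra_simps)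

lemma fdist_scale:
  assumes "f \<in> Cc H" "f' \<in> Cc H"
  shows "fdist (\<lambda>g. c * f g) (\<lambda>g. c * f' g) \<le> norm c * fdist f f'"
  using full_norm_scale_le[OF Cc_diff[OF assms], of c] by (simp add: fdist_eq algebra_simps)

lemma cauchy_iff:
  "cauchy_in (Cc_alg H) u \<longleftrightarrow> (\<forall>i. u i \<in> Cc H) \<and> (\<forall>e>0. \<exists>N. \<forall>i\<ge>N. \<forall>j\<ge>N. fdist (u i) (u j) < e)"
  by (simp add: cauchy_in_def fdist_def) (simp add: Cc_alg_def)

lemma cls_iff: "v \<in> cls (Cc_alg H) u \<longleftrightarrow> cauchy_in (Cc_alg H) v \<and> (\<lambda>i. fdist (u i) (v i)) \<longlonglongrightarrow> 0"
  by (simp add: cls_def fdist_def)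

lemma rep_cls: "cauchy_in (Cc_alg H) u \<Longrightarrow> rep (cls (Cc_alg H) u) \<in> cls (Cc_alg H) u"
  unfolding rep_def by (rule someI[of _ u]) (simp add: cls_iff cauchy_iff fdist_self)

lemma cls_pointwise:
  assumes "v \<in> cls (Cc_alg H) u" "\<And>i. u i \<in> Cc H"
  shows "(\<lambda>i. u i g - v i g) \<longlonglongrightarrow> 0"
proof (rule Lim_null_comparison)
  show "\<forall>\<^sub>F i in sequentially. norm (u i g - v i g) \<le> fdist (u i) (v i)"
    using assms fdist_ge by (auto simp: cls_iff cauchy_iff)
  show "(\<lambda>i. fdist (u i) (v i)) \<longlonglongrightarrow> 0" using assms(1) by (simp add: cls_iff)
qed

text \<open>Point values of an element of the completion. As the norm dominates the supremum norm, they do not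
  depend on the representing sequence.\<close>

definition val :: "(nat \<Rightarrow> real \<times> 'p \<times> (int ^ 'n) \<Rightarrow> complex) set \<Rightarrow> real \<times> 'p \<times> (int ^ 'n) \<Rightarrow> complex" where
  "val X g = lim (\<lambda>i. rep X i g)"

lemma cauchy_pointwise:
  assumes "cauchy_in (Cc_alg H) u" shows "convergent (\<lambda>i. u i g)"
proof -
  have "Cauchy (\<lambda>i. u i g)"
    unfolding Cauchy_def
  proof (intro allI impI)
    fix e :: real assume "e > 0"
    then obtain N where "\<forall>i\<ge>N. \<forall>j\<ge>N. fdist (u i) (u j) < e" using assms by (auto simp: cauchy_iff)
    moreover have "dist (u i g) (u j g) \<le> fdist (u i) (u j)" for i j
      using assms fdist_ge by (simp add: cauchy_iff dist_norm)
    ultimately show "\<exists>M. \<forall>m\<ge>M. \<forall>n\<ge>M. dist (u m g) (u n g) < e" by (meson le_less_trans)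
  qed
  then show ?thesis by (simp add: Cauchy_convergent)
qed

lemma cstar_elemsE:
  assumes "X \<in> elems (cstar H)"
  obtains u where "cauchy_in (Cc_alg H) u" "X = cls (Cc_alg H) u"
  using assms by (auto simp: cstar_def completion_def)

lemma cls_elems: "cauchy_in (Cc_alg H) u \<Longrightarrow> cls (Cc_alg H) u \<in> elems (cstar H)"
  by (auto simp: cstar_def completion_def)

lemma rep_mem: "X \<in> elems (cstar H) \<Longrightarrow> rep X \<in> X"
  by (metis cstar_elemsE rep_cls)

lemma rep_cauchy: "X \<in> elems (cstar H) \<Longrightarrow> cauchy_in (Cc_alg H) (rep X)"
  using rep_mem[of X] by (auto elim!: cstar_elemsE simp: cls_iff)

lemma rep_Cc: "X \<in> elems (cstar H) \<Longrightarrow> rep X i \<in> Cc H"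
  using rep_cauchy by (simp add: cauchy_iff)

lemma val_lim: "X \<in> elems (cstar H) \<Longrightarrow> (\<lambda>i. rep X i g) \<longlonglongrightarrow> val X g"
  unfolding val_def using cauchy_pointwise[OF rep_cauchy] by (simp add: convergent_LIMSEQ_iff)

text \<open>The sequence \<open>w\<close> is at distance tending to 0 from a Cauchy sequence of the class. In the application it
  is the image of a Cauchy sequence under the restriction to a fiber.\<close>

lemma val_cls:
  assumes "cls (Cc_alg H) w \<in> elems (cstar H)" "\<And>i. w i \<in> Cc H"
  shows "(\<lambda>i. w i g) \<longlonglongrightarrow> val (cls (Cc_alg H) w) g"
  using tendsto_add[OF cls_pointwise[OF rep_mem[OF assms(1)] assms(2)] val_lim[OF assms(1)], of g g] by simp

lemma norm_val_le:
  assumes "X \<in> elems (cstar H)" shows "norm (val X g) \<le> nrm (cstar H) X"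
proof -
  note c = rep_cauchy[OF assms, unfolded cauchy_iff]
  have "Cauchy (\<lambda>i. full_norm H (rep X i))"
    unfolding Cauchy_def
  proof (intro allI impI)
    fix e :: real assume "e > 0"
    then obtain N where "\<forall>i\<ge>N. \<forall>j\<ge>N. fdist (rep X i) (rep X j) < e" using c by blast
    moreover have "dist (full_norm H (rep X i)) (full_norm H (rep X j)) \<le> fdist (rep X i) (rep X j)" for i j
      using full_norm_diff_le c by (simp add: dist_real_def)
    ultimately show "\<exists>M. \<forall>m\<ge>M. \<forall>n\<ge>M. dist (full_norm H (rep X m)) (full_norm H (rep X n)) < e"
      by (meson le_less_trans)
  qed
  then have l1: "(\<lambda>i. full_norm H (rep X i)) \<longlonglongrightarrow> nrm (cstar H) X"
    by (simp add: cstar_def completion_def Cc_alg_def convergent_LIMSEQ_iff[symmetric] Cauchy_convergent)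
  have l2: "(\<lambda>i. norm (rep X i g)) \<longlonglongrightarrow> norm (val X g)" by (intro tendsto_norm val_lim assms)
  show ?thesis by (rule LIMSEQ_le[OF l2 l1]) (use norm_le_full_norm[OF rep_Cc[OF assms]] in blast)
qed

lemma emb_elems: "f \<in> Cc H \<Longrightarrow> emb (Cc_alg H) f \<in> elems (cstar H)"
  unfolding emb_def by (rule cls_elems) (simp add: cauchy_iff fdist_self)

lemma val_emb: assumes "f \<in> Cc H" shows "val (emb (Cc_alg H) f) g = f g"
  using val_cls[OF emb_elems[OF assms, unfolded emb_def], of g] assms
  by (simp add: emb_def LIMSEQ_const_iff)

lemma cauchy_scale:
  assumes "cauchy_in (Cc_alg H) u" shows "cauchy_in (Cc_alg H) (\<lambda>i g. - 1 * u i g)"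
  unfolding cauchy_iff
proof (intro conjI allI impI)
  have u: "u i \<in> Cc H" for i using assms by (simp add: cauchy_iff)
  show "(\<lambda>g. - 1 * u i g) \<in> Cc H" for i by (rule Cc_scale[OF u])
  fix e :: real assume "e > 0"
  then obtain N where "\<forall>i\<ge>N. \<forall>j\<ge>N. fdist (u i) (u j) < e" using assms by (auto simp: cauchy_iff)
  moreover have "fdist (\<lambda>g. - 1 * u i g) (\<lambda>g. - 1 * u j g) \<le> fdist (u i) (u j)" for i j
    using fdist_scale[OF u u, of "-1"] by simp
  ultimately show "\<exists>N. \<forall>i\<ge>N. \<forall>j\<ge>N. fdist (\<lambda>g. - 1 * u i g) (\<lambda>g. - 1 * u j g) < e"
    by (meson le_less_trans)
qed

lemma cauchy_add:
  assumes "cauchy_in (Cc_alg H) u" "cauchy_in (Cc_alg H) v"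
  shows "cauchy_in (Cc_alg H) (\<lambda>i g. u i g + v i g)"
  unfolding cauchy_iff
proof (intro conjI allI impI)
  have u: "u i \<in> Cc H" "v i \<in> Cc H" for i using assms by (simp_all add: cauchy_iff)
  show "(\<lambda>g. u i g + v i g) \<in> Cc H" for i by (rule Cc_add[OF u])
  fix e :: real assume "e > 0"
  then obtain N N' where N: "\<forall>i\<ge>N. \<forall>j\<ge>N. fdist (u i) (u j) < e / 2" "\<forall>i\<ge>N'. \<forall>j\<ge>N'. fdist (v i) (v j) < e / 2"
    using assms unfolding cauchy_iff by (meson half_gt_zero)
  have "fdist (\<lambda>g. u i g + v i g) (\<lambda>g. u j g + v j g) < e" if "i \<ge> max N N'" "j \<ge> max N N'" for i j
  proof -
    have "fdist (u i) (u j) < e / 2" "fdist (v i) (v j) < e / 2" using N that by auto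
    then show ?thesis using fdist_add[OF u(1)[of i] u(2)[of i] u(1)[of j] u(2)[of j]] by linarith
  qed
  then show "\<exists>N. \<forall>i\<ge>N. \<forall>j\<ge>N. fdist (\<lambda>g. u i g + v i g) (\<lambda>g. u j g + v j g) < e" by blast
qed

lemma val_sub:
  assumes X: "X \<in> elems (cstar H)" and Y: "Y \<in> elems (cstar H)"
  shows "alg_sub (cstar H) X Y \<in> elems (cstar H)" "val (alg_sub (cstar H) X Y) g = val X g - val Y g"
proof -
  let ?Z = "cls (Cc_alg H) (\<lambda>i g. - 1 * rep Y i g)"
  let ?w = "\<lambda>i g. rep X i g + rep ?Z i g"
  have Z: "?Z \<in> elems (cstar H)" by (rule cls_elems[OF cauchy_scale[OF rep_cauchy[OF Y]]])
  have eq: "alg_sub (cstar H) X Y = cls (Cc_alg H) ?w"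
    by (simp add: alg_sub_def cstar_def completion_def) (simp add: Cc_alg_def)
  have w: "cls (Cc_alg H) ?w \<in> elems (cstar H)"
    by (rule cls_elems[OF cauchy_add[OF rep_cauchy[OF X] rep_cauchy[OF Z]]])
  then show "alg_sub (cstar H) X Y \<in> elems (cstar H)" by (simp add: eq)
  have "(\<lambda>i. - 1 * rep Y i g) \<longlonglongrightarrow> val ?Z g"
    by (rule val_cls[OF Z]) (rule Cc_scale[OF rep_Cc[OF Y]])
  moreover have "(\<lambda>i. - 1 * rep Y i g) \<longlonglongrightarrow> - 1 * val Y g" by (intro tendsto_mult tendsto_const val_lim Y)
  ultimately have "val ?Z g = - val Y g" using LIMSEQ_unique by fastforce
  then have "(\<lambda>i. ?w i g) \<longlonglongrightarrow> val X g - val Y g"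
    using tendsto_add[OF val_lim[OF X, of g] val_lim[OF Z, of g]] by simp
  moreover have "(\<lambda>i. ?w i g) \<longlonglongrightarrow> val (cls (Cc_alg H) ?w) g"
    by (rule val_cls[OF w]) (intro Cc_add rep_Cc X Z)
  ultimately show "val (alg_sub (cstar H) X Y) g = val X g - val Y g"
    unfolding eq using LIMSEQ_unique by blast
qed

text \<open>A Cauchy sequence converges uniformly.\<close>

lemma continuous_on_val:
  assumes "X \<in> elems (cstar H)" shows "continuous_on A (val X)"
proof (rule uniform_limit_theorem)
  show "\<forall>\<^sub>F i in sequentially. continuous_on A (rep X i)"
    using rep_Cc[OF assms] by (simp add: Cc_def)
  show "uniform_limit A (rep X) (val X) sequentially"
    unfolding uniform_limit_sequentially_iff
  proof (intro allI impI)
    fix e :: real assume "e > 0"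
    then obtain N where N: "\<forall>i\<ge>N. \<forall>j\<ge>N. fdist (rep X i) (rep X j) < e / 2"
      using rep_cauchy[OF assms] unfolding cauchy_iff by (meson half_gt_zero)
    have "dist (rep X i g) (val X g) < e" if "i \<ge> N" for i g
    proof -
      have "(\<lambda>j. norm (rep X i g - rep X j g)) \<longlonglongrightarrow> norm (rep X i g - val X g)"
        by (intro tendsto_intros val_lim assms)
      moreover have "norm (rep X i g - rep X j g) \<le> e / 2" if "j \<ge> N" for j
        using fdist_ge[OF rep_Cc[OF assms] rep_Cc[OF assms], of i g j] N \<open>i \<ge> N\<close> that by fastforce
      ultimately have "norm (rep X i g - val X g) \<le> e / 2"
        by (intro LIMSEQ_le_const2) auto
      then show ?thesis using \<open>e > 0\<close> by (simp add: dist_norm)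
    qed
    then show "\<exists>N. \<forall>n\<ge>N. \<forall>x\<in>A. dist (rep X n x) (val X x) < e" by blast
  qed
qed simp

abbreviation arrows_at :: "real \<Rightarrow> (real \<times> 'p \<times> (int ^ 'n)) set" where
  "arrows_at h \<equiv> {g \<in> A. fst g = h}"

lemma subgroupoid_fiber: "arrows_at h \<noteq> {} \<Longrightarrow> subgroupoid \<beta> (arrows_at h)"
  by unfold_locales (auto simp: act_0 act_add intro: arrows_comp arrows_inv)

lemma fiber_eq: "arrows_at h \<noteq> {} \<Longrightarrow> fiber H fst h = subgroupoid.H \<beta> (arrows_at h)"
  using subgroupoid.H_def[OF subgroupoid_fiber] by (simp add: fiber_def) (simp add: H_def)

lemma restr_Cc:
  assumes "f \<in> Cc H" shows "restr (fiber H fst h) f \<in> Cc (fiber H fst h)"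
proof -
  obtain K where K: "compact K" "K \<subseteq> A" "\<forall>g. g \<notin> K \<longrightarrow> f g = 0" and c: "continuous_on A f"
    using assms unfolding Cc_def H_simps by blast
  have "closed (fst -` {h} :: (real \<times> 'p \<times> (int ^ 'n)) set)"
    by (intro closed_vimage_fst closed_singleton)
  then have 1: "compact (K \<inter> fst -` {h})" using K(1) by (rule compact_Int_closed[rotated])
  have 2: "continuous_on (arrows_at h) (restr (fiber H fst h) f)"
    using continuous_on_subset[OF c, of "arrows_at h"]
    by (rule continuous_on_eq) (auto simp: restr_def fiber_def)
  have 3: "restr (fiber H fst h) f g = 0" if "g \<notin> K \<inter> fst -` {h}" for g
    using that K(3)[rule_format, of g] by (cases "g \<in> K") (auto simp: restr_def fiber_def)
  have 4: "K \<inter> fst -` {h} \<subseteq> arrows_at h" using K(2) by auto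
  have 5: "arrows (fiber H fst h) = arrows_at h" by (simp add: fiber_def)
  show ?thesis
    unfolding Cc_def mem_Collect_eq 5
    by (intro conjI exI[of _ "K \<inter> fst -` {h}"] allI impI) (rule 1 2 3 4, assumption?)+
qed

lemma conv_fiber:
  assumes "f \<in> Cc H" "f' \<in> Cc H" "arrows_at h \<noteq> {}"
  shows "conv (fiber H fst h) (restr (fiber H fst h) f) (restr (fiber H fst h) f')
    = restr (fiber H fst h) (conv H f f')"
proof
  fix g :: "real \<times> 'p \<times> (int ^ 'n)"
  interpret F: subgroupoid \<beta> "arrows_at h" by (rule subgroupoid_fiber[OF assms(3)])
  obtain h' y m where g: "g = (h', y, m)" by (metis surj_pair)
  note b = F.Cc_banded[OF restr_Cc[OF assms(1), of h, unfolded fiber_eq[OF assms(3)]]]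
    F.Cc_banded[OF restr_Cc[OF assms(2), of h, unfolded fiber_eq[OF assms(3)]]]
  show "conv (fiber H fst h) (restr (fiber H fst h) f) (restr (fiber H fst h) f') g
    = restr (fiber H fst h) (conv H f f') g"
  proof (cases "g \<in> arrows_at h")
    case True
    have r: "restr F.H f (h, z, k) = f (h, z, k)" if "f \<in> Cc H" for f z k
      using banded_0[OF Cc_banded[OF that], of "(h, z, k)"] by (auto simp: restr_def)
    have "conv F.H (restr F.H f) (restr F.H f') g = conv H f f' g"
      using True unfolding g F.conv_banded[OF b] conv_banded[OF Cc_banded[OF assms(1)] Cc_banded[OF assms(2)]]
      by (simp add: r[OF assms(1)] r[OF assms(2)])
    then show ?thesis using True by (simp add: fiber_eq[OF assms(3)] restr_def)
  next
    case False
    moreover have "arrows (fiber H fst h) = arrows_at h" by (simp add: fiber_def)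
    ultimately show ?thesis by (simp only: conv_def restr_def if_False)
  qed
qed

text \<open>Near 0 the section is arbitrarily close in norm to the restriction of an element of the completion over
  the whole groupoid. The same bound holds for the point values, and those of the element are continuous
  along the path.\<close>

lemma section_values_continuous:
  assumes ne: "\<And>h. arrows_at h \<noteq> {}"
    and field: "continuous_field (cstar H) (\<lambda>h. cstar (fiber H fst h)) (eval_fiber H fst)"
    and sec: "section_continuous_at (cstar H) (\<lambda>h. cstar (fiber H fst h)) (eval_fiber H fst)
      (\<lambda>h. emb (Cc_alg (fiber H fst h)) (s h)) 0"
    and s: "\<And>h. s h \<in> Cc (fiber H fst h)"
    and path: "\<forall>\<^sub>F h in nhds 0. (h, y, m) \<in> A"
  shows "isCont (\<lambda>h. s h (h, y, m)) 0"
proof -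
  have close: "norm (s h (h, y, m) - val a (h, y, m)) \<le>
      nrm (cstar (fiber H fst h)) (alg_sub (cstar (fiber H fst h)) (emb (Cc_alg (fiber H fst h)) (s h)) (eval_fiber H fst h a))"
    if a: "a \<in> elems (cstar H)" and g: "(h, y, m) \<in> A" for h a
  proof -
    interpret F: subgroupoid \<beta> "arrows_at h" by (rule subgroupoid_fiber[OF ne])
    let ?g = "(h, y, m)" and ?w = "\<lambda>i. restr F.H (rep a i)"
    note eq = fiber_eq[OF ne, of h]
    have sC: "s h \<in> Cc F.H" using s[of h] by (simp add: eq)
    have ev: "eval_fiber H fst h a = cls (Cc_alg F.H) ?w"
      by (simp add: eval_fiber_def completion_map_def eq)
    have "eval_fiber H fst h a \<in> elems (cstar F.H)"
      using field a unfolding continuous_field_def star_hom_def eq[symmetric] by blast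
    then have E: "cls (Cc_alg F.H) ?w \<in> elems (cstar F.H)" by (simp add: ev)
    have "(\<lambda>i. ?w i ?g) \<longlonglongrightarrow> F.val (cls (Cc_alg F.H) ?w) ?g"
      using restr_Cc[OF rep_Cc[OF a], of h] by (intro F.val_cls[OF E]) (simp add: eq)
    moreover have "(\<lambda>i. ?w i ?g) \<longlonglongrightarrow> val a ?g"
      using val_lim[OF a, of ?g] g by (simp add: restr_def)
    ultimately have "F.val (cls (Cc_alg F.H) ?w) ?g = val a ?g" using LIMSEQ_unique by blast
    then have "s h ?g - val a ?g
        = F.val (alg_sub (cstar F.H) (emb (Cc_alg F.H) (s h)) (cls (Cc_alg F.H) ?w)) ?g"
      by (simp add: F.val_sub(2)[OF F.emb_elems[OF sC] E] F.val_emb[OF sC])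
    then show ?thesis
      using F.norm_val_le[OF F.val_sub(1)[OF F.emb_elems[OF sC] E], of ?g] by (simp add: eq ev)
  qed
  obtain U where U: "open U" "0 \<in> U" "\<And>h. h \<in> U \<Longrightarrow> (h, y, m) \<in> A"
    using path unfolding eventually_nhds by blast
  have "\<forall>\<^sub>F h in nhds 0. dist (s h (h, y, m)) (s 0 (0, y, m)) < e" if "e > 0" for e
  proof -
    have e3: "e / 3 > 0" using that by simp
    then obtain a where a: "a \<in> elems (cstar H)"
      and ev: "\<forall>\<^sub>F h in nhds 0. nrm (cstar (fiber H fst h)) (alg_sub (cstar (fiber H fst h))
        (emb (Cc_alg (fiber H fst h)) (s h)) (eval_fiber H fst h a)) < e / 3"
      using sec unfolding section_continuous_at_def by blast
    have near: "\<forall>\<^sub>F h in nhds 0. norm (s h (h, y, m) - val a (h, y, m)) < e / 3"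
      using eventually_conj[OF ev path] by (rule eventually_mono) (use close[OF a] in force)
    then have near0: "norm (s 0 (0, y, m) - val a (0, y, m)) < e / 3" by (rule eventually_nhds_x_imp_x)
    have "continuous_on U (\<lambda>h. val a (h, y, m))"
      by (rule continuous_on_compose2[OF continuous_on_val[OF a]]) (use U(3) in \<open>auto intro!: continuous_intros\<close>)
    then have "isCont (\<lambda>h. val a (h, y, m)) 0" using U(1,2) by (simp add: continuous_on_eq_continuous_at)
    then have "\<forall>\<^sub>F h in nhds 0. dist (val a (h, y, m)) (val a (0, y, m)) < e / 3"
      using tendsto_at_iff_tendsto_nhds[of "\<lambda>h. val a (h, y, m)" 0] tendstoD[OF _ e3]
      unfolding isCont_def by blast
    with near show ?thesis
    proof eventually_elim
      case (elim h)
      have "dist (s h (h, y, m)) (s 0 (0, y, m)) \<le> dist (s h (h, y, m)) (val a (h, y, m))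
          + dist (val a (h, y, m)) (val a (0, y, m)) + dist (val a (0, y, m)) (s 0 (0, y, m))"
        by (meson add_mono dist_triangle order_refl order_trans)
      then show ?case using elim near0 by (simp add: dist_norm norm_minus_commute)
    qed
  qed
  then show ?thesis
    using tendsto_at_iff_tendsto_nhds[of "\<lambda>h. s h (h, y, m)" 0] tendstoI[of "\<lambda>h. s h (h, y, m)"]
    unfolding isCont_def by blast
qed

end


section \<open>Charts\<close>

lemma pointsI: "(U, \<phi>) \<in> A \<Longrightarrow> x \<in> U \<Longrightarrow> x \<in> points A"
  unfolding points_def by (rule UnionI[OF imageI[where f=fst, of "(U, \<phi>)", simplified]])

lemma pointsE:
  assumes "x \<in> points A" obtains U \<phi> where "(U, \<phi>) \<in> A" "x \<in> U"
  using assms unfolding points_def by (metis UnionE imageE prod.collapse)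

lemma restrict_atlasI: "(U, \<phi>) \<in> A \<Longrightarrow> (U \<inter> S, \<phi>) \<in> restrict_atlas A S"
  unfolding restrict_atlas_def by blast

lemma restrict_atlasE:
  assumes "(U', \<phi>) \<in> restrict_atlas A S" obtains U where "(U, \<phi>) \<in> A" "U' = U \<inter> S"
  using assms unfolding restrict_atlas_def by blast

lemma points_restrict_atlas: "points (restrict_atlas A S) = points A \<inter> S"
  by (intro equalityI subsetI) (auto elim!: pointsE restrict_atlasE intro: pointsI restrict_atlasI)

lemma prod_atlasE:
  assumes "(W, \<kappa>) \<in> prod_atlas A B"
  obtains U \<phi> V \<psi> where "(U, \<phi>) \<in> A" "(V, \<psi>) \<in> B" "W = U \<times> V" "\<kappa> = (\<lambda>(x, y). (\<phi> x, \<psi> y))"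
  using assms unfolding prod_atlas_def by blast

lemma smooth_mapD:
  assumes "smooth_map A B f" "(U, \<phi>) \<in> A" "(V, \<psi>) \<in> B"
  shows "smooth_on (\<phi> ` (U \<inter> f -` V)) (\<psi> \<circ> f \<circ> inv_into U \<phi>)"
  using bspec[OF bspec[OF conjunct2[OF conjunct2[OF assms(1)[unfolded smooth_map_def]]] assms(2), simplified] assms(3)]
  by simp

lemma cis_eq_near:
  assumes "cis a = cis b" "\<bar>a - b\<bar> < 2 * pi" shows "a = b"
proof -
  have "cis (a - b) = 1" using assms(1) by (simp add: cis_divide[symmetric])
  then have "cos (a - b) = 1" by (metis cis.simps(1) one_complex.simps(1))
  then obtain n :: int where n: "a - b = of_int n * 2 * pi" unfolding cos_one_2pi_int by blast
  then have "\<bar>of_int n\<bar> * (2 * pi) < 1 * (2 * pi)" using assms(2) by (simp add: abs_mult)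
  then have "\<bar>real_of_int n\<bar> < 1" by (simp only: mult_less_cancel_right) auto
  then have "n = 0" by linarith
  then show ?thesis using n by simp
qed

text \<open>A branch of the argument is locally inverse to \<open>cis\<close>: near a point of its image the two differ by
  a small multiple of \<open>2 \<pi>\<close>, hence by 0.\<close>

lemma circle_chart_open:
  assumes "(U, \<theta>) \<in> circle_atlas" shows "open (\<theta> ` U)"
proof (subst open_dist, intro ballI)
  obtain O' where O': "open O'" "U = sphere 0 1 \<inter> O'" and c: "continuous_on U \<theta>" "\<And>z. z \<in> U \<Longrightarrow> cis (\<theta> z) = z"
    using assms by (auto simp: circle_atlas_def openin_open)
  fix t0 assume "t0 \<in> \<theta> ` U"
  then obtain z0 where z0: "z0 \<in> U" "t0 = \<theta> z0" by blast
  let ?W = "cis -` O'"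
  have W: "open ?W" by (intro open_vimage O'(1) continuous_intros)
  have t0W: "t0 \<in> ?W" using O'(2) z0 c(2)[OF z0(1)] by auto
  have WU: "cis t \<in> U" if "t \<in> ?W" for t using O'(2) that by auto
  have "continuous_on ?W (\<lambda>t. \<theta> (cis t))"
    by (rule continuous_on_compose2[OF c(1)]) (auto intro!: continuous_intros WU)
  then have "isCont (\<lambda>t. \<theta> (cis t)) t0" using t0W by (simp only: continuous_on_eq_continuous_at[OF W])
  then obtain d where d: "d > 0" "\<And>t. dist t t0 < d \<Longrightarrow> dist (\<theta> (cis t)) (\<theta> (cis t0)) < pi"
    unfolding continuous_at_eps_delta using pi_gt_zero by blast
  obtain e where e: "e > 0" "ball t0 e \<subseteq> ?W" using W t0W openE by blast
  have "t \<in> \<theta> ` U" if t: "dist t t0 < min (min d e) pi" for t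
  proof -
    have tW: "t \<in> ?W" using e(2) t by (auto simp: dist_commute)
    have "dist (\<theta> (cis t)) t0 < pi" using d(2)[of t] t c(2)[OF z0(1)] z0(2) by simp
    then have "\<bar>\<theta> (cis t) - t\<bar> < 2 * pi" using t unfolding dist_real_def by linarith
    then have "\<theta> (cis t) = t" using cis_eq_near c(2)[OF WU[OF tW]] by blast
    then show ?thesis using WU[OF tW] by (metis image_eqI)
  qed
  then show "\<exists>e>0. \<forall>t. dist t t0 < e \<longrightarrow> t \<in> \<theta> ` U"
    using d(1) e(1) pi_gt_zero by (intro exI[of _ "min (min d e) pi"]) auto
qed

lemma torus_chart:
  assumes "(V, \<theta>) \<in> torus_atlas"
  shows "open (\<theta> ` V)" "s \<in> V \<Longrightarrow> torus_exp (\<theta> s) = s" "\<exists>O'. open O' \<and> V = torus \<inter> O'"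
proof -
  have "\<exists>U \<eta>. (V, \<theta>) = ({s. \<forall>i. s $ i \<in> U i}, \<lambda>s. \<chi> i. \<eta> i (s $ i)) \<and> (\<forall>i. (U i, \<eta> i) \<in> circle_atlas)"
    using assms unfolding torus_atlas_def by (rule CollectD)
  then obtain U \<eta> where eq: "(V, \<theta>) = ({s. \<forall>i. s $ i \<in> U i}, \<lambda>s. \<chi> i. \<eta> i (s $ i))"
    and all: "\<forall>i. (U i, \<eta> i) \<in> circle_atlas" by (elim exE conjE)
  note U = spec[OF all]
  have V: "V = {s. \<forall>i. s $ i \<in> U i}" "\<theta> = (\<lambda>s. \<chi> i. \<eta> i (s $ i))"
    using eq by (simp_all only: prod.inject)
  have "\<theta> ` V = {\<tau>. \<forall>i. \<tau> $ i \<in> \<eta> i ` U i}"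
  proof
    show "{\<tau>. \<forall>i. \<tau> $ i \<in> \<eta> i ` U i} \<subseteq> \<theta> ` V"
    proof
      fix \<tau> :: "real ^ 'a" assume "\<tau> \<in> {\<tau>. \<forall>i. \<tau> $ i \<in> \<eta> i ` U i}"
      then have "\<forall>i. \<exists>z. \<tau> $ i = \<eta> i z \<and> z \<in> U i" by blast
      then obtain z where z: "\<And>i. \<tau> $ i = \<eta> i (z i) \<and> z i \<in> U i" using choice[of "\<lambda>i z. \<tau> $ i = \<eta> i z \<and> z \<in> U i"] by blast
      then have "\<tau> = \<theta> (\<chi> i. z i)" "(\<chi> i. z i) \<in> V" by (simp_all add: V vec_eq_iff)
      then show "\<tau> \<in> \<theta> ` V" by blast
    qed
  qed (auto simp: V)
  then show "open (\<theta> ` V)" using open_vector_box[of "\<lambda>i. \<eta> i ` U i"] circle_chart_open[OF U] by simp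
  show "s \<in> V \<Longrightarrow> torus_exp (\<theta> s) = s"
    using U by (auto simp: V torus_exp_def vec_eq_iff circle_atlas_def)
  have "\<forall>i. \<exists>O'. open O' \<and> U i = sphere 0 1 \<inter> O'" using U by (auto simp: circle_atlas_def openin_open)
  then obtain O' where O': "\<And>i. open (O' i) \<and> U i = sphere 0 1 \<inter> O' i" by metis
  then have "V = torus \<inter> {s. \<forall>i. s $ i \<in> O' i}" by (auto simp: V torus_def)
  moreover have "open {s. \<forall>i. s $ i \<in> O' i}" using O' by (intro open_vector_box) simp
  ultimately show "\<exists>O'. open O' \<and> V = torus \<inter> O'" by blast
qed

lemma torus_exp_in_torus [simp]: "torus_exp X \<in> torus"
  by (simp add: torus_exp_def torus_def)

lemma torus_exp_add: "torus_exp (X + Y) = torus_exp X * torus_exp Y"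
  by (simp add: torus_exp_def vec_eq_iff cis_mult)

lemma continuous_on_torus_exp: "continuous_on S torus_exp"
  unfolding torus_exp_def by (intro continuous_intros)

lemma character_torus_exp: "character k (torus_exp X) = cis (\<Sum>i\<in>UNIV. of_int (k $ i) * X $ i)"
proof -
  have "(\<Prod>i\<in>S. cis (f i)) = cis (\<Sum>i\<in>S. f i)" for f and S :: "'a set"
    by (induction S rule: infinite_finite_induct) (simp_all add: cis_mult)
  then show ?thesis by (simp add: character_def torus_exp_def cis_power_int)
qed

lemma character_add: "s \<in> torus \<Longrightarrow> character (k + l) s = character k s * character l s"
  unfolding character_def prod.distrib[symmetric]
proof (intro prod.cong refl)
  fix i assume "s \<in> torus"
  then have "norm (s $ i) = 1" by (simp add: torus_def)
  then have "s $ i \<noteq> 0" by auto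
  then show "s $ i powi (k + l) $ i = s $ i powi k $ i * s $ i powi l $ i" by (simp add: power_int_add)
qed

lemma character_1 [simp]: "character k 1 = 1"
  by (simp add: character_def)

lemma character_0 [simp]: "character 0 s = 1"
  by (simp add: character_def)


section \<open>The product coordinates\<close>

locale deformed_torus_action =
  fixes A_M :: "('m::{t2_space, second_countable_topology}, 'e::real_inner) atlas"
    and A_N :: "('p::t2_space, 'f::real_inner) atlas"
    and \<alpha> :: "complex ^ 'n \<Rightarrow> 'm \<Rightarrow> 'm"
    and \<beta> :: "real ^ 'n \<Rightarrow> 'p \<Rightarrow> 'p"
    and J :: "'m \<Rightarrow> 'p" and \<sigma> :: "'p \<Rightarrow> 'm"
    and \<Omega> :: "'m \<Rightarrow> 'm tvec2"
    and \<I> :: "('m \<Rightarrow> complex) \<Rightarrow> (nat \<Rightarrow> real \<times> 'p \<times> (int ^ 'n) \<Rightarrow> complex) set"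
  assumes M: "smooth_manifold A_M" "points A_M = UNIV"
    and N: "smooth_manifold A_N" "points A_N = UNIV"
    and alpha: "torus_action \<alpha>"
    and beta: "vector_action A_N \<beta>"
    and orbits: "orbit_projection \<alpha> J"
    and J_smooth: "smooth_map A_M A_N J"
    and sigma: "\<forall>y\<in>range J. J (\<sigma> y) = y"
    and \<I>: "fourier_iso \<alpha> \<beta> J \<sigma> \<I>"
    and poisson: "poisson_bivector A_M \<Omega>"
    and deformation: "deformation_groupoid (Ggrp \<alpha> \<beta> J) fst A_M \<Omega> (Cc_smooth A_N (Ggrp \<alpha> \<beta> J)) \<I>"
    and Delta_inf_open: "open (Delta_inf \<alpha> J)"
    and rho_diffeo: "diffeo (prod_atlas (restrict_atlas A_N (Delta_inf \<alpha> J)) torus_atlas)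
      (restrict_atlas A_M (J -` Delta_inf \<alpha> J)) (rho \<alpha> \<sigma>)"
begin

abbreviation "D \<equiv> Delta_inf \<alpha> J"
abbreviation "A_D \<equiv> restrict_atlas A_N D"
abbreviation "A_P \<equiv> prod_atlas A_D (torus_atlas :: (complex ^ 'n, real ^ 'n) atlas)"
abbreviation "A_R \<equiv> restrict_atlas A_M (J -` D)"
abbreviation "\<rho> \<equiv> rho \<alpha> \<sigma>"

lemma act_mult: "s \<in> torus \<Longrightarrow> t \<in> torus \<Longrightarrow> \<alpha> (s * t) x = \<alpha> s (\<alpha> t x)" and act_one: "\<alpha> 1 x = x"
  using alpha by (auto simp: torus_action_def)

lemma J_eq_iff: "J x = J x' \<longleftrightarrow> (\<exists>s\<in>torus. x' = \<alpha> s x)"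
  using orbits unfolding orbit_projection_def by blast

lemma D_range: "y \<in> D \<Longrightarrow> y \<in> range J"
  by (simp add: Delta_inf_def)

lemma J_rho: "y \<in> D \<Longrightarrow> s \<in> torus \<Longrightarrow> J (\<rho> (y, s)) = y"
  using sigma D_range[of y] J_eq_iff[of "\<sigma> y" "\<alpha> s (\<sigma> y)"] by (auto simp: rho_def)

lemma points_A_D: "points A_D = D"
  by (simp add: points_restrict_atlas N(2))

lemma points_A_R: "points A_R = J -` D"
  by (simp add: points_restrict_atlas M(2))

lemma points_A_P: "points A_P \<subseteq> D \<times> torus"
proof
  fix p assume "p \<in> points A_P"
  then obtain W \<kappa> where "(W, \<kappa>) \<in> A_P" "p \<in> W" by (rule pointsE)
  then obtain U \<phi> V \<theta> where *: "(U, \<phi>) \<in> A_D" "(V, \<theta>) \<in> torus_atlas" "p \<in> U \<times> V"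
    by (auto elim: prod_atlasE)
  then have "U \<subseteq> D" by (auto elim: restrict_atlasE)
  moreover have "V \<subseteq> torus" using torus_chart(3)[OF *(2)] by blast
  ultimately show "p \<in> D \<times> torus" using *(3) by blast
qed

lemma J_continuous: "continuous_on UNIV J"
  using J_smooth by (simp add: smooth_map_def M(2))

lemma open_J_D: "open (J -` D)"
  using Delta_inf_open J_continuous by (rule open_vimage)

lemma rho_continuous: "continuous_on (points A_P) \<rho>"
  using rho_diffeo by (simp add: diffeo_def smooth_map_def)

lemma rho_bij: "bij_betw \<rho> (points A_P) (J -` D)"
  using rho_diffeo by (simp add: diffeo_def points_A_R)

lemma frame_M: obtains B :: "'e set" where "orthonormal_frame B"
proof -
  obtain B0 :: "'e set" where "finite B0" "span B0 = UNIV" using M(1) by (auto simp: smooth_manifold_def)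
  then show thesis using orthonormal_frame_exists that by blast
qed

lemma frame_N: obtains B :: "'f set" where "orthonormal_frame B"
proof -
  obtain B0 :: "'f set" where "finite B0" "span B0 = UNIV" using N(1) by (auto simp: smooth_manifold_def)
  then show thesis using orthonormal_frame_exists that by blast
qed

end

text \<open>Coordinates on the free part of M: a chart of N and a local logarithm on the torus, carried over by
  \<open>\<rho>\<close>.\<close>

locale product_chart = deformed_torus_action A_M A_N \<alpha> \<beta> J \<sigma> \<Omega> \<I>
  for A_M :: "('m::{t2_space, second_countable_topology}, 'e::real_inner) atlas"
    and A_N :: "('p::t2_space, 'f::real_inner) atlas"
    and \<alpha> :: "complex ^ 'n \<Rightarrow> 'm \<Rightarrow> 'm" and \<beta> :: "real ^ 'n \<Rightarrow> 'p \<Rightarrow> 'p" and J \<sigma> \<Omega> \<I> +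
  fixes U :: "'p set" and \<psi> :: "'p \<Rightarrow> 'f" and V :: "(complex ^ 'n) set" and \<theta> :: "complex ^ 'n \<Rightarrow> real ^ 'n"
  assumes U_chart: "(U, \<psi>) \<in> A_N" and V_chart: "(V, \<theta>) \<in> torus_atlas"
begin

abbreviation "W \<equiv> (U \<inter> D) \<times> V"
abbreviation \<kappa> :: "'p \<times> (complex ^ 'n) \<Rightarrow> 'f \<times> (real ^ 'n)" where "\<kappa> \<equiv> \<lambda>(y, s). (\<psi> y, \<theta> s)"

text \<open>The inverse of the product chart. In this form the torus factor is defined for all \<open>\<tau>\<close>.\<close>

definition from_coords :: "'f \<times> (real ^ 'n) \<Rightarrow> 'p \<times> (complex ^ 'n)" where
  "from_coords = (\<lambda>(z, \<tau>). (inv_into U \<psi> z, torus_exp \<tau>))"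

lemma chart_in_A_P: "(W, \<kappa>) \<in> A_P"
  using restrict_atlasI[OF U_chart] V_chart unfolding prod_atlas_def by blast

lemma W_points: "W \<subseteq> points A_P"
  using pointsI[OF chart_in_A_P] by blast

lemmas U_hom = smooth_manifold_chart[OF N U_chart]

lemma V_torus: "V \<subseteq> torus"
  using torus_chart(3)[OF V_chart] by blast

lemma inv_psi: "y \<in> U \<Longrightarrow> inv_into U \<psi> (\<psi> y) = y"
  using homeomorphism_apply1[OF U_hom(1)] .

lemma from_coords_kappa: "w \<in> W \<Longrightarrow> from_coords (\<kappa> w) = w"
  using torus_chart(2)[OF V_chart] by (auto simp: from_coords_def inv_psi)

lemma inv_kappa: "p \<in> \<kappa> ` W \<Longrightarrow> inv_into W \<kappa> p = from_coords p"
proof -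
  have "inj_on \<kappa> W" by (rule inj_on_inverseI[of _ from_coords]) (rule from_coords_kappa)
  then show "p \<in> \<kappa> ` W \<Longrightarrow> inv_into W \<kappa> p = from_coords p"
    using from_coords_kappa by (metis (no_types, lifting) f_inv_into_f inv_into_into)
qed

lemma from_coords_mem: "p \<in> \<kappa> ` W \<Longrightarrow> from_coords p \<in> W"
  using from_coords_kappa by (metis (no_types, lifting) imageE)

lemma open_psi_D: "open (\<psi> ` (U \<inter> D))"
proof -
  have "\<psi> ` (U \<inter> D) = {z \<in> \<psi> ` U. inv_into U \<psi> z \<in> D}" using inv_psi by auto
  also have "open \<dots>"
    using continuous_open_preimage[OF homeomorphism_cont2[OF U_hom(1)] U_hom(3) Delta_inf_open]
    by (simp add: vimage_def Int_def)
  finally show ?thesis .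
qed

lemma kappa_image: "\<kappa> ` W = \<psi> ` (U \<inter> D) \<times> \<theta> ` V"
  by force

lemma open_kappa_W: "open (\<kappa> ` W)"
  unfolding kappa_image by (intro open_Times open_psi_D torus_chart(1)[OF V_chart])

lemma continuous_from_coords: "continuous_on (\<kappa> ` W) from_coords"
proof -
  have "continuous_on (\<kappa> ` W) (\<lambda>p. inv_into U \<psi> (fst p))"
    by (rule continuous_on_compose2[OF homeomorphism_cont2[OF U_hom(1)]])
       (auto intro!: continuous_intros)
  moreover have "continuous_on (\<kappa> ` W) (\<lambda>p. torus_exp (snd p))"
    by (rule continuous_on_compose2[OF continuous_on_torus_exp]) (auto intro!: continuous_intros)
  ultimately show ?thesis unfolding from_coords_def case_prod_beta by (rule continuous_on_Pair)
qed

lemma continuous_rho_coords: "continuous_on (\<kappa> ` W) (\<lambda>p. \<rho> (from_coords p))"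
  by (rule continuous_on_compose2[OF rho_continuous continuous_from_coords])
     (use W_points from_coords_mem in blast)

text \<open>Locally u is a smooth function of the coordinates of a chart of M, and these are smooth functions of
  the product coordinates because \<open>\<rho>\<close> is smooth.\<close>

lemma smooth_in_coords:
  assumes u: "smooth_fun A_M u"
  shows "smooth_on (\<kappa> ` W) (\<lambda>p. u (\<rho> (from_coords p)))"
proof (rule smooth_on_local)
  fix p assume p: "p \<in> \<kappa> ` W"
  obtain V' \<phi> where ch: "(V', \<phi>) \<in> A_M" "\<rho> (from_coords p) \<in> V'"
    using M(2) pointsE[of _ A_M] by (metis UNIV_I)
  obtain B :: "'e set" where B: "orthonormal_frame B" by (rule frame_M)
  note hom = smooth_manifold_chart[OF M ch(1)]
  let ?T = "{p \<in> \<kappa> ` W. \<rho> (from_coords p) \<in> V'}"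
  have oT: "open ?T"
    using continuous_open_preimage[OF continuous_rho_coords open_kappa_W hom(2)]
    by (simp add: vimage_def Int_def)
  have "smooth_map A_P A_R \<rho>" using rho_diffeo by (simp add: diffeo_def)
  from smooth_mapD[OF this chart_in_A_P restrict_atlasI[OF ch(1)]]
  have "smooth_on (\<kappa> ` (W \<inter> \<rho> -` (V' \<inter> J -` D))) (\<phi> \<circ> \<rho> \<circ> inv_into W \<kappa>)" .
  then have s1: "smooth_on ?T (\<phi> \<circ> \<rho> \<circ> inv_into W \<kappa>)"
  proof (rule smooth_on_subset)
    show "?T \<subseteq> \<kappa> ` (W \<inter> \<rho> -` (V' \<inter> J -` D))"
    proof
      fix q assume "q \<in> ?T"
      then obtain w where w: "w \<in> W" "q = \<kappa> w" "\<rho> w \<in> V'" using from_coords_kappa by force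
      moreover have "J (\<rho> w) \<in> D" using w(1) V_torus J_rho by auto
      ultimately show "q \<in> \<kappa> ` (W \<inter> \<rho> -` (V' \<inter> J -` D))" by auto
    qed
  qed
  have s2: "smooth_on (\<phi> ` V') (u \<circ> inv_into V' \<phi>)" using u ch(1) by (auto simp: smooth_fun_iff)
  have s3: "(\<phi> \<circ> \<rho> \<circ> inv_into W \<kappa>) ` ?T \<subseteq> \<phi> ` V'" using inv_kappa by auto
  from smooth_on_compose[OF B oT s2 s1 s3]
  have "smooth_on ?T (\<lambda>p. u (\<rho> (from_coords p)))"
    by (rule smooth_on_cong[OF oT, rotated]) (simp add: inv_kappa homeomorphism_apply1[OF hom(1)])
  then show "\<exists>T. open T \<and> p \<in> T \<and> smooth_on T (\<lambda>p. u (\<rho> (from_coords p)))"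
    using oT p ch(2) by blast
qed

end

context deformed_torus_action
begin

lemma A_P_chartE:
  assumes "(W', \<kappa>') \<in> A_P"
  obtains U \<psi> V \<theta> where "product_chart A_M A_N \<alpha> \<beta> J \<sigma> \<Omega> \<I> U \<psi> V \<theta>"
    "W' = (U \<inter> D) \<times> V" "\<kappa>' = (\<lambda>(y, s). (\<psi> y, \<theta> s))"
proof -
  obtain U \<psi> V \<theta> where *: "(U, \<psi>) \<in> A_N" "(V, \<theta>) \<in> torus_atlas"
    "W' = (U \<inter> D) \<times> V" "\<kappa>' = (\<lambda>(y, s). (\<psi> y, \<theta> s))"
    using assms by (elim prod_atlasE restrict_atlasE) blast
  then have "product_chart A_M A_N \<alpha> \<beta> J \<sigma> \<Omega> \<I> U \<psi> V \<theta>" by unfold_locales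
  then show thesis using * that by blast
qed

lemma smooth_fun_rho:
  assumes "smooth_fun A_M u" shows "smooth_fun A_P (u \<circ> \<rho>)"
  unfolding smooth_fun_iff
proof (intro conjI ballI)
  have "continuous_on UNIV u" using assms M(2) by (simp add: smooth_fun_iff)
  then show "continuous_on (points A_P) (u \<circ> \<rho>)"
    unfolding comp_def using rho_continuous by (rule continuous_on_compose2) simp
  fix c assume c: "c \<in> A_P"
  obtain W' \<kappa>' where c': "c = (W', \<kappa>')" by (cases c)
  obtain U \<psi> V \<theta> where "product_chart A_M A_N \<alpha> \<beta> J \<sigma> \<Omega> \<I> U \<psi> V \<theta>"
    and eq: "W' = (U \<inter> D) \<times> V" "\<kappa>' = (\<lambda>(y, s). (\<psi> y, \<theta> s))"
    using A_P_chartE c c' by metis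
  then interpret product_chart A_M A_N \<alpha> \<beta> J \<sigma> \<Omega> \<I> U \<psi> V \<theta> by simp
  have "smooth_on (\<kappa> ` W) (u \<circ> \<rho> \<circ> inv_into W \<kappa>)"
    by (rule smooth_on_cong[OF open_kappa_W _ smooth_in_coords[OF assms]]) (simp add: inv_kappa)
  then show "case c of (U, \<phi>) \<Rightarrow> smooth_on (\<phi> ` U) (u \<circ> \<rho> \<circ> inv_into U \<phi>)"
    by (simp add: c' eq)
qed

end


section \<open>Tangent vectors in product coordinates\<close>

locale product_chart_at = product_chart A_M A_N \<alpha> \<beta> J \<sigma> \<Omega> \<I> U \<psi> V \<theta>
  for A_M :: "('m::{t2_space, second_countable_topology}, 'e::real_inner) atlas"
    and A_N :: "('p::t2_space, 'f::real_inner) atlas"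
    and \<alpha> :: "complex ^ 'n \<Rightarrow> 'm \<Rightarrow> 'm" and \<beta> :: "real ^ 'n \<Rightarrow> 'p \<Rightarrow> 'p" and J \<sigma> \<Omega> \<I> U \<psi> V \<theta> +
  fixes y0 :: 'p and s0 :: "complex ^ 'n"
  assumes y0: "y0 \<in> U" "y0 \<in> D" and s0: "s0 \<in> V"
begin

definition "x0 = \<rho> (y0, s0)"
definition "z0 = (\<psi> y0, \<theta> s0)"

abbreviation "coords u \<equiv> \<lambda>p. u (\<rho> (from_coords p))"

definition "dcoord u = frechet_derivative (coords u) (at z0)"

lemma z0_mem: "z0 \<in> \<kappa> ` W"
  using y0 s0 by (force simp: z0_def)

lemma s0_torus: "s0 \<in> torus" using s0 V_torus by blast

lemma dcoord_derivative:
  assumes "smooth_fun A_M u" shows "(coords u has_derivative dcoord u) (at z0)"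
  unfolding dcoord_def using smooth_on_differentiable[OF smooth_in_coords[OF assms] z0_mem]
  by (simp only: frechet_derivative_works)

lemma vector_derivative_coords:
  assumes u: "smooth_fun A_M u" and c: "(c has_vector_derivative w) (at (0::real))" "c 0 = z0"
    and eq: "\<forall>\<^sub>F t in nhds 0. f t = coords u (c t)"
  shows "vector_derivative f (at 0) = dcoord u w"
proof -
  have "(coords u has_derivative dcoord u) (at (c 0))" using dcoord_derivative[OF u] c(2) by simp
  from has_derivative_compose[OF c(1)[unfolded has_vector_derivative_def] this]
  have "((\<lambda>t. coords u (c t)) has_derivative (\<lambda>t. dcoord u (t *\<^sub>R w))) (at 0)" .
  moreover have "linear (dcoord u)" using dcoord_derivative[OF u] by (rule has_derivative_linear)
  ultimately have "((\<lambda>t. coords u (c t)) has_vector_derivative dcoord u w) (at 0)"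
    by (simp add: has_vector_derivative_def linear_cmul)
  moreover obtain S where S: "open S" "0 \<in> S" "\<And>t. t \<in> S \<Longrightarrow> coords u (c t) = f t"
    using eq unfolding eventually_nhds by metis
  ultimately have "(f has_vector_derivative dcoord u w) (at 0)"
    using has_vector_derivative_transform_within_open[of "\<lambda>t. coords u (c t)" "dcoord u w" 0 S f] by blast
  then show ?thesis by (rule vector_derivative_at)
qed

text \<open>By the chain rule for \<open>u \<circ> \<phi>\<^sup>-\<^sup>1 = (u \<circ> \<rho> \<circ> \<kappa>\<^sup>-\<^sup>1) \<circ> (\<kappa> \<circ> \<rho>\<^sup>-\<^sup>1 \<circ> \<phi>\<^sup>-\<^sup>1)\<close>, where \<open>\<rho>\<^sup>-\<^sup>1\<close> is smooth, a
  derivative in any chart \<open>\<phi>\<close> of M is a derivative in the product coordinates \<open>\<kappa>\<close>. The new direction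
  depends on the old one alone, not on u.\<close>

lemma tangent_dcoord:
  assumes "v \<in> tangent_space A_M x0"
  obtains w where "v = (\<lambda>u. if smooth_fun A_M u then dcoord u w else 0)"
proof -
  obtain U' \<phi> w where ch: "(U', \<phi>) \<in> A_M" "x0 \<in> U'"
    and v: "v = (\<lambda>u. if smooth_fun A_M u then frechet_derivative (u \<circ> inv_into U' \<phi>) (at (\<phi> x0)) w else 0)"
    using assms unfolding tangent_space_def by blast
  let ?\<iota> = "inv_into (points A_P) \<rho>" and ?S = "J -` D"
  note hom = smooth_manifold_chart[OF M ch(1)]
  note inv_phi = homeomorphism_apply1[OF hom(1)]
  have inj: "inj_on \<rho> (points A_P)" using rho_bij by (simp add: bij_betw_def)
  have pt: "(y0, s0) \<in> points A_P" using W_points y0 s0 by blast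
  have \<iota>_x0: "?\<iota> x0 = (y0, s0)" unfolding x0_def by (rule inv_into_f_f[OF inj pt])
  have \<rho>_\<iota>: "\<rho> (?\<iota> x) = x" and \<iota>_pt: "?\<iota> x \<in> points A_P" if "x \<in> ?S" for x
    using that rho_bij unfolding bij_betw_def by (auto intro: f_inv_into_f inv_into_into)
  have x0S: "x0 \<in> ?S" using J_rho[OF y0(2) s0_torus] y0(2) by (simp add: x0_def)
  have inv_sm: "smooth_map A_R A_P ?\<iota>" using rho_diffeo by (simp add: diffeo_def)
  have \<iota>_cont: "continuous_on ?S ?\<iota>" using inv_sm by (simp add: smooth_map_def points_A_R)
  have inv_eq: "inv_into (U' \<inter> ?S) \<phi> (\<phi> x) = x" if "x \<in> U' \<inter> ?S" for x
    by (rule inv_into_f_f[OF inj_on_inverseI[of _ "inv_into U' \<phi>"] that]) (simp add: inv_phi)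
  have sm: "smooth_on (\<phi> ` ((U' \<inter> ?S) \<inter> ?\<iota> -` W)) (\<kappa> \<circ> ?\<iota> \<circ> inv_into (U' \<inter> ?S) \<phi>)"
    by (rule smooth_mapD[OF inv_sm restrict_atlasI[OF ch(1)] chart_in_A_P])
  let ?\<Phi> = "\<kappa> \<circ> ?\<iota> \<circ> inv_into (U' \<inter> ?S) \<phi>"
  have "\<phi> x0 \<in> \<phi> ` ((U' \<inter> ?S) \<inter> ?\<iota> -` W)" using ch(2) x0S y0 s0 \<iota>_x0 by auto
  from smooth_on_differentiable[OF sm this] obtain E where E: "(?\<Phi> has_derivative E) (at (\<phi> x0))"
    unfolding differentiable_def by blast
  have \<Phi>_x0: "?\<Phi> (\<phi> x0) = z0" using inv_eq[of x0] ch(2) x0S \<iota>_x0 by (simp add: z0_def)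
  (* V is open in the torus only; membership in T is an open condition when stated with O'. *)
  obtain O' where O': "open O'" "V = torus \<inter> O'" using torus_chart(3)[OF V_chart] by blast
  define T1 where "T1 = {p \<in> \<phi> ` U'. inv_into U' \<phi> p \<in> ?S}"
  have T1: "open T1"
    using continuous_open_preimage[OF homeomorphism_cont2[OF hom(1)] hom(3) open_J_D]
    by (simp add: T1_def vimage_def Int_def)
  define T where "T = {p \<in> T1. ?\<iota> (inv_into U' \<phi> p) \<in> U \<times> O'}"
  have "continuous_on T1 (\<lambda>p. ?\<iota> (inv_into U' \<phi> p))"
    by (rule continuous_on_compose2[OF \<iota>_cont continuous_on_subset[OF homeomorphism_cont2[OF hom(1)]]])
       (auto simp: T1_def)
  from continuous_open_preimage[OF this T1 open_Times[OF U_hom(2) O'(1)]]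
  have T: "open T" by (simp add: T_def vimage_def Int_def)
  have x0T: "\<phi> x0 \<in> T"
    using ch(2) x0S y0 s0 O'(2) by (auto simp: T_def T1_def inv_phi \<iota>_x0)
  have key: "coords u (?\<Phi> p) = (u \<circ> inv_into U' \<phi>) p" if pT: "p \<in> T" for u :: "'m \<Rightarrow> complex" and p
  proof -
    obtain x where x: "x \<in> U'" "p = \<phi> x" using pT by (auto simp: T_def T1_def)
    then have xS: "x \<in> ?S" and W': "?\<iota> x \<in> U \<times> O'" using pT by (auto simp: T_def T1_def inv_phi)
    have "?\<iota> x \<in> D \<times> torus" using \<iota>_pt[OF xS] points_A_P by blast
    then have "?\<iota> x \<in> W" using W' O'(2) by auto
    moreover have "?\<Phi> p = \<kappa> (?\<iota> x)" using inv_eq[of x] x xS by simp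
    ultimately have "from_coords (?\<Phi> p) = ?\<iota> x" by (simp only: from_coords_kappa)
    then show ?thesis using x \<rho>_\<iota>[OF xS] by (simp add: inv_phi)
  qed
  have "v u = (if smooth_fun A_M u then dcoord u (E w) else 0)" for u
  proof (cases "smooth_fun A_M u")
    case True
    have "(coords u has_derivative dcoord u) (at (?\<Phi> (\<phi> x0)))"
      using dcoord_derivative[OF True] unfolding \<Phi>_x0 .
    from has_derivative_compose[OF E this]
    have "((\<lambda>p. coords u (?\<Phi> p)) has_derivative (\<lambda>w. dcoord u (E w))) (at (\<phi> x0))" .
    then have "((u \<circ> inv_into U' \<phi>) has_derivative (\<lambda>w. dcoord u (E w))) (at (\<phi> x0))"
      by (rule has_derivative_transform_within_open[OF _ T x0T]) (rule key)
    from frechet_derivative_at[OF this]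
    have "dcoord u (E w) = frechet_derivative (u \<circ> inv_into U' \<phi>) (at (\<phi> x0)) w" by (rule fun_cong)
    then show ?thesis using True by (simp only: v if_True)
  qed (simp add: v)
  then have "v = (\<lambda>u. if smooth_fun A_M u then dcoord u (E w) else 0)" by (rule ext)
  then show thesis by (rule that)
qed

text \<open>In the product coordinates \<open>exp (t X)\<close> acts as the translation of the torus coordinates by
  \<open>t X\<close>.\<close>

lemma xi_alpha_dcoord:
  "xi_alpha A_M \<alpha> X x0 u = (if smooth_fun A_M u then dcoord u (0, X) else 0)"
proof (cases "smooth_fun A_M u")
  case True
  let ?c = "\<lambda>t::real. (\<psi> y0, \<theta> s0 + t *\<^sub>R X)"
  have "(?c has_vector_derivative (0, 0 + 1 *\<^sub>R X)) (at 0)"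
    by (intro has_vector_derivative_Pair has_vector_derivative_add_const[THEN iffD2])
       (auto intro!: derivative_eq_intros simp: has_vector_derivative_def)
  then have c: "(?c has_vector_derivative (0, X)) (at 0)" by simp
  have "u (\<alpha> (torus_exp (t *\<^sub>R X)) x0) = coords u (?c t)" for t
  proof -
    have "\<alpha> (torus_exp (t *\<^sub>R X)) x0 = \<alpha> (torus_exp (t *\<^sub>R X) * s0) (\<sigma> y0)"
      by (simp add: x0_def rho_def act_mult s0_torus)
    also have "torus_exp (t *\<^sub>R X) * s0 = torus_exp (\<theta> s0 + t *\<^sub>R X)"
      by (simp add: torus_exp_add torus_chart(2)[OF V_chart s0] mult.commute)
    finally show ?thesis by (simp add: from_coords_def inv_psi y0 rho_def)
  qed
  then show ?thesis
    using vector_derivative_coords[OF True c] True by (simp add: z0_def xi_alpha_def velocity_def)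
qed (simp add: xi_alpha_def velocity_def)

lemma orbit_near:
  "\<forall>\<^sub>F t in nhds 0. \<beta> (t *\<^sub>R X) y0 \<in> U \<inter> D"
proof -
  have "continuous_on UNIV (\<lambda>(X, y). \<beta> X y)" and b0: "\<beta> 0 y0 = y0"
    using beta by (simp_all add: vector_action_def)
  from continuous_on_compose2[OF this(1), of UNIV "\<lambda>t. (t *\<^sub>R X, y0)"]
  have "continuous_on UNIV (\<lambda>t. \<beta> (t *\<^sub>R X) y0)" by (simp add: continuous_intros)
  from open_vimage[OF open_Int[OF U_hom(2) Delta_inf_open] this]
  have "open ((\<lambda>t. \<beta> (t *\<^sub>R X) y0) -` (U \<inter> D))" .
  moreover have "0 \<in> (\<lambda>t. \<beta> (t *\<^sub>R X) y0) -` (U \<inter> D)" using y0 b0 by simp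
  ultimately show ?thesis unfolding eventually_nhds by blast
qed

text \<open>The vector \<open>\<xi>\<^sup>\<beta>\<^sub>X\<close> at \<open>y\<^sub>0\<close> in the chart.\<close>

definition "drift X = vector_derivative (\<lambda>t. \<psi> (\<beta> (t *\<^sub>R X) y0)) (at 0)"

lemma drift: "((\<lambda>t. \<psi> (\<beta> (t *\<^sub>R X) y0)) has_vector_derivative drift X) (at 0)"
proof -
  have "(\<lambda>t. \<psi> (\<beta> (t *\<^sub>R X) y0)) differentiable at (0::real)"
    using beta U_chart y0(1) unfolding vector_action_def by blast
  then show ?thesis unfolding drift_def by (simp add: vector_derivative_works)
qed

text \<open>The push-forward of \<open>\<xi>\<^sup>\<beta>\<close> is set to 0 on functions whose restriction to the slice \<open>s = s\<^sub>0\<close> is not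
  smooth, so restrictions of smooth functions have to be recognised as smooth.\<close>

lemma smooth_fun_slice:
  assumes u: "smooth_fun A_M u" shows "smooth_fun A_D (\<lambda>y. u (\<rho> (y, s0)))"
  unfolding smooth_fun_iff
proof (intro conjI ballI)
  have pts: "(\<lambda>y. (y, s0)) ` points A_D \<subseteq> points A_P"
  proof
    fix p assume "p \<in> (\<lambda>y. (y, s0)) ` points A_D"
    then obtain y where y: "y \<in> D" "p = (y, s0)" by (auto simp: points_A_D)
    obtain U' \<phi> where ch: "(U', \<phi>) \<in> A_N" "y \<in> U'" using N(2) pointsE[of y A_N] by blast
    interpret C: product_chart A_M A_N \<alpha> \<beta> J \<sigma> \<Omega> \<I> U' \<phi> V \<theta>
      by unfold_locales (rule ch V_chart)+
    show "p \<in> points A_P" using C.W_points ch(2) y s0 by blast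
  qed
  have "continuous_on UNIV u" using u M(2) by (simp add: smooth_fun_iff)
  moreover have "continuous_on (points A_D) (\<lambda>y. \<rho> (y, s0))"
    by (rule continuous_on_compose2[OF rho_continuous _ pts]) (intro continuous_intros)
  ultimately show "continuous_on (points A_D) (\<lambda>y. u (\<rho> (y, s0)))"
    by (rule continuous_on_compose2) simp
  fix c assume c: "c \<in> A_D"
  obtain U' \<phi> where ch: "(U', \<phi>) \<in> A_N" "c = (U' \<inter> D, \<phi>)"
    using c by (cases c) (auto elim: restrict_atlasE)
  interpret C: product_chart A_M A_N \<alpha> \<beta> J \<sigma> \<Omega> \<I> U' \<phi> V \<theta>
    by unfold_locales (rule ch V_chart)+
  obtain B :: "'f set" where "orthonormal_frame B" by (rule frame_N)
  note B = orthonormal_frame_Times[OF this orthonormal_frame_Basis[where 'a="real ^ 'n"]]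
  have "smooth_on (\<phi> ` (U' \<inter> D)) (\<lambda>z. (z, 0) + (0, \<theta> s0))"
    by (intro smooth_on_add C.open_psi_D smooth_on_const smooth_on_linear)
       (auto intro!: bounded_linear_Pair bounded_linear_ident bounded_linear_zero)
  then have "smooth_on (\<phi> ` (U' \<inter> D)) (\<lambda>z. (z, \<theta> s0))" by simp
  moreover have "(\<lambda>z. (z, \<theta> s0)) ` (\<phi> ` (U' \<inter> D)) \<subseteq> C.\<kappa> ` C.W" using s0 by auto
  ultimately have "smooth_on (\<phi> ` (U' \<inter> D)) (\<lambda>z. u (\<rho> (C.from_coords (z, \<theta> s0))))"
    by (rule smooth_on_compose[OF B C.open_psi_D C.smooth_in_coords[OF u]])
  then have "smooth_on (\<phi> ` (U' \<inter> D)) ((\<lambda>y. u (\<rho> (y, s0))) \<circ> inv_into (U' \<inter> D) \<phi>)"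
  proof (rule smooth_on_cong[OF C.open_psi_D, rotated])
    fix z assume "z \<in> \<phi> ` (U' \<inter> D)"
    then obtain y where y: "y \<in> U' \<inter> D" "z = \<phi> y" by blast
    have "inv_into (U' \<inter> D) \<phi> z = y"
      unfolding y(2) by (rule inv_into_f_f[OF inj_on_inverseI[of _ "inv_into U' \<phi>"] y(1)]) (simp add: C.inv_psi)
    moreover have "C.from_coords (z, \<theta> s0) = (y, s0)"
      using C.from_coords_kappa[of "(y, s0)"] y s0 by simp
    ultimately show "u (\<rho> (C.from_coords (z, \<theta> s0))) = ((\<lambda>y. u (\<rho> (y, s0))) \<circ> inv_into (U' \<inter> D) \<phi>) z" by simp
  qed
  then show "case c of (U, \<phi>) \<Rightarrow> smooth_on (\<phi> ` U) ((\<lambda>y. u (\<rho> (y, s0))) \<circ> inv_into U \<phi>)"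
    by (simp add: ch(2))
qed

lemma rho_star_dcoord:
  "rho_star_xi_beta A_M A_N \<alpha> \<beta> J \<sigma> X x0 u = (if smooth_fun A_M u then dcoord u (drift X, 0) else 0)"
proof (cases "smooth_fun A_M u")
  case True
  let ?c = "\<lambda>t::real. (\<psi> (\<beta> (t *\<^sub>R X) y0), \<theta> s0)"
  have c: "(?c has_vector_derivative (drift X, 0)) (at 0)"
    by (intro has_vector_derivative_Pair drift has_vector_derivative_const)
  have c0: "?c 0 = z0" using beta by (simp add: vector_action_def z0_def)
  have "\<forall>\<^sub>F t in nhds 0. u (\<rho> (\<beta> (t *\<^sub>R X) y0, s0)) = coords u (?c t)"
    using orbit_near[of X]
  proof (rule eventually_mono)
    fix t assume "\<beta> (t *\<^sub>R X) y0 \<in> U \<inter> D"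
    then show "u (\<rho> (\<beta> (t *\<^sub>R X) y0, s0)) = coords u (?c t)"
      using from_coords_kappa[of "(\<beta> (t *\<^sub>R X) y0, s0)"] s0 by simp
  qed
  from vector_derivative_coords[OF True c c0 this]
  have "vector_derivative (\<lambda>t. u (\<rho> (\<beta> (t *\<^sub>R X) y0, s0))) (at 0) = dcoord u (drift X, 0)" .
  moreover have "inv_into (points A_P) \<rho> x0 = (y0, s0)"
    unfolding x0_def using rho_bij W_points y0 s0 by (intro inv_into_f_f) (auto simp: bij_betw_def)
  ultimately show ?thesis
    using True smooth_fun_rho[OF True] smooth_fun_slice[OF True]
    by (simp add: rho_star_xi_beta_def pushforward_def first_factor_vec_def xi_beta_def velocity_def Let_def)
qed (simp add: rho_star_xi_beta_def pushforward_def Let_def)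

end


section \<open>The commutator and the Poisson bracket\<close>

definition int_vec :: "int ^ 'n \<Rightarrow> real ^ 'n" where
  "int_vec k = (\<chi> i. of_int (k $ i))"

lemma hk_scaleR: "hk h k = h *\<^sub>R int_vec k"
  by (simp add: hk_def int_vec_def vec_eq_iff)

lemma int_vec_simps: "int_vec 0 = 0" "int_vec (axis i 1) = axis i 1"
  by (simp_all add: int_vec_def vec_eq_iff axis_def)

lemma infsum_single:
  assumes "k \<in> S" "\<And>m. m \<in> S \<Longrightarrow> m \<noteq> k \<Longrightarrow> f m = 0"
  shows "infsum f S = (f k :: complex)"
proof -
  have "infsum f S = infsum f {k}" by (rule infsum_cong_neutral) (use assms in auto)
  then show ?thesis by simp
qed

context deformed_torus_action
begin

definition Gar :: "(real \<times> 'p \<times> (int ^ 'n)) set" where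
  "Gar = arrows (Ggrp \<alpha> \<beta> J)"

lemma beta_0: "\<beta> 0 y = y" and beta_add: "\<beta> (X + Y) y = \<beta> X (\<beta> Y y)"
  and beta_continuous: "continuous_on UNIV (\<lambda>(X, y). \<beta> X y)"
  using beta by (simp_all add: vector_action_def)

lemma Gar_iff: "(h, y, k) \<in> Gar \<longleftrightarrow> y \<in> Delta_k \<alpha> J k \<and> \<beta> (hk h k) y \<in> Delta_k \<alpha> J k \<and>
    isotropy \<alpha> J y = isotropy \<alpha> J (\<beta> (hk h k) y)"
  by (simp add: Gar_def Ggrp_def)

lemma Delta_k_range: "y \<in> Delta_k \<alpha> J k \<Longrightarrow> y \<in> range J"
  by (simp add: Delta_k_def)

lemma Delta_k_isotropy:
  "y \<in> Delta_k \<alpha> J k \<Longrightarrow> isotropy \<alpha> J y = isotropy \<alpha> J y' \<Longrightarrow> y' \<in> range J \<Longrightarrow> y' \<in> Delta_k \<alpha> J k"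
  by (simp add: Delta_k_def)

lemma isotropy_torus: "s \<in> isotropy \<alpha> J y \<Longrightarrow> s \<in> torus"
  by (simp add: isotropy_def)

lemma Delta_k_add: "y \<in> Delta_k \<alpha> J k \<Longrightarrow> y \<in> Delta_k \<alpha> J l \<Longrightarrow> y \<in> Delta_k \<alpha> J (k + l)"
  using isotropy_torus by (simp add: Delta_k_def character_add)

lemma Delta_k_minus:
  assumes "y \<in> Delta_k \<alpha> J k" shows "y \<in> Delta_k \<alpha> J (- k)"
proof -
  have "character (- k) s = 1" if "s \<in> isotropy \<alpha> J y" for s
    using character_add[OF isotropy_torus[OF that], of "- k" k] assms that by (simp add: Delta_k_def)
  then show ?thesis using assms by (simp add: Delta_k_def)
qed

lemma D_Delta_k: "y \<in> D \<Longrightarrow> y \<in> Delta_k \<alpha> J k"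
  by (simp add: Delta_inf_def Delta_k_def)

lemma D_Gar: "y \<in> D \<Longrightarrow> \<beta> (hk h k) y \<in> D \<Longrightarrow> (h, y, k) \<in> Gar"
  unfolding Gar_iff by (simp add: D_Delta_k) (simp add: Delta_inf_def)

text \<open>The isotropy groups at the two ends of an arrow agree, and \<open>\<Delta>(k)\<close> is defined by the isotropy
  group. Hence all points of a chain of arrows lie in the \<open>\<Delta>(k)\<close> of each of them.\<close>

lemma subgroupoid_Gar:
  assumes "y \<in> D" shows "subgroupoid \<beta> Gar"
proof
  show "\<beta> 0 y = y" "\<beta> (X + Y) y = \<beta> X (\<beta> Y y)" for y X Y by (rule beta_0 beta_add)+
  show "Gar \<noteq> {}" using D_Gar[OF assms, of 0 0] assms by (auto simp: beta_0)
next
  fix h y m l assume a: "(h, \<beta> (hk h m) y, l) \<in> Gar" "(h, y, m) \<in> Gar"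
  let ?y = "\<beta> (hk h m) y" and ?z = "\<beta> (hk h l) (\<beta> (hk h m) y)"
  have z: "\<beta> (hk h (l + m)) y = ?z" by (simp add: hk_add beta_add)
  note a' = a[unfolded Gar_iff]
  have 1: "y \<in> Delta_k \<alpha> J l" by (rule Delta_k_isotropy[of ?y]) (use a' Delta_k_range[of y m] in auto)
  have 2: "?z \<in> Delta_k \<alpha> J m" by (rule Delta_k_isotropy[of ?y]) (use a' Delta_k_range[of ?z l] in auto)
  show "(h, y, l + m) \<in> Gar"
    unfolding Gar_iff z using a' 1 2 Delta_k_add by simp
next
  fix h y k assume a: "(h, y, k) \<in> Gar"
  have "\<beta> (hk h (- k)) (\<beta> (hk h k) y) = y"
    by (simp add: beta_add[symmetric] hk_add[symmetric] beta_0)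
  then show "(h, \<beta> (hk h k) y, - k) \<in> Gar" using a Delta_k_minus by (simp add: Gar_iff)
qed

text \<open>Two elements of the torus that move \<open>\<sigma> y\<close> to the same point differ by an element that fixes
  \<open>\<sigma> y\<close>. As the torus is commutative, this element fixes the whole orbit, so it lies in the isotropy
  group, which is trivial over \<open>\<Delta>(\<infinity>)\<close>.\<close>

lemma k_sigma_rho:
  assumes y: "y \<in> D" and s: "s \<in> torus" shows "k_sigma \<alpha> J \<sigma> k (\<rho> (y, s)) = character k s"
proof -
  have uniq: "s' = s" if s': "s' \<in> torus" and eq: "\<alpha> s (\<sigma> y) = \<alpha> s' (\<sigma> y)" for s'
  proof -
    (* r is the inverse of s *)
    define r :: "complex ^ 'n" where "r = (\<chi> i. cnj (s $ i))"
    have rt: "r \<in> torus" using s by (simp add: r_def torus_def)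
    have rs: "r * s = 1"
      using s by (simp add: r_def torus_def vec_eq_iff complex_norm_square[symmetric] mult.commute)
    have t: "r * s' \<in> torus" using rt s' by (simp add: torus_def norm_mult)
    have fixed: "\<alpha> (r * s') (\<sigma> y) = \<sigma> y"
      using eq rs by (metis act_mult act_one rt s s')
    have "\<alpha> (r * s') x = x" if "J x = y" for x
    proof -
      have "J (\<sigma> y) = J x" using that sigma by auto
      then obtain q where q: "q \<in> torus" "x = \<alpha> q (\<sigma> y)" using J_eq_iff by blast
      have "\<alpha> (r * s') x = \<alpha> (q * (r * s')) (\<sigma> y)"
        using q t by (simp add: act_mult[symmetric] mult.commute)
      also have "\<dots> = x" using act_mult[OF q(1) t] fixed q(2) by simp
      finally show ?thesis .
    qed
    then have "r * s' \<in> isotropy \<alpha> J y" using t by (simp add: isotropy_def)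
    then have "r * s' = 1" using y by (simp add: Delta_inf_def)
    then have "s * (r * s') = s" by simp
    then show ?thesis using rs by (metis mult.assoc mult.commute mult_1)
  qed
  have Jx: "J (\<rho> (y, s)) = y" by (rule J_rho[OF y s])
  show ?thesis
    unfolding k_sigma_def Jx
  proof (rule the_equality)
    show "\<exists>t\<in>torus. \<rho> (y, s) = \<alpha> t (\<sigma> y) \<and> character k s = character k t"
      using s by (auto simp: rho_def)
    fix c assume "\<exists>t\<in>torus. \<rho> (y, s) = \<alpha> t (\<sigma> y) \<and> c = character k t"
    then show "c = character k s" using uniq by (auto simp: rho_def)
  qed
qed

abbreviation "Q \<equiv> Cc_smooth A_N (Ggrp \<alpha> \<beta> J)"
abbreviation "G0 \<equiv> fiber (Ggrp \<alpha> \<beta> J) fst 0"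

text \<open>The function on M that corresponds to the fiber of f at 0.\<close>

definition symbol :: "(real \<times> 'p \<times> (int ^ 'n) \<Rightarrow> complex) \<Rightarrow> 'm \<Rightarrow> complex" where
  "symbol f = inv_into C0 \<I> (emb (Cc_alg G0) (restr G0 f))"

lemma Q_Cc: "f \<in> Q \<Longrightarrow> f \<in> Cc (Ggrp \<alpha> \<beta> J)"
  by (simp add: Cc_smooth_def)

lemma symbol_smooth: "f \<in> Q \<Longrightarrow> smooth_fun A_M (symbol f)"
  using deformation unfolding deformation_groupoid_def Let_def C0_smooth_def symbol_def by blast

lemma Q_conv: "f \<in> Q \<Longrightarrow> f' \<in> Q \<Longrightarrow> conv (Ggrp \<alpha> \<beta> J) f f' \<in> Q"
  using deformation unfolding deformation_groupoid_def Let_def star_subalgebra_def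
  by (simp add: Cc_alg_def)

lemma fourier:
  assumes "f \<in> Cc G0"
  shows "inv_into C0 \<I> (emb (Cc_alg G0) f)
    = (\<lambda>x. \<Sum>\<^sub>\<infinity>k\<in>{k. J x \<in> Delta_k \<alpha> J k}. f (0, J x, k) * k_sigma \<alpha> J \<sigma> k x)"
  using \<I> assms unfolding fourier_iso_def Let_def by blast

end

context product_chart_at
begin

sublocale G: subgroupoid \<beta> Gar
  by (rule subgroupoid_Gar[OF y0(2)])

lemma G_H: "G.H = Ggrp \<alpha> \<beta> J"
  unfolding G.H_def by (simp add: Gar_def Ggrp_def Gtilde_def)

lemma fiber_nonempty: "G.arrows_at h \<noteq> {}"
proof -
  have "(h, y0, 0) \<in> Gar" using D_Gar[of y0 h 0] y0(2) by (simp add: beta_0)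
  then show ?thesis by auto
qed

text \<open>The value at \<open>(0, y\<^sub>0, m)\<close> of the bracket on the groupoid side is the limit of the values of the
  rescaled commutators along the continuous path \<open>h \<mapsto> (h, y\<^sub>0, m)\<close>.\<close>

lemma bracket_limit:
  assumes f: "f \<in> Q" and f': "f' \<in> Q"
  obtains c where
    "\<forall>m. ((\<lambda>h. 1 / (\<i> * of_real h) * commutator (Ggrp \<alpha> \<beta> J) f f' (h, y0, m)) \<longlongrightarrow> c m) (at 0)"
    "\<Omega> x0 (symbol f) (symbol f') = (\<Sum>\<^sub>\<infinity>m. c m * k_sigma \<alpha> J \<sigma> m x0)"
proof -
  let ?G = "Ggrp \<alpha> \<beta> J" and ?pb = "pbracket \<Omega> (symbol f) (symbol f')"
  obtain c where c: "c \<in> restr G0 ` Q"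
    and sec: "section_continuous_at (cstar ?G) (\<lambda>h. cstar (fiber ?G fst h)) (eval_fiber ?G fst)
      (quantum_bracket ?G fst f f' c) 0"
    and pb: "?pb \<in> C0" "emb (Cc_alg G0) c = \<I> ?pb"
    using deformation f f' unfolding deformation_groupoid_def Let_def symbol_def by blast
  have field: "continuous_field (cstar ?G) (\<lambda>h. cstar (fiber ?G fst h)) (eval_fiber ?G fst)"
    and iso: "star_iso C0_alg (cstar G0) \<I>"
    using deformation unfolding deformation_groupoid_def Let_def by blast+
  define s where "s h = (if h = 0 then c else (\<lambda>g. 1 / (\<i> * of_real h) *
    commutator (fiber ?G fst h) (restr (fiber ?G fst h) f) (restr (fiber ?G fst h) f') g))" for h :: real
  have restr_Cc: "restr (fiber ?G fst h) q \<in> Cc (fiber ?G fst h)" if "q \<in> Cc ?G" for q h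
    using G.restr_Cc[of q h] that by (simp add: G_H)
  have conv_eq: "conv (fiber ?G fst h) (restr (fiber ?G fst h) p) (restr (fiber ?G fst h) q)
      = restr (fiber ?G fst h) (conv ?G p q)" if "p \<in> Q" "q \<in> Q" for p q h
    using G.conv_fiber[of p q h] fiber_nonempty Q_Cc that by (simp add: G_H)
  have c_Cc: "c \<in> Cc G0" using c restr_Cc Q_Cc by blast
  have s_Cc: "s h \<in> Cc (fiber ?G fst h)" for h
  proof (cases "h = 0")
    case False
    interpret F: subgroupoid \<beta> "G.arrows_at h" by (rule G.subgroupoid_fiber[OF fiber_nonempty])
    have eq: "fiber ?G fst h = F.H" using G.fiber_eq[OF fiber_nonempty, of h] by (simp add: G_H)
    have "commutator (fiber ?G fst h) (restr (fiber ?G fst h) f) (restr (fiber ?G fst h) f')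
        = (\<lambda>g. restr (fiber ?G fst h) (conv ?G f f') g - restr (fiber ?G fst h) (conv ?G f' f) g)"
      by (simp add: commutator_def[abs_def] conv_eq f f')
    also have "\<dots> \<in> Cc (fiber ?G fst h)"
      using restr_Cc[OF Q_Cc[OF Q_conv[OF f f']], of h] restr_Cc[OF Q_Cc[OF Q_conv[OF f' f]], of h]
      unfolding eq by (rule F.Cc_diff)
    finally have "commutator (fiber ?G fst h) (restr (fiber ?G fst h) f) (restr (fiber ?G fst h) f') \<in> Cc F.H"
      unfolding eq .
    then show ?thesis using False unfolding s_def eq by (simp only: if_False F.Cc_scale)
  qed (simp add: s_def c_Cc)
  have "quantum_bracket ?G fst f f' c = (\<lambda>h. emb (Cc_alg (fiber ?G fst h)) (s h))"
    by (simp add: quantum_bracket_def s_def fun_eq_iff)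
  note sec = sec[unfolded this]
  have lim: "((\<lambda>h. 1 / (\<i> * of_real h) * commutator ?G f f' (h, y0, m)) \<longlongrightarrow> c (0, y0, m)) (at 0)" for m
  proof -
    have path: "\<forall>\<^sub>F h in nhds 0. (h, y0, m) \<in> Gar"
      using orbit_near[of "int_vec m"] by (rule eventually_mono) (use D_Gar y0(2) in \<open>simp add: hk_scaleR\<close>)
    have "isCont (\<lambda>h. s h (h, y0, m)) 0"
      by (rule G.section_values_continuous[unfolded G_H, OF fiber_nonempty field sec s_Cc path])
    then have "((\<lambda>h. s h (h, y0, m)) \<longlongrightarrow> c (0, y0, m)) (at 0)" by (simp add: isCont_def s_def)
    moreover have "\<forall>\<^sub>F h in at 0. s h (h, y0, m) = 1 / (\<i> * of_real h) * commutator ?G f f' (h, y0, m)"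
    proof -
      have "\<forall>\<^sub>F h in at (0::real). (h, y0, m) \<in> Gar \<and> h \<noteq> 0"
        using path by (simp add: eventually_at_filter eventually_mono)
      then show ?thesis
      proof (rule eventually_mono)
        fix h :: real assume h: "(h, y0, m) \<in> Gar \<and> h \<noteq> 0"
        then have "(h, y0, m) \<in> arrows (fiber ?G fst h)" by (simp add: fiber_def Gar_def)
        then show "s h (h, y0, m) = 1 / (\<i> * of_real h) * commutator ?G f f' (h, y0, m)"
          using h by (simp add: s_def commutator_def conv_eq f f' restr_def)
      qed
    qed
    ultimately show ?thesis by (rule Lim_transform_eventually)
  qed
  have "inj_on \<I> C0" using iso by (simp add: star_iso_def bij_betw_def C0_alg_def)
  then have "inv_into C0 \<I> (emb (Cc_alg G0) c) = ?pb" unfolding pb(2) using pb(1) by (rule inv_into_f_f)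
  from fun_cong[OF this, of x0] have "\<Omega> x0 (symbol f) (symbol f')
      = (\<Sum>\<^sub>\<infinity>m\<in>{m. J x0 \<in> Delta_k \<alpha> J m}. c (0, J x0, m) * k_sigma \<alpha> J \<sigma> m x0)"
    by (simp only: fourier[OF c_Cc] pbracket_def)
  moreover have "J x0 = y0" unfolding x0_def by (rule J_rho[OF y0(2) s0_torus])
  ultimately have "\<Omega> x0 (symbol f) (symbol f') = (\<Sum>\<^sub>\<infinity>m. c (0, y0, m) * k_sigma \<alpha> J \<sigma> m x0)"
    using D_Delta_k[OF y0(2)] by simp
  moreover have "\<forall>m. ((\<lambda>h. 1 / (\<i> * of_real h) * commutator ?G f f' (h, y0, m)) \<longlongrightarrow> c (0, y0, m)) (at 0)"
    using lim by blast
  ultimately show thesis by (rule that[rotated])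
qed

end


section \<open>Test functions\<close>

text \<open>The functions with these indices have spanning differentials, and the vectors \<open>\<xi>\<^sup>\<beta>\<^sub>X\<close> that occur in
  their brackets are those of the asserted bivector, \<open>X = E\<^sub>i\<close>, and 0.\<close>

definition index_set :: "(int ^ 'n) set" where
  "index_set = insert 0 (range (\<lambda>i. axis i 1))"

text \<open>The radii are so small that \<open>(h, y, k)\<close> with \<open>\<bar>h\<bar> \<le> \<delta>\<close> and \<open>y\<close> in the ball has both ends in
  \<open>\<Delta>(\<infinity>)\<close>, and therefore belongs to the groupoid.\<close>

locale test_functions = product_chart_at A_M A_N \<alpha> \<beta> J \<sigma> \<Omega> \<I> U \<psi> V \<theta> y0 s0
  for A_M :: "('m::{t2_space, second_countable_topology}, 'e::real_inner) atlas"
    and A_N :: "('p::t2_space, 'f::real_inner) atlas"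
    and \<alpha> :: "complex ^ 'n \<Rightarrow> 'm \<Rightarrow> 'm" and \<beta> :: "real ^ 'n \<Rightarrow> 'p \<Rightarrow> 'p" and J \<sigma> \<Omega> \<I> U \<psi> V \<theta> y0 s0 +
  fixes r \<delta> :: real
  assumes r: "r > 0" and \<delta>: "\<delta> > 0"
    and ball_chart: "cball (\<psi> y0) r \<subseteq> \<psi> ` (U \<inter> D)"
    and ball_shift: "\<And>h z k. \<bar>h\<bar> \<le> \<delta> \<Longrightarrow> z \<in> cball (\<psi> y0) r \<Longrightarrow> k \<in> index_set \<Longrightarrow>
      \<beta> (hk h k) (inv_into U \<psi> z) \<in> D"

lemma (in product_chart_at) test_functions_exist:
  obtains r \<delta> where "test_functions A_M A_N \<alpha> \<beta> J \<sigma> \<Omega> \<I> U \<psi> V \<theta> y0 s0 r \<delta>"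
proof -
  define T where "T = (UNIV \<times> \<psi> ` (U \<inter> D)) \<inter>
    (\<Inter>k\<in>index_set. {p \<in> UNIV \<times> \<psi> ` U. \<beta> (hk (fst p) k) (inv_into U \<psi> (snd p)) \<in> D})"
  have fin: "finite (index_set :: (int ^ 'n) set)" by (simp add: index_set_def)
  have "open {p \<in> UNIV \<times> \<psi> ` U. \<beta> (hk (fst p) k) (inv_into U \<psi> (snd p)) \<in> D}" for k :: "int ^ 'n"
  proof -
    have "continuous_on (UNIV \<times> \<psi> ` U) (\<lambda>p. inv_into U \<psi> (snd p))"
      by (rule continuous_on_compose2[OF homeomorphism_cont2[OF U_hom(1)]]) (auto intro!: continuous_intros)
    moreover have "continuous_on (UNIV \<times> \<psi> ` U) (\<lambda>p. hk (fst p) k)"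
      unfolding hk_scaleR by (intro continuous_intros)
    ultimately have "continuous_on (UNIV \<times> \<psi> ` U) (\<lambda>p. (hk (fst p) k, inv_into U \<psi> (snd p)))"
      by (rule continuous_on_Pair[rotated])
    from continuous_on_compose2[OF beta_continuous this]
    have "continuous_on (UNIV \<times> \<psi> ` U) (\<lambda>p. \<beta> (hk (fst p) k) (inv_into U \<psi> (snd p)))" by simp
    from continuous_open_preimage[OF this open_Times[OF open_UNIV U_hom(3)] Delta_inf_open]
    show ?thesis by (simp add: vimage_def Int_def)
  qed
  then have "open T" unfolding T_def
    by (intro open_Int open_Times open_UNIV open_psi_D open_INT fin ballI)
  moreover have "(0, \<psi> y0) \<in> T" using y0 by (auto simp: T_def beta_0 inv_psi)
  ultimately obtain A B where AB: "open A" "open B" "(0, \<psi> y0) \<in> A \<times> B" "A \<times> B \<subseteq> T"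
    by (rule open_prod_elim)
  have "0 \<in> A" "\<psi> y0 \<in> B" using AB(3) by auto
  then obtain \<delta> r where \<delta>: "\<delta> > 0" "cball 0 \<delta> \<subseteq> A" and r: "r > 0" "cball (\<psi> y0) r \<subseteq> B"
    using AB(1,2) unfolding open_contains_cball by blast
  have T: "(h, z) \<in> T" if "\<bar>h\<bar> \<le> \<delta>" "z \<in> cball (\<psi> y0) r" for h z
    using that \<delta>(2) r(2) AB(4) by (auto simp: subset_iff)
  have "test_functions A_M A_N \<alpha> \<beta> J \<sigma> \<Omega> \<I> U \<psi> V \<theta> y0 s0 r \<delta>"
  proof
    show "r > 0" "\<delta> > 0" by fact+
    show "cball (\<psi> y0) r \<subseteq> \<psi> ` (U \<inter> D)" using T[of 0] \<delta>(1) unfolding T_def by auto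
    show "\<beta> (hk h k) (inv_into U \<psi> z) \<in> D"
      if "\<bar>h\<bar> \<le> \<delta>" "z \<in> cball (\<psi> y0) r" "k \<in> index_set" for h z k
      using T[OF that(1,2)] that(3) unfolding T_def by auto
  qed
  then show thesis by (rule that)
qed

text \<open>The indicator of a point is the product of indicators of single coordinates, and these are continuous
  because \<open>\<int>\<close> is discrete.\<close>

lemma continuous_on_eq_index: "continuous_on UNIV (\<lambda>m :: int ^ 'n. if m = k then 1 else (0::complex))"
proof -
  have "continuous_on UNIV (\<lambda>j. if j = a then 1 else (0::complex))" for a :: int
    by (simp add: continuous_on_open_vimage open_discrete)
  then have "continuous_on UNIV (\<lambda>m :: int ^ 'n. if m $ i = k $ i then 1 else (0::complex))" for i
    by (rule continuous_on_compose2) (auto intro!: continuous_intros)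
  then have "continuous_on UNIV (\<lambda>m :: int ^ 'n. \<Prod>i\<in>UNIV. (if m $ i = k $ i then 1 else (0::complex)))"
    by (intro continuous_on_prod)
  moreover have "(\<Prod>i\<in>UNIV. (if m $ i = k $ i then 1 else (0::complex))) = (if m = k then 1 else 0)"
    for m :: "int ^ 'n"
  proof (cases "m = k")
    case False
    then obtain i where "m $ i \<noteq> k $ i" by (auto simp: vec_eq_iff)
    then show ?thesis using False by (auto intro!: prod_zero)
  qed simp
  ultimately show ?thesis by simp
qed

lemma difference_quotient_tendsto:
  fixes F :: "real \<Rightarrow> 'a::real_normed_vector"
  assumes "(F has_vector_derivative F') (at 0)"
  shows "((\<lambda>h. (F h - F 0) /\<^sub>R h) \<longlongrightarrow> F') (at 0)"
proof -
  have "((\<lambda>h. norm (F (0 + h) - F 0 - h *\<^sub>R F') / norm h) \<longlongrightarrow> 0) (at 0)"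
    using assms by (simp only: has_vector_derivative_def has_derivative_at)
  moreover have "\<forall>\<^sub>F h in at 0. norm (F (0 + h) - F 0 - h *\<^sub>R F') / norm h = norm ((F h - F 0) /\<^sub>R h - F')"
    unfolding eventually_at_filter
  proof (intro always_eventually allI impI)
    fix h :: real assume "h \<noteq> 0"
    then have "(F h - F 0) /\<^sub>R h - F' = inverse h *\<^sub>R (F h - F 0 - h *\<^sub>R F')"
      by (simp add: scaleR_diff_right)
    then show "norm (F (0 + h) - F 0 - h *\<^sub>R F') / norm h = norm ((F h - F 0) /\<^sub>R h - F')"
      by (simp add: divide_inverse mult.commute)
  qed
  ultimately have "((\<lambda>h. norm ((F h - F 0) /\<^sub>R h - F')) \<longlongrightarrow> 0) (at 0)" by (rule Lim_transform_eventually)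
  then show ?thesis by (rule LIM_zero_cancel[OF tendsto_norm_zero_cancel])
qed

context test_functions
begin

definition admissible :: "('f \<Rightarrow> complex) \<Rightarrow> bool" where
  "admissible g \<longleftrightarrow> smooth_on UNIV g \<and> (\<forall>z. z \<notin> cball (\<psi> y0) r \<longrightarrow> g z = 0)"

definition on_N :: "('f \<Rightarrow> complex) \<Rightarrow> 'p \<Rightarrow> complex" where
  "on_N g y = (if y \<in> U then g (\<psi> y) else 0)"

definition test :: "int ^ 'n \<Rightarrow> ('f \<Rightarrow> complex) \<Rightarrow> real \<times> 'p \<times> (int ^ 'n) \<Rightarrow> complex" where
  "test k g = (\<lambda>(h, y, m). of_real (bump 0 \<delta> h) * on_N g y * (if m = k then 1 else 0))"

definition "ball_N = inv_into U \<psi> ` cball (\<psi> y0) r"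

lemma on_N:
  assumes "admissible g"
  shows "smooth_fun A_N (on_N g)" "y \<notin> ball_N \<Longrightarrow> on_N g y = 0" and compact_ball_N: "compact ball_N"
proof -
  obtain B :: "'f set" where B: "orthonormal_frame B" by (rule frame_N)
  have sub: "cball (\<psi> y0) r \<subseteq> \<psi> ` U" using ball_chart by blast
  have g: "smooth_on UNIV g" "\<And>z. z \<notin> cball (\<psi> y0) r \<Longrightarrow> g z = 0" using assms by (simp_all add: admissible_def)
  note * = smooth_fun_extend_by_0[where g=g, OF N U_chart g(1) compact_cball_frame[OF B] sub]
  show "smooth_fun A_N (on_N g)" unfolding on_N_def[abs_def] by (rule *(1)[OF g(2)])
  show "compact ball_N" unfolding ball_N_def by (rule *(2)[OF g(2)])
  show "y \<notin> ball_N \<Longrightarrow> on_N g y = 0" unfolding ball_N_def on_N_def by (rule *(3)[OF g(2)])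
qed

lemma ball_N_shift:
  assumes "\<bar>h\<bar> \<le> \<delta>" "y \<in> ball_N" "k \<in> index_set"
  shows "(h, y, k) \<in> Gar"
proof -
  obtain z where z: "z \<in> cball (\<psi> y0) r" "y = inv_into U \<psi> z" using assms(2) by (auto simp: ball_N_def)
  have "y \<in> D" using z ball_chart inv_psi by force
  then show ?thesis using ball_shift[OF assms(1) z(1) assms(3)] z(2) by (intro D_Gar) simp_all
qed

lemma test_continuous: "admissible g \<Longrightarrow> continuous_on S (test k g)"
proof -
  assume g: "admissible g"
  have "continuous_on UNIV (on_N g)" using on_N(1)[OF g] N(2) by (simp add: smooth_fun_iff)
  moreover have "continuous_on UNIV (bump 0 \<delta> :: real \<Rightarrow> real)" by (rule smooth_on_continuous[OF smooth_on_bump])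
  ultimately have "continuous_on UNIV (\<lambda>p::real \<times> 'p \<times> (int ^ 'n). of_real (bump 0 \<delta> (fst p)) * on_N g (fst (snd p)) *
      (if snd (snd p) = k then 1 else 0))"
    by (intro continuous_on_mult continuous_on_of_real continuous_on_compose2[OF _ continuous_on_fst]
        continuous_on_compose2[OF _ continuous_on_fst[OF continuous_on_snd]]
        continuous_on_compose2[OF continuous_on_eq_index continuous_on_snd[OF continuous_on_snd]])
       (auto intro: continuous_intros)
  then show "continuous_on S (test k g)"
    unfolding test_def case_prod_beta by (rule continuous_on_subset) simp
qed

lemma test_smooth:
  assumes g: "admissible g" shows "smooth_fun (Gtilde_atlas A_N) (test k g)"
  unfolding smooth_fun_iff
proof (intro conjI ballI)
  show "continuous_on (points (Gtilde_atlas A_N)) (test k g)" by (rule test_continuous[OF g])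
  fix c assume "c \<in> (Gtilde_atlas A_N :: (real \<times> 'p \<times> (int ^ 'n), real \<times> 'f) atlas)"
  then obtain U' \<phi> m where ch: "(U', \<phi>) \<in> A_N"
    and c: "c = (UNIV \<times> U' \<times> {m}, \<lambda>(h, y, _). (h, \<phi> y))"
    unfolding Gtilde_atlas_def by blast
  let ?W = "UNIV \<times> U' \<times> {m} :: (real \<times> 'p \<times> (int ^ 'n)) set"
  let ?k = "(\<lambda>(h, y, _). (h, \<phi> y)) :: real \<times> 'p \<times> (int ^ 'n) \<Rightarrow> real \<times> 'f"
  note hom = smooth_manifold_chart[OF N ch]
  obtain B :: "'f set" where B: "orthonormal_frame B" by (rule frame_N)
  have im: "?k ` ?W = UNIV \<times> \<phi> ` U'" by force
  have op: "open (UNIV \<times> \<phi> ` U' :: (real \<times> 'f) set)" by (intro open_Times open_UNIV hom(3))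
  have inv: "inv_into ?W ?k (h, \<phi> y) = (h, y, m)" if "y \<in> U'" for h y
  proof -
    have inj: "inj_on ?k ?W" using homeomorphism_apply1[OF hom(1)] by (auto simp: inj_on_def) metis
    show ?thesis using inv_into_f_f[OF inj, of "(h, y, m)"] that by simp
  qed
  have "smooth_on (\<phi> ` U') (on_N g \<circ> inv_into U' \<phi>)" using on_N(1)[OF g] ch by (auto simp: smooth_fun_iff)
  then have s1: "smooth_on (UNIV \<times> \<phi> ` U' :: (real \<times> 'f) set) (\<lambda>p. (on_N g \<circ> inv_into U' \<phi>) (snd p))"
    using smooth_on_linear[OF bounded_linear_snd op] by (rule smooth_on_compose[OF B op]) auto
  have "smooth_on (UNIV \<times> \<phi> ` U' :: (real \<times> 'f) set) (\<lambda>p. bump 0 \<delta> (fst p))"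
    using smooth_on_bump smooth_on_linear[OF bounded_linear_fst op]
    by (rule smooth_on_compose[OF orthonormal_frame_Basis op]) simp
  from smooth_on_bilinear[OF bounded_bilinear_scaleR op this s1]
  have s2: "smooth_on (UNIV \<times> \<phi> ` U' :: (real \<times> 'f) set) (\<lambda>p. bump 0 \<delta> (fst p) *\<^sub>R (on_N g \<circ> inv_into U' \<phi>) (snd p))" .
  have s3: "smooth_on (UNIV \<times> \<phi> ` U' :: (real \<times> 'f) set) (\<lambda>p. if m = k then 1 else (0::complex))"
    by (rule smooth_on_const[OF op])
  from smooth_on_bilinear[OF bounded_bilinear_mult op s2 s3]
  have "smooth_on (UNIV \<times> \<phi> ` U') (test k g \<circ> inv_into ?W ?k)"
  proof (rule smooth_on_cong[OF op, rotated])
    fix p :: "real \<times> 'f" assume "p \<in> UNIV \<times> \<phi> ` U'"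
    then obtain h y where "y \<in> U'" "p = (h, \<phi> y)" by force
    then show "bump 0 \<delta> (fst p) *\<^sub>R (on_N g \<circ> inv_into U' \<phi>) (snd p) * (if m = k then 1 else 0)
        = (test k g \<circ> inv_into ?W ?k) p"
      using inv homeomorphism_apply1[OF hom(1)] by (simp add: test_def scaleR_conv_of_real)
  qed
  then show "case c of (U, \<phi>) \<Rightarrow> smooth_on (\<phi> ` U) (test k g \<circ> inv_into U \<phi>)"
    by (simp only: c prod.case im)
qed

lemma test_in_Q:
  assumes g: "admissible g" and k: "k \<in> index_set" shows "test k g \<in> Q"
proof -
  let ?K = "cball (0::real) \<delta> \<times> ball_N \<times> {k}"
  have "compact ?K" by (intro compact_Times compact_ball_N[OF g]) simp_all
  moreover have "?K \<subseteq> arrows (Ggrp \<alpha> \<beta> J)" using ball_N_shift[OF _ _ k] by (auto simp: Gar_def[symmetric])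
  moreover have "\<forall>p. p \<notin> ?K \<longrightarrow> test k g p = 0"
  proof (intro allI impI)
    fix p assume p: "p \<notin> ?K"
    obtain h y m where hym: "p = (h, y, m)" by (metis surj_pair)
    show "test k g p = 0"
      using p bump_eq_0[OF \<delta>, of h 0] on_N(2)[OF g, of y] unfolding hym test_def by auto
  qed
  ultimately have "test k g \<in> Cc (Ggrp \<alpha> \<beta> J)"
    unfolding Cc_def mem_Collect_eq using test_continuous[OF g] by blast
  then show ?thesis
    unfolding Cc_smooth_def mem_Collect_eq using test_smooth[OF g] by blast
qed

lemma test_symbol:
  assumes g: "admissible g" and k: "k \<in> index_set" and y: "y \<in> U \<inter> D" and s: "s \<in> torus"
  shows "symbol (test k g) (\<rho> (y, s)) = g (\<psi> y) * character k s"
proof -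
  have Jx: "J (\<rho> (y, s)) = y" using J_rho y s by blast
  have "restr (fiber G.H fst 0) (test k g) \<in> Cc (fiber G.H fst 0)"
    by (rule G.restr_Cc) (simp add: G_H Q_Cc[OF test_in_Q[OF g k]])
  then have f0: "restr G0 (test k g) \<in> Cc G0" by (simp only: G_H)
  have arr: "(0, y, m) \<in> arrows G0" for m
    using D_Gar[of y 0 m] y by (simp add: fiber_def beta_0 Gar_def)
  have "symbol (test k g) (\<rho> (y, s))
      = (\<Sum>\<^sub>\<infinity>m\<in>UNIV. restr G0 (test k g) (0, y, m) * k_sigma \<alpha> J \<sigma> m (\<rho> (y, s)))"
    unfolding symbol_def fourier[OF f0] Jx using D_Delta_k y by simp
  also have "\<dots> = restr G0 (test k g) (0, y, k) * k_sigma \<alpha> J \<sigma> k (\<rho> (y, s))"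
    by (rule infsum_single) (simp_all add: restr_def test_def)
  also have "\<dots> = g (\<psi> y) * character k s"
    using y s by (simp add: restr_def arr test_def on_N_def k_sigma_rho)
  finally show ?thesis .
qed

text \<open>In the product coordinates the function is \<open>(z, \<tau>) \<mapsto> g(z) exp (\<i> (k|\<tau>))\<close>.\<close>

lemma test_dcoord:
  assumes g: "admissible g" and k: "k \<in> index_set" and Dg: "(g has_derivative Dg) (at (\<psi> y0))"
  shows "dcoord (symbol (test k g)) (w1, w2) =
    (Dg w1 + g (\<psi> y0) * \<i> * of_real (\<Sum>i\<in>UNIV. of_int (k $ i) * w2 $ i)) * character k s0"
proof -
  let ?S = "\<lambda>\<tau>. \<Sum>i\<in>UNIV. of_int (k $ i) * \<tau> $ i :: real"
  have S: "bounded_linear ?S"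
    by (intro bounded_linear_sum bounded_linear_mult_const[THEN bounded_linear_compose]
        bounded_linear_compose[OF bounded_linear_mult_right bounded_linear_vec_nth])
  have sE: "cis (?S (\<theta> s0)) = character k s0"
    using character_torus_exp[of k "\<theta> s0"] by (simp only: torus_chart(2)[OF V_chart s0])
  have E: "((\<lambda>\<tau>. cis (?S \<tau>)) has_derivative (\<lambda>w. (\<i> * of_real (?S w)) * character k s0)) (at (\<theta> s0))"
    by (rule has_derivative_eq_rhs[OF has_derivative_cis[OF bounded_linear_imp_has_derivative[OF S]]])
       (simp add: scaleR_conv_of_real fun_eq_iff sE[symmetric] mult_ac)
  have "((\<lambda>p. g (fst p)) has_derivative (\<lambda>w. Dg (fst w))) (at z0)"
    by (rule has_derivative_compose[where g=g]) (use Dg in \<open>auto simp: z0_def intro: has_derivative_fst\<close>)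
  moreover have "((\<lambda>p. cis (?S (snd p))) has_derivative (\<lambda>w. (\<i> * of_real (?S (snd w))) * character k s0)) (at z0)"
    by (rule has_derivative_compose[where g="\<lambda>\<tau>. cis (?S \<tau>)"]) (use E in \<open>auto simp: z0_def intro: has_derivative_snd\<close>)
  ultimately have "((\<lambda>p. g (fst p) * cis (?S (snd p))) has_derivative
      (\<lambda>w. g (fst z0) * ((\<i> * of_real (?S (snd w))) * character k s0) + Dg (fst w) * cis (?S (snd z0)))) (at z0)"
    by (rule has_derivative_mult)
  then have "((\<lambda>p. g (fst p) * cis (?S (snd p))) has_derivative
      (\<lambda>w. g (\<psi> y0) * ((\<i> * of_real (?S (snd w))) * character k s0) + Dg (fst w) * character k s0)) (at z0)"
    by (simp only: z0_def fst_conv snd_conv sE)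
  then have "(coords (symbol (test k g)) has_derivative
      (\<lambda>w. g (\<psi> y0) * ((\<i> * of_real (?S (snd w))) * character k s0) + Dg (fst w) * character k s0)) (at z0)"
  proof (rule has_derivative_transform_within_open[OF _ open_kappa_W z0_mem])
    fix p assume "p \<in> \<kappa> ` W"
    then obtain y s where ys: "(y, s) \<in> W" "p = \<kappa> (y, s)" by auto
    then have "from_coords p = (y, s)" using from_coords_kappa by blast
    then show "g (fst p) * cis (?S (snd p)) = coords (symbol (test k g)) p"
      using ys V_torus test_symbol[OF g k, of y s] torus_chart(2)[OF V_chart, of s] character_torus_exp[of k "\<theta> s"]
      by auto
  qed
  from frechet_derivative_at[OF this] show ?thesis
    unfolding dcoord_def by (simp add: algebra_simps fun_eq_iff)
qed

text \<open>The only factorisation that contributes is that of \<open>k + k'\<close> into \<open>k\<close> and \<open>k'\<close>; the base point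
  of the left factor is moved by the right one.\<close>

lemma conv_test:
  assumes g: "admissible g" "k \<in> index_set" and g': "admissible g'" "k' \<in> index_set"
  shows "conv (Ggrp \<alpha> \<beta> J) (test k g) (test k' g') (h, y, m)
    = (if m = k + k' then of_real ((bump 0 \<delta> h)\<^sup>2) * (on_N g (\<beta> (hk h k') y) * on_N g' y) else 0)"
proof -
  have "G.banded (test k g)" "G.banded (test k' g')"
    using G.Cc_banded Q_Cc test_in_Q g g' by (simp_all add: G_H)
  from G.conv_banded[OF this, of h y m]
  have "conv (Ggrp \<alpha> \<beta> J) (test k g) (test k' g') (h, y, m)
      = (\<Sum>j\<in>supp (\<lambda>j. test k' g' (h, y, j)). test k g (h, \<beta> (hk h j) y, m - j) * test k' g' (h, y, j))"
    by (simp add: G_H)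
  also have "\<dots> = (\<Sum>j\<in>{k'}. test k g (h, \<beta> (hk h j) y, m - j) * test k' g' (h, y, j))"
    by (rule sum.mono_neutral_left) (auto simp: test_def split: if_splits)
  also have "\<dots> = (if m = k + k' then of_real ((bump 0 \<delta> h)\<^sup>2) * (on_N g (\<beta> (hk h k') y) * on_N g' y) else 0)"
    by (auto simp: test_def power2_eq_square eq_diff_eq diff_eq_eq)
  finally show ?thesis .
qed

lemma on_N_orbit_derivative:
  assumes g: "admissible g" and Dg: "(g has_derivative Dg) (at (\<psi> y0))"
  shows "((\<lambda>h. on_N g (\<beta> (hk h k) y0)) has_vector_derivative Dg (drift (int_vec k))) (at 0)"
proof -
  have "(g has_derivative Dg) (at (\<psi> (\<beta> (0 *\<^sub>R int_vec k) y0)))" using Dg by (simp add: beta_0)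
  from has_derivative_compose[OF drift[unfolded has_vector_derivative_def] this]
  have "((\<lambda>h. g (\<psi> (\<beta> (h *\<^sub>R int_vec k) y0))) has_derivative (\<lambda>h. Dg (h *\<^sub>R drift (int_vec k)))) (at 0)" .
  then have "((\<lambda>h. g (\<psi> (\<beta> (h *\<^sub>R int_vec k) y0))) has_vector_derivative Dg (drift (int_vec k))) (at 0)"
    using has_derivative_linear[OF Dg] by (simp add: has_vector_derivative_def linear_cmul)
  moreover obtain S where S: "open S" "0 \<in> S" "\<And>h. h \<in> S \<Longrightarrow> \<beta> (h *\<^sub>R int_vec k) y0 \<in> U \<inter> D"
    using orbit_near[of "int_vec k"] unfolding eventually_nhds by metis
  ultimately show ?thesis
    unfolding hk_scaleR
    using has_vector_derivative_transform_within_open[of "\<lambda>h. g (\<psi> (\<beta> (h *\<^sub>R int_vec k) y0))" _ 0 S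
        "\<lambda>h. on_N g (\<beta> (h *\<^sub>R int_vec k) y0)"] by (simp add: on_N_def)
qed

text \<open>Without the cutoff, the commutator on the sheet \<open>k + k'\<close> is a function \<open>F\<close> of \<open>h\<close> that is
  differentiable at 0, with \<open>F 0 = 0\<close>. The limit of \<open>F h / (\<i> h)\<close> is therefore \<open>F' 0 / \<i>\<close>, and the cutoff, being
  continuous with value 1 at 0, does not affect it.\<close>

lemma bracket_test:
  assumes g: "admissible g" "k \<in> index_set" "(g has_derivative Dg) (at (\<psi> y0))"
    and g': "admissible g'" "k' \<in> index_set" "(g' has_derivative Dg') (at (\<psi> y0))"
  shows "\<Omega> x0 (symbol (test k g)) (symbol (test k' g')) =
    \<i> * (g (\<psi> y0) * Dg' (drift (int_vec k)) - Dg (drift (int_vec k')) * g' (\<psi> y0)) * character k s0 * character k' s0"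
proof -
  let ?C = "commutator (Ggrp \<alpha> \<beta> J) (test k g) (test k' g')"
  obtain c where c: "\<forall>m. ((\<lambda>h. 1 / (\<i> * of_real h) * ?C (h, y0, m)) \<longlongrightarrow> c m) (at 0)"
    and \<Omega>: "\<Omega> x0 (symbol (test k g)) (symbol (test k' g')) = (\<Sum>\<^sub>\<infinity>m. c m * k_sigma \<alpha> J \<sigma> m x0)"
    by (rule bracket_limit[OF test_in_Q[OF g(1,2)] test_in_Q[OF g'(1,2)]])
  define F where "F h = on_N g (\<beta> (hk h k') y0) * on_N g' y0 - on_N g' (\<beta> (hk h k) y0) * on_N g y0" for h
  let ?F' = "Dg (drift (int_vec k')) * g' (\<psi> y0) - Dg' (drift (int_vec k)) * g (\<psi> y0)"
  have C: "?C (h, y0, m) = (if m = k + k' then of_real ((bump 0 \<delta> h)\<^sup>2) * F h else 0)" for h m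
    by (simp add: commutator_def conv_test g g' F_def add.commute algebra_simps)
  have "c m = 0" if "m \<noteq> k + k'" for m
  proof -
    have "((\<lambda>h::real. 0) \<longlongrightarrow> c m) (at 0)" using c[rule_format, of m] that by (simp add: C)
    then show ?thesis by (rule LIM_const_eq[symmetric])
  qed
  then have \<Omega>': "\<Omega> x0 (symbol (test k g)) (symbol (test k' g')) = c (k + k') * k_sigma \<alpha> J \<sigma> (k + k') x0"
    unfolding \<Omega> by (intro infsum_single) simp_all
  have "(F has_vector_derivative ?F') (at 0)"
    unfolding F_def[abs_def] using on_N_orbit_derivative[OF g(1,3), of k'] on_N_orbit_derivative[OF g'(1,3), of k] y0
    by (auto intro!: derivative_eq_intros simp: on_N_def)
  moreover have F0: "F 0 = 0" by (simp add: F_def beta_0 mult.commute)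
  ultimately have "((\<lambda>h. (F h - F 0) /\<^sub>R h) \<longlongrightarrow> ?F') (at 0)"
    by (intro difference_quotient_tendsto)
  moreover have "((\<lambda>h. bump 0 \<delta> h) \<longlongrightarrow> 1) (at (0::real))"
    using smooth_on_continuous[OF smooth_on_bump, of "0::real" \<delta>]
    by (metis UNIV_I bump_center continuous_on_def at_within_open open_UNIV)
  ultimately have "((\<lambda>h. 1 / \<i> * (of_real ((bump 0 \<delta> h)\<^sup>2) * ((F h - F 0) /\<^sub>R h))) \<longlongrightarrow> 1 / \<i> * (of_real (1\<^sup>2) * ?F')) (at 0)"
    by (intro tendsto_intros)
  then have "((\<lambda>h. 1 / (\<i> * of_real h) * ?C (h, y0, k + k')) \<longlongrightarrow> 1 / \<i> * ?F') (at 0)"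
    by (simp add: C F0 scaleR_conv_of_real divide_inverse mult_ac)
  then have "c (k + k') = 1 / \<i> * ?F'" using c[rule_format, of "k + k'"] LIM_unique by blast
  also have "1 / \<i> * ?F' = \<i> * (g (\<psi> y0) * Dg' (drift (int_vec k)) - Dg (drift (int_vec k')) * g' (\<psi> y0))"
    by (simp add: algebra_simps)
  finally have "c (k + k') = \<i> * (g (\<psi> y0) * Dg' (drift (int_vec k)) - Dg (drift (int_vec k')) * g' (\<psi> y0))" .
  moreover have "k_sigma \<alpha> J \<sigma> (k + k') x0 = character k s0 * character k' s0"
    unfolding x0_def by (simp add: k_sigma_rho y0 s0_torus character_add)
  ultimately show ?thesis unfolding \<Omega>' by (simp only: mult.assoc)
qed

end


section \<open>Comparison of the two bivectors\<close>

text \<open>If all tangent vectors involved expand u and v by the same coefficients, so do their wedge products.\<close>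

lemma sum_wedge_expand:
  assumes P: "finite P"
    and ab: "\<And>j. j \<in> I \<Longrightarrow> a j u = (\<Sum>p\<in>P. c p * a j (t p)) \<and> a j v = (\<Sum>p\<in>P. d p * a j (t p))
      \<and> b j u = (\<Sum>p\<in>P. c p * b j (t p)) \<and> b j v = (\<Sum>p\<in>P. d p * b j (t p))"
  shows "(\<Sum>j\<in>I. wedge (a j) (b j) u v)
    = (\<Sum>p\<in>P. \<Sum>q\<in>P. c p * d q * (\<Sum>j\<in>I. wedge (a j) (b j) (t p) (t q)))"
proof -
  have "wedge (a j) (b j) u v = (\<Sum>p\<in>P. \<Sum>q\<in>P. c p * d q * wedge (a j) (b j) (t p) (t q))" if j: "j \<in> I" for j
  proof -
    have "a j u * b j v - b j u * a j v
      = (\<Sum>p\<in>P. \<Sum>q\<in>P. (c p * a j (t p)) * (d q * b j (t q))) - (\<Sum>p\<in>P. \<Sum>q\<in>P. (c p * b j (t p)) * (d q * a j (t q)))"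
      using ab[OF j] by (simp only: sum_product)
    also have "\<dots> = (\<Sum>p\<in>P. \<Sum>q\<in>P. c p * d q * (a j (t p) * b j (t q) - b j (t p) * a j (t q)))"
      unfolding sum_subtractf[symmetric] by (intro sum.cong refl) (simp add: algebra_simps)
    finally show ?thesis by (simp add: wedge_def tensor_def)
  qed
  then have "(\<Sum>j\<in>I. wedge (a j) (b j) u v)
      = (\<Sum>j\<in>I. \<Sum>p\<in>P. \<Sum>q\<in>P. c p * d q * wedge (a j) (b j) (t p) (t q))" by simp
  also have "\<dots> = (\<Sum>p\<in>P. \<Sum>j\<in>I. \<Sum>q\<in>P. c p * d q * wedge (a j) (b j) (t p) (t q))" by (rule sum.swap)
  also have "\<dots> = (\<Sum>p\<in>P. \<Sum>q\<in>P. \<Sum>j\<in>I. c p * d q * wedge (a j) (b j) (t p) (t q))"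
    by (intro sum.cong refl sum.swap)
  finally show ?thesis by (simp only: sum_distrib_left)
qed

context test_functions
begin

abbreviation "Lambda \<equiv> \<lambda>u v. \<Sum>i\<in>UNIV. wedge (xi_alpha A_M \<alpha> (axis i 1) x0)
  (rho_star_xi_beta A_M A_N \<alpha> \<beta> J \<sigma> (axis i 1) x0) u v"

lemma drift_0: "drift 0 = 0"
  by (simp add: drift_def beta_0 vector_derivative_const_at)

text \<open>At most one coefficient of \<open>k\<close> is nonzero, and it is 1.\<close>

lemma sum_drift:
  assumes k: "k \<in> index_set" and L: "linear Dg"
  shows "(\<Sum>i\<in>UNIV. complex_of_int (k $ i) * Dg (drift (axis i 1))) = Dg (drift (int_vec k))"
proof (cases "k = 0")
  case True
  then show ?thesis using linear_0[OF L] by (simp add: int_vec_simps drift_0)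
next
  case False
  then obtain i where i: "k = axis i 1" using k by (auto simp: index_set_def)
  have "(\<Sum>j\<in>UNIV. complex_of_int (k $ j) * Dg (drift (axis j 1)))
      = (\<Sum>j\<in>UNIV. if j = i then Dg (drift (axis i 1)) else 0)"
    by (intro sum.cong refl) (auto simp: i axis_def)
  then show ?thesis by (simp add: i int_vec_simps)
qed

lemma Lambda_test:
  assumes g: "admissible g" "k \<in> index_set" "(g has_derivative Dg) (at (\<psi> y0))"
    and g': "admissible g'" "k' \<in> index_set" "(g' has_derivative Dg') (at (\<psi> y0))"
  shows "Lambda (symbol (test k g)) (symbol (test k' g')) =
    \<i> * (g (\<psi> y0) * Dg' (drift (int_vec k)) - Dg (drift (int_vec k')) * g' (\<psi> y0)) * character k s0 * character k' s0"
proof -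
  note sm = symbol_smooth[OF test_in_Q[OF g(1,2)]] symbol_smooth[OF test_in_Q[OF g'(1,2)]]
  note lin = has_derivative_linear[OF g(3)] has_derivative_linear[OF g'(3)]
  have ax: "(\<Sum>j\<in>UNIV. of_int (m $ j) * (axis i 1 :: real ^ 'n) $ j) = of_int (m $ i)" for m :: "int ^ 'n" and i
    by (simp add: axis_def if_distrib cong: if_cong)
  have xa: "xi_alpha A_M \<alpha> (axis i 1) x0 (symbol (test k g)) = g (\<psi> y0) * \<i> * of_int (k $ i) * character k s0"
    "xi_alpha A_M \<alpha> (axis i 1) x0 (symbol (test k' g')) = g' (\<psi> y0) * \<i> * of_int (k' $ i) * character k' s0" for i
    by (simp_all only: xi_alpha_dcoord sm if_True test_dcoord[OF g] test_dcoord[OF g'] ax linear_0[OF lin(1)] linear_0[OF lin(2)]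
        add_0 of_real_of_int_eq)
  have xb: "rho_star_xi_beta A_M A_N \<alpha> \<beta> J \<sigma> (axis i 1) x0 (symbol (test k g)) = Dg (drift (axis i 1)) * character k s0"
    "rho_star_xi_beta A_M A_N \<alpha> \<beta> J \<sigma> (axis i 1) x0 (symbol (test k' g')) = Dg' (drift (axis i 1)) * character k' s0" for i
    by (simp_all add: rho_star_dcoord sm test_dcoord[OF g] test_dcoord[OF g'])
  have "Lambda (symbol (test k g)) (symbol (test k' g'))
      = \<i> * (g (\<psi> y0) * (\<Sum>i\<in>UNIV. of_int (k $ i) * Dg' (drift (axis i 1)))
        - (\<Sum>i\<in>UNIV. of_int (k' $ i) * Dg (drift (axis i 1))) * g' (\<psi> y0)) * character k s0 * character k' s0"
    unfolding wedge_def tensor_def xa xb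
    by (simp add: sum_subtractf sum_distrib_left sum_distrib_right algebra_simps)
  then show ?thesis by (simp only: sum_drift[OF g(2) lin(2)] sum_drift[OF g'(2) lin(1)])
qed

text \<open>The differentials of the test functions span the complexified cotangent space: \<open>\<psi>\<close>-coordinates cut
  off by a bump function, and the characters of the coordinate circles.\<close>

definition coord_fun :: "'f \<Rightarrow> 'f \<Rightarrow> complex" where
  "coord_fun b z = of_real (bump (\<psi> y0) r z * ((z - \<psi> y0) \<bullet> b))"

definition cutoff :: "'f \<Rightarrow> complex" where
  "cutoff z = of_real (bump (\<psi> y0) r z)"

primrec spanning :: "'f + 'n \<Rightarrow> 'm \<Rightarrow> complex" where
  "spanning (Inl b) = symbol (test 0 (coord_fun b))"
| "spanning (Inr i) = symbol (test (axis i 1) cutoff)"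

lemma admissible_cutoff: "admissible cutoff"
proof -
  from smooth_on_compose[OF orthonormal_frame_Basis open_UNIV smooth_on_linear[OF bounded_linear_of_real open_UNIV] smooth_on_bump]
  have "smooth_on UNIV cutoff" by (simp add: cutoff_def[abs_def])
  then show ?thesis by (simp add: admissible_def cutoff_def bump_eq_0[OF r])
qed

lemma admissible_coord_fun: "admissible (coord_fun b)"
proof -
  have aff: "smooth_on UNIV (\<lambda>z. (z - \<psi> y0) \<bullet> b)"
    using smooth_on_add[OF open_UNIV smooth_on_linear[OF bounded_linear_inner_left[of b] open_UNIV]
        smooth_on_const[OF open_UNIV, of "- (\<psi> y0 \<bullet> b)"]] by (simp add: inner_diff_left)
  from smooth_on_bilinear[OF bounded_bilinear_mult open_UNIV smooth_on_bump this]
  have "smooth_on UNIV (\<lambda>z. bump (\<psi> y0) r z * ((z - \<psi> y0) \<bullet> b))" .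
  from smooth_on_compose[OF orthonormal_frame_Basis open_UNIV smooth_on_linear[OF bounded_linear_of_real open_UNIV] this]
  have "smooth_on UNIV (coord_fun b)" by (simp add: coord_fun_def[abs_def])
  then show ?thesis by (simp add: admissible_def coord_fun_def bump_eq_0[OF r])
qed

lemma cutoff_derivative: "(cutoff has_derivative (\<lambda>_. 0)) (at (\<psi> y0))"
  using has_derivative_of_real[OF bump_deriv_center[OF r]] by (simp add: cutoff_def[abs_def])

lemma coord_fun_derivative: "(coord_fun b has_derivative (\<lambda>w. of_real (w \<bullet> b))) (at (\<psi> y0))"
proof -
  have "((\<lambda>z. (z - \<psi> y0) \<bullet> b) has_derivative (\<lambda>w. w \<bullet> b)) (at (\<psi> y0))"
    by (auto intro!: derivative_eq_intros)
  from has_derivative_of_real[OF has_derivative_mult[OF bump_deriv_center[OF r] this]]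
  show ?thesis by (simp add: coord_fun_def[abs_def])
qed

lemma index_set_mem: "0 \<in> index_set" "axis i 1 \<in> index_set"
  by (simp_all add: index_set_def)

text \<open>The bump has value 1 and derivative 0 at the centre, so the cut-off functions have the differentials
  of the coordinates themselves, up to a nonzero factor.\<close>

lemma dcoord_spanning:
  "dcoord (spanning (Inl b)) (w1, w2) = of_real (w1 \<bullet> b)"
  "dcoord (spanning (Inr i)) (w1, w2) = \<i> * of_real (w2 $ i) * character (axis i 1) s0"
proof -
  show "dcoord (spanning (Inl b)) (w1, w2) = of_real (w1 \<bullet> b)"
    using test_dcoord[OF admissible_coord_fun index_set_mem(1) coord_fun_derivative, of b w1 w2]
    by (simp add: coord_fun_def)
  have "(\<Sum>j\<in>UNIV. real_of_int (axis i 1 $ j) * w2 $ j) = (\<Sum>j\<in>UNIV. if j = i then w2 $ i else 0)"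
    by (intro sum.cong refl) (auto simp: axis_def)
  then have "(\<Sum>j\<in>UNIV. real_of_int (axis i 1 $ j) * w2 $ j) = w2 $ i" by simp
  then show "dcoord (spanning (Inr i)) (w1, w2) = \<i> * of_real (w2 $ i) * character (axis i 1) s0"
    using test_dcoord[OF admissible_cutoff index_set_mem(2) cutoff_derivative, of i w1 w2]
    by (simp only: cutoff_def bump_center spanning.simps add_0 of_real_1 mult_1)
qed

lemma spanning_smooth: "smooth_fun A_M (spanning p)"
  by (cases p) (auto intro!: symbol_smooth test_in_Q admissible_coord_fun admissible_cutoff index_set_mem)

lemma brackets_agree: "\<Omega> x0 (spanning p) (spanning q) = Lambda (spanning p) (spanning q)"
proof -
  have sp: "\<exists>k g Dg. spanning p = symbol (test k g) \<and> admissible g \<and> k \<in> index_set \<and>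
    (g has_derivative Dg) (at (\<psi> y0))" for p
    using admissible_coord_fun index_set_mem coord_fun_derivative admissible_cutoff cutoff_derivative
    by (cases p) (simp_all, blast+)
  obtain k g Dg where g: "spanning p = symbol (test k g)" "admissible g" "k \<in> index_set" "(g has_derivative Dg) (at (\<psi> y0))"
    using sp[of p] by blast
  obtain k' g' Dg' where g': "spanning q = symbol (test k' g')" "admissible g'" "k' \<in> index_set" "(g' has_derivative Dg') (at (\<psi> y0))"
    using sp[of q] by blast
  show ?thesis unfolding g(1) g'(1) bracket_test[OF g(2-4) g'(2-4)] Lambda_test[OF g(2-4) g'(2-4)] ..
qed

text \<open>Every differential is a combination of those of the spanning functions, with coefficients that do not
  depend on the tangent vector. Both bivectors are thus determined by their values on that family. On
  functions that are not smooth both are 0 by convention.\<close>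

lemma Omega_eq_Lambda: "\<Omega> x0 = Lambda"
proof (intro ext)
  fix u v
  obtain B :: "'f set" where B: "orthonormal_frame B" by (rule frame_N)
  then have fB: "finite B" by (simp add: orthonormal_frame_def)
  have "\<Omega> x0 \<in> bivectors A_M x0" using poisson M(2) by (simp add: poisson_bivector_def)
  then obtain a b and m :: nat where \<Omega>: "\<Omega> x0 = (\<lambda>u v. \<Sum>j<m. wedge (a j) (b j) u v)"
    and ab: "\<forall>j<m. a j \<in> tangent_space A_M x0 \<and> b j \<in> tangent_space A_M x0"
    unfolding bivectors_def by blast
  let ?xa = "\<lambda>i. xi_alpha A_M \<alpha> (axis i 1) x0" and ?xb = "\<lambda>i. rho_star_xi_beta A_M A_N \<alpha> \<beta> J \<sigma> (axis i 1) x0"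
  show "\<Omega> x0 u v = Lambda u v"
  proof (cases "smooth_fun A_M u \<and> smooth_fun A_M v")
    case False
    have zero: "w f = 0" if "w \<in> tangent_space A_M x0" "\<not> smooth_fun A_M f" for w f
      by (rule tangent_dcoord[OF that(1)]) (simp add: that(2))
    have "wedge (a j) (b j) u v = 0" if "j < m" for j
    proof -
      have "a j \<in> tangent_space A_M x0" "b j \<in> tangent_space A_M x0" using ab that by simp_all
      then have "a j u = 0 \<and> b j u = 0 \<or> a j v = 0 \<and> b j v = 0" using zero False by blast
      then show ?thesis by (auto simp: wedge_def tensor_def)
    qed
    then have "\<Omega> x0 u v = 0" by (simp add: \<Omega>)
    moreover have "Lambda u v = 0"
      using False by (intro sum.neutral) (auto simp: wedge_def tensor_def xi_alpha_dcoord rho_star_dcoord)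
    ultimately show ?thesis by simp
  next
    case True
    define coeff where "coeff f p = (case p of Inl b \<Rightarrow> dcoord f (b, 0)
      | Inr i \<Rightarrow> dcoord f (0, axis i 1) / (\<i> * character (axis i 1) s0))" for f and p :: "'f + 'n"
    let ?P = "B <+> (UNIV :: 'n set)"
    have ne: "character (axis i 1) s0 \<noteq> 0" for i
    proof -
      have "norm (s0 $ j) = 1" for j using s0_torus by (simp add: torus_def)
      then have "s0 $ j \<noteq> 0" for j by (metis norm_zero zero_neq_one)
      then show ?thesis by (simp add: character_def)
    qed
    have expand: "w f = (\<Sum>p\<in>?P. coeff f p * w (spanning p))"
      if w: "\<And>h. smooth_fun A_M h \<Longrightarrow> w h = dcoord h d" and f: "smooth_fun A_M f" for w d f
    proof -
      obtain w1 w2 where d: "d = (w1, w2)" by (cases d)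
      have lin: "linear (dcoord f)" by (rule has_derivative_linear[OF dcoord_derivative[OF f]])
      have "(w1, 0) = (\<Sum>b\<in>B. (w1 \<bullet> b) *\<^sub>R (b, 0 :: real ^ 'n))"
        using B by (simp add: prod_eq_iff fst_sum snd_sum orthonormal_frame_def)
      moreover have "(0, w2) = (\<Sum>i\<in>UNIV. w2 $ i *\<^sub>R (0 :: 'f, axis i 1 :: real ^ 'n))"
        using basis_expansion[of w2] by (simp add: prod_eq_iff fst_sum snd_sum scalar_mult_eq_scaleR)
      ultimately have "d = (\<Sum>b\<in>B. (w1 \<bullet> b) *\<^sub>R (b, 0)) + (\<Sum>i\<in>UNIV. w2 $ i *\<^sub>R (0, axis i 1))"
        unfolding d by (metis add.left_neutral add.right_neutral add_Pair)
      then have "dcoord f d = (\<Sum>b\<in>B. (w1 \<bullet> b) *\<^sub>R dcoord f (b, 0)) + (\<Sum>i\<in>UNIV. w2 $ i *\<^sub>R dcoord f (0, axis i 1))"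
        using lin by (simp only: linear_add linear_sum linear_cmul)
      also have "\<dots> = (\<Sum>p\<in>?P. coeff f p * dcoord (spanning p) d)"
        using fB ne by (simp add: sum.Plus coeff_def d dcoord_spanning scaleR_conv_of_real mult.commute del: spanning.simps)
      finally show ?thesis using w f spanning_smooth by simp
    qed
    have P: "finite ?P" using fB by simp
    have exp_tan: "w f = (\<Sum>p\<in>?P. coeff f p * w (spanning p))"
      if wt: "w \<in> tangent_space A_M x0" "smooth_fun A_M f" for w f
    proof -
      obtain d where "w = (\<lambda>h. if smooth_fun A_M h then dcoord h d else 0)" by (rule tangent_dcoord[OF wt(1)])
      then show ?thesis using expand[of w d f] wt(2) by simp
    qed
    have exp_xi: "?xa i f = (\<Sum>p\<in>?P. coeff f p * ?xa i (spanning p))" "?xb i f = (\<Sum>p\<in>?P. coeff f p * ?xb i (spanning p))"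
      if "smooth_fun A_M f" for f i
      using expand[of "?xa i" "(0, axis i 1)" f] expand[of "?xb i" "(drift (axis i 1), 0)" f] that
      by (simp_all add: xi_alpha_dcoord rho_star_dcoord)
    have "\<Omega> x0 u v = (\<Sum>p\<in>?P. \<Sum>q\<in>?P. coeff u p * coeff v q * \<Omega> x0 (spanning p) (spanning q))"
      unfolding \<Omega> by (rule sum_wedge_expand[OF P]) (use exp_tan ab True in simp)
    also have "\<dots> = (\<Sum>p\<in>?P. \<Sum>q\<in>?P. coeff u p * coeff v q * Lambda (spanning p) (spanning q))"
      by (simp only: brackets_agree)
    also have "\<dots> = Lambda u v"
      by (rule sum_wedge_expand[OF P, symmetric]) (use exp_xi True in simp)
    finally show ?thesis .
  qed
qed

end

theorem theorem3p2:
  fixes A_M :: "('m::{t2_space, second_countable_topology}, 'e::real_inner) atlas"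
    and A_N :: "('p::t2_space, 'f::real_inner) atlas"
    and \<alpha> :: "complex ^ 'n \<Rightarrow> 'm \<Rightarrow> 'm"
    and \<beta> :: "real ^ 'n \<Rightarrow> 'p \<Rightarrow> 'p"
    and J :: "'m \<Rightarrow> 'p" and \<sigma> :: "'p \<Rightarrow> 'm"
    and \<Omega> :: "'m \<Rightarrow> 'm tvec2"
    and \<I> :: "('m \<Rightarrow> complex) \<Rightarrow> (nat \<Rightarrow> real \<times> 'p \<times> (int ^ 'n) \<Rightarrow> complex) set"
  assumes M: "smooth_manifold A_M" "points A_M = UNIV"
    and N: "smooth_manifold A_N" "points A_N = UNIV"
    and alpha: "torus_action \<alpha>"
    and beta: "vector_action A_N \<beta>"
    and Delta: "orbit_projection \<alpha> J" "locally_closed (range J)"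
    and etale: "etale (Ggrp \<alpha> \<beta> J)"
    and J_smooth: "smooth_map A_M A_N J"
    and sigma: "continuous_on (range J) \<sigma>" "\<forall>y\<in>range J. J (\<sigma> y) = y"
    and k_sigma_smooth:
      "\<forall>k. smooth_map (restrict_atlas A_M (J -` Delta_k \<alpha> J k)) circle_atlas (k_sigma \<alpha> J \<sigma> k)"
    and \<I>: "fourier_iso \<alpha> \<beta> J \<sigma> \<I>"
    and poisson: "poisson_bivector A_M \<Omega>"
    and deformation: "deformation_groupoid (Ggrp \<alpha> \<beta> J) fst A_M \<Omega> (Cc_smooth A_N (Ggrp \<alpha> \<beta> J)) \<I>"
    and alpha_diffeo: "\<forall>s\<in>torus. diffeo A_M A_M (\<alpha> s)"
    and Delta_inf: "open (Delta_inf \<alpha> J)" "range J \<subseteq> closure (Delta_inf \<alpha> J)"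
    and rho_diffeo: "diffeo (prod_atlas (restrict_atlas A_N (Delta_inf \<alpha> J)) torus_atlas)
      (restrict_atlas A_M (J -` Delta_inf \<alpha> J)) (rho \<alpha> \<sigma>)"
  shows "\<forall>x \<in> J -` Delta_inf \<alpha> J. \<Omega> x =
    (\<lambda>u v. \<Sum>i\<in>UNIV. wedge (xi_alpha A_M \<alpha> (axis i 1) x)
                          (rho_star_xi_beta A_M A_N \<alpha> \<beta> J \<sigma> (axis i 1) x) u v)"
proof
  fix x assume x: "x \<in> J -` Delta_inf \<alpha> J"
  interpret deformed_torus_action A_M A_N \<alpha> \<beta> J \<sigma> \<Omega> \<I>
    by (rule deformed_torus_action.intro[OF M N alpha beta Delta(1) J_smooth sigma(2) \<I> poisson deformation
          Delta_inf(1) rho_diffeo])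
  have "x \<in> \<rho> ` points A_P" using x bij_betw_imp_surj_on[OF rho_bij] by (simp only:)
  then obtain p where p: "x = \<rho> p" "p \<in> points A_P" by (rule imageE)
  obtain W' \<kappa>' where ch: "(W', \<kappa>') \<in> A_P" "p \<in> W'" using p(2) by (rule pointsE)
  obtain U \<psi> V \<theta> where c: "product_chart A_M A_N \<alpha> \<beta> J \<sigma> \<Omega> \<I> U \<psi> V \<theta>"
    and W': "W' = (U \<inter> Delta_inf \<alpha> J) \<times> V" using ch(1) by (rule A_P_chartE)
  obtain y0 s0 where ys: "p = (y0, s0)" by (cases p)
  interpret product_chart A_M A_N \<alpha> \<beta> J \<sigma> \<Omega> \<I> U \<psi> V \<theta> by (rule c)
  interpret product_chart_at A_M A_N \<alpha> \<beta> J \<sigma> \<Omega> \<I> U \<psi> V \<theta> y0 s0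
    by unfold_locales (use ch(2) W' ys in auto)
  obtain r \<delta> where "test_functions A_M A_N \<alpha> \<beta> J \<sigma> \<Omega> \<I> U \<psi> V \<theta> y0 s0 r \<delta>"
    by (rule test_functions_exist)
  then interpret test_functions A_M A_N \<alpha> \<beta> J \<sigma> \<Omega> \<I> U \<psi> V \<theta> y0 s0 r \<delta> .
  have "x0 = x" using p(1) ys by (simp add: x0_def)
  then show "\<Omega> x = (\<lambda>u v. \<Sum>i\<in>UNIV. wedge (xi_alpha A_M \<alpha> (axis i 1) x)
      (rho_star_xi_beta A_M A_N \<alpha> \<beta> J \<sigma> (axis i 1) x) u v)"
    using Omega_eq_Lambda by simp
qed

end
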